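(* Let $s,t\in\mathbb Z_+$ with $H_{s,t}\neq\{0\}$ and let $B\ge 0$. Let $f$ be a smooth function on $\mathbb C^n$ such that for each non-negative integer $k$ there is a constant $C_k$ with $|z|^k|f(z)|\le C_k e^{-\frac14|z|^2}$ for all $z\in\mathbb C^n$. Suppose $f\times\nu_{r,j}(z)=0$ for all $z\in\mathbb C^n$, all $r>|z|+B$ and all $j$ with $1\le j\le d(s,t)$. Then $f(z)=0$ whenever $|z|>B$.
   Context: $\mathbb Z_+$ is the set of non-negative integers. For $s,t\in\mathbb Z_+$, $P_{s,t}$ is the space of polynomials on $\mathbb C^n$ of the form $P(z)=\sum_{|\alpha|=s}\sum_{|\beta|=t}c_{\alpha\beta}z^\alpha\bar z^\beta$, and $H_{s,t}=\{P\in P_{s,t}:\Delta P=0\}$ with $\Delta$ the standard Laplacian on $\mathbb C^n$; $d(s,t)=\dim H_{s,t}$. Fix an orthonormal basis $\{P_{st}^j:1\le j\le d(s,t)\}$ of $H_{s,t}$ (orthonormal for restrictions to $S^{2n-1}$ in $L^2(S^{2n-1})$). For $r>0$, $\mu_r$ is the normalized surface measure on the sphere $S_r(o)=\{w\in\mathbb C^n:|w|=r\}$ and $d\nu_{r,j}=P_{st}^j\,d\mu_r$. The weighted twisted spherical mean of $f$ is $$f\times\nu_{r,j}(z)=\int_{S_r(o)}f(z-w)\,e^{\frac i2\mathrm{Im}(z\cdot\bar w)}P_{st}^j(w)\,d\mu_r(w),\qquad z\cdot\bar w=\sum_{i=1}^n z_i\bar w_i.$$ *)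

theory Defs
  imports "HOL-Probability.Probability_Measure" "HOL-Analysis.Analysis" "HOL-Library.Function_Algebras"
begin

text \<open>The derivatives are real Frechet derivatives, also on complex spaces.\<close>

primrec Ck :: "nat \<Rightarrow> ('a::real_normed_vector \<Rightarrow> 'b::real_normed_vector) \<Rightarrow> bool" where
  "Ck 0 f \<longleftrightarrow> continuous_on UNIV f"
| "Ck (Suc k) f \<longleftrightarrow> (\<forall>x. f differentiable (at x)) \<and>
     (\<forall>v. Ck k (\<lambda>x. frechet_derivative f (at x) v))"

definition smooth :: "('a::real_normed_vector \<Rightarrow> 'b::real_normed_vector) \<Rightarrow> bool" where
  "smooth f \<longleftrightarrow> (\<forall>k. Ck k f)"

text \<open>On \<open>complex ^ 'n\<close> the set \<^const>\<open>Basis\<close> consists of the \<open>2n\<close> real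
  directions \<open>axis i 1\<close> and \<open>axis i \<i>\<close>, so this is the sum of all
  \<open>\<partial>\<^sup>2/\<partial>x\<^sub>i\<^sup>2 + \<partial>\<^sup>2/\<partial>y\<^sub>i\<^sup>2\<close>.\<close>

definition laplacian :: "('a::euclidean_space \<Rightarrow> 'b::real_normed_vector) \<Rightarrow> 'a \<Rightarrow> 'b" where
  "laplacian f x =
     (\<Sum>b\<in>Basis. frechet_derivative (\<lambda>y. frechet_derivative f (at y) b) (at x) b)"

text \<open>Defined through polar coordinates: a set \<open>A\<close> on the sphere of radius \<open>r > 0\<close> is given
  the normalized volume of the cone \<open>{x. norm x < 1, r x / norm x \<in> A}\<close>. It is a Borel
  measure on the whole space which is concentrated on the sphere.\<close>

definition sphere_measure :: "real \<Rightarrow> 'a::euclidean_space measure" where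
  "sphere_measure r = distr (uniform_measure lborel (ball 0 1)) borel (\<lambda>x. r *\<^sub>R sgn x)"

lemma borel_measurable_radial [measurable]:
  "(\<lambda>x::'a::euclidean_space. r *\<^sub>R sgn x) \<in> borel_measurable borel"
  by (simp add: sgn_div_norm)

lemma sets_sphere_measure [simp, measurable_cong]: "sets (sphere_measure r) = sets borel"
  and space_sphere_measure [simp]: "space (sphere_measure r) = UNIV"
  by (simp_all add: sphere_measure_def)

lemma prob_space_sphere_measure: "prob_space (sphere_measure r :: 'a::euclidean_space measure)"
proof -
  have "emeasure lborel (ball (0::'a) 1) > 0"
    using emeasure_lborel_ball_finite[of "0::'a" 1] content_ball_pos[of 1 "0::'a"]
    by (simp add: measure_def enn2real_positive_iff)
  then have "prob_space (uniform_measure lborel (ball (0::'a) 1))"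
    using emeasure_lborel_ball_finite[of "0::'a" 1]
    by (intro prob_space_uniform_measure) auto
  then show ?thesis
    unfolding sphere_measure_def by (rule prob_space.prob_space_distr) simp
qed

lemma AE_sphere_measure:
  assumes "r > 0"
  shows "AE x in (sphere_measure r :: 'a::euclidean_space measure). x \<in> sphere 0 r"
proof -
  have "AE x in lborel. x \<noteq> (0::'a)"
    by (rule AE_lborel_singleton)
  then have "AE x in uniform_measure lborel (ball (0::'a) 1). r *\<^sub>R sgn x \<in> sphere 0 r"
    using assms by (intro AE_uniform_measureI) (auto simp: norm_sgn)
  moreover have "{x::'a. x \<in> sphere 0 r} \<in> sets borel"
    by simp
  ultimately show ?thesis
    unfolding sphere_measure_def by (subst AE_distr_iff) simp_all
qed

definition multi_indices :: "nat \<Rightarrow> ('n::finite \<Rightarrow> nat) set" where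
  "multi_indices s = {\<alpha>. (\<Sum>i\<in>UNIV. \<alpha> i) = s}"

lemma finite_multi_indices [simp]: "finite (multi_indices s :: ('n::finite \<Rightarrow> nat) set)"
proof (rule finite_subset)
  show "(multi_indices s :: ('n \<Rightarrow> nat) set) \<subseteq> UNIV \<rightarrow>\<^sub>E {..s}"
    by (auto simp: multi_indices_def intro: member_le_sum)
qed (simp add: finite_PiE)

definition monomial :: "('n::finite \<Rightarrow> nat) \<Rightarrow> complex ^ 'n \<Rightarrow> complex" where
  "monomial \<alpha> z = (\<Prod>i\<in>UNIV. (z $ i) ^ \<alpha> i)"

definition bihom_polys :: "nat \<Rightarrow> nat \<Rightarrow> (complex ^ 'n::finite \<Rightarrow> complex) set" where
  "bihom_polys s t =
     {P. \<exists>c. P = (\<lambda>z. \<Sum>\<alpha>\<in>multi_indices s. \<Sum>\<beta>\<in>multi_indices t.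
                     c \<alpha> \<beta> * monomial \<alpha> z * cnj (monomial \<beta> z))}"

definition bihom_harmonics :: "nat \<Rightarrow> nat \<Rightarrow> (complex ^ 'n::finite \<Rightarrow> complex) set" where
  "bihom_harmonics s t = {P \<in> bihom_polys s t. \<forall>z. laplacian P z = 0}"

definition cscale_fun :: "complex \<Rightarrow> ('a \<Rightarrow> complex) \<Rightarrow> 'a \<Rightarrow> complex" where
  "cscale_fun c f = (\<lambda>z. c * f z)"

global_interpretation cfun: vector_space "cscale_fun :: complex \<Rightarrow> ('a \<Rightarrow> complex) \<Rightarrow> _"
  by unfold_locales (auto simp: cscale_fun_def fun_eq_iff algebra_simps)

definition dim_H :: "'n::finite itself \<Rightarrow> nat \<Rightarrow> nat \<Rightarrow> nat" where
  "dim_H _ s t = cfun.dim (bihom_harmonics s t :: (complex ^ 'n \<Rightarrow> complex) set)"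

definition sphere_inner ::
    "(complex ^ 'n::finite \<Rightarrow> complex) \<Rightarrow> (complex ^ 'n \<Rightarrow> complex) \<Rightarrow> complex" where
  "sphere_inner P Q = (\<integral>w. P w * cnj (Q w) \<partial>sphere_measure 1)"

definition orthonormal_basis_H ::
    "nat \<Rightarrow> nat \<Rightarrow> (nat \<Rightarrow> complex ^ 'n::finite \<Rightarrow> complex) \<Rightarrow> bool" where
  "orthonormal_basis_H s t P \<longleftrightarrow>
     (\<forall>j\<in>{1..dim_H TYPE('n) s t}. P j \<in> bihom_harmonics s t) \<and>
     (\<forall>j\<in>{1..dim_H TYPE('n) s t}. \<forall>k\<in>{1..dim_H TYPE('n) s t}.
        sphere_inner (P j) (P k) = (if j = k then 1 else 0)) \<and>
     cfun.span (P ` {1..dim_H TYPE('n) s t}) = bihom_harmonics s t"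

definition hdot :: "complex ^ 'n::finite \<Rightarrow> complex ^ 'n \<Rightarrow> complex" where
  "hdot z w = (\<Sum>i\<in>UNIV. z $ i * cnj (w $ i))"

definition twisted_mean ::
    "(complex ^ 'n::finite \<Rightarrow> complex) \<Rightarrow> (complex ^ 'n \<Rightarrow> complex) \<Rightarrow> real \<Rightarrow> complex ^ 'n \<Rightarrow> complex"
  where
  "twisted_mean f P r z =
     (\<integral>w. f (z - w) * exp (\<i> / 2 * of_real (Im (hdot z w))) * P w \<partial>sphere_measure r)"

end

theory Submission
  imports Defs "HOL-Computational_Algebra.Polynomial" "HOL-Real_Asymp.Real_Asymp"
begin

text \<open>
  Write \<open>\<rho> = |w|\<^sup>2\<close>, let \<open>\<partial>\<^sub>i\<close> and \<open>\<partial>'\<^sub>i\<close> be the derivatives with respect to \<open>w\<^sub>i\<close> and its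
  conjugate \<open>w'\<^sub>i\<close>, and let \<open>n\<close> be the number of complex variables. The twisted convolution
  \<open>f \<times> g\<close> has the property that \<open>f \<times> A\<^sub>i g\<close> and \<open>f \<times> A'\<^sub>i g\<close> with \<open>A\<^sub>i = \<partial>\<^sub>i + w'\<^sub>i / 4\<close> and
  \<open>A'\<^sub>i = \<partial>'\<^sub>i - w\<^sub>i / 4\<close> are first-order differential operators applied to \<open>f \<times> g\<close>
  (\<open>tconv_tderiv\<close>).

  Integrating the hypothesis over \<open>r\<close> shows that \<open>f \<times> P \<phi>(\<rho>) = 0\<close> near the origin for all
  \<open>P \<in> H\<^sub>s\<^sub>t\<close> and all smooth \<open>\<phi>\<close> with compact support in \<open>\<rho> > B\<^sup>2\<close>. Evaluating derivatives at the
  origin, where the twist disappears, gives \<open>\<integral> f (- w) (D (P \<phi>)) (w) dw = 0\<close> for all compositions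
  \<open>D\<close> of the operators \<open>A\<^sub>i\<close>, \<open>A'\<^sub>i\<close>. The decay of \<open>f\<close> permits unbounded supports of \<open>\<phi>\<close>,
  as long as \<open>\<phi>\<close> and its derivatives grow at most like a power of \<open>\<rho>\<close> times \<open>exp (\<rho> / 4)\<close>
  (\<open>annihilated_if_twisted_means_vanish\<close>). This is the point where the precise decay is used:
  the equations \<open>\<phi>' \<plusminus> \<phi> / 4 = \<psi>\<close> and \<open>N \<phi> + \<rho> (\<phi>' \<plusminus> \<phi> / 4) = \<psi>\<close> have solutions supported in
  \<open>\<rho> > B\<^sup>2\<close> within that class for every \<open>\<psi>\<close> in it, but not within the compactly supported functions
  (\<open>profile_ode\<close>, \<open>profile_euler_ode\<close>).

  Call \<open>P\<close> annihilated if the integrals vanish for all such \<open>\<phi>\<close> and \<open>D\<close>. The annihilated polynomials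
  are found in two steps.

  Down: for \<open>Q \<in> H\<^sub>p\<^sub>q\<close> let \<open>P\<^sub>i \<in> H\<^bsub>p+1,q\<^esub>\<close> be the harmonic projection of \<open>w\<^sub>i Q\<close>. Then
  \<open>\<Sum> A\<^sub>i (P\<^sub>i \<phi>) = \<kappa> Q (N \<phi> + \<rho> (\<phi>' + \<phi> / 4))\<close> with \<open>N = n + p + q\<close>
  (\<open>sum_tderiv_raise_harmonic\<close>). Solving the radial equation, \<open>Q\<close> is annihilated if \<open>H\<^bsub>p+1,q\<^esub>\<close> is, and the same holds for
  the conjugate operators. Hence the constants are annihilated (\<open>annihilated_one\<close>). The constant
  \<open>\<kappa>\<close> is zero only if \<open>n = 1\<close>, \<open>p = 0\<close> and \<open>q > 0\<close>; this case is excluded by \<open>H\<^sub>s\<^sub>t \<noteq> 0\<close>, which for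
  \<open>n = 1\<close> means \<open>s = 0\<close> or \<open>t = 0\<close>.

  Up: \<open>A'\<^sub>i (P \<phi>) = \<partial>'\<^sub>i P \<phi> + w\<^sub>i P (\<phi>' - \<phi> / 4)\<close> shows that \<open>w\<^sub>i P\<close> is annihilated if \<open>P\<close> and
  \<open>\<partial>'\<^sub>i P\<close> are, and similarly for \<open>w'\<^sub>i P\<close>. By induction on the degree all polynomials are
  annihilated (\<open>annihilated_wpoly\<close>).

  For \<open>\<phi>\<close> with compact support and \<open>D\<close> the identity, \<open>f (- w) \<phi> (|w|\<^sup>2)\<close> is orthogonal to all polynomials,
  and the Stone--Weierstrass theorem gives \<open>f = 0\<close> on \<open>|w| > B\<close>.
\<close>

section \<open>Polar coordinates\<close>

lemma nn_integral_lborel_scaleR: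
  fixes H :: "'a::euclidean_space \<Rightarrow> ennreal"
  assumes [measurable]: "H \<in> borel_measurable borel" and c: "c > 0"
  shows "(\<integral>\<^sup>+w. H w \<partial>lborel) = ennreal (c ^ DIM('a)) * (\<integral>\<^sup>+x. H (c *\<^sub>R x) \<partial>lborel)"
proof -
  have "(\<integral>\<^sup>+w. H w \<partial>lborel) =
      (\<integral>\<^sup>+w. H w \<partial>density (distr lborel borel (\<lambda>x::'a. 0 + c *\<^sub>R x)) (\<lambda>_. ennreal (\<bar>c\<bar> ^ DIM('a))))"
    using lborel_affine[of c "0::'a"] c by simp
  also have "\<dots> = ennreal (c ^ DIM('a)) * (\<integral>\<^sup>+x. H (c *\<^sub>R x) \<partial>lborel)"
    using c by (simp add: nn_integral_density nn_integral_distr nn_integral_cmult)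
  finally show ?thesis .
qed

lemma nn_integral_inverse_power_tail:
  fixes a :: real and d :: nat
  assumes a: "a > 0" and d: "d > 0"
  shows "(\<integral>\<^sup>+\<mu>. ennreal (real d / \<mu> ^ Suc d) * indicator {a..} \<mu> \<partial>lborel) = ennreal (1 / a ^ d)"
proof -
  have "(\<integral>\<^sup>+\<mu>. ennreal (real d / \<mu> ^ Suc d) * indicator {a..} \<mu> \<partial>lborel) = ennreal (0 - (- (1 / a ^ d)))"
  proof (rule nn_integral_FTC_atLeast)
    fix x :: real assume x: "a \<le> x"
    with a have "x > 0" by simp
    then show "DERIV (\<lambda>x. - (1 / x ^ d)) x :> real d / x ^ Suc d"
    proof -
      obtain m where m: "d = Suc m" using d by (cases d) auto
      have "DERIV (\<lambda>x. - (1 / x ^ d)) x :> d * x ^ m / (x ^ d * x ^ d)"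
        using \<open>x > 0\<close> unfolding m by (auto intro!: derivative_eq_intros) (cases m; simp add: field_simps)
      also have "d * x ^ m / (x ^ d * x ^ d) = real d / x ^ Suc d"
        using \<open>x > 0\<close> unfolding m by (simp add: field_simps)
      finally show ?thesis .
    qed
    show "0 \<le> real d / x ^ Suc d" using \<open>x > 0\<close> by simp
  next
    have "((\<lambda>x::real. inverse (x ^ d)) \<longlongrightarrow> 0) at_top"
      using d by (intro tendsto_inverse_0_at_top filterlim_pow_at_top filterlim_ident) auto
    then show "((\<lambda>x::real. - (1 / x ^ d)) \<longlongrightarrow> 0) at_top"
      using tendsto_minus[of "\<lambda>x::real. inverse (x ^ d)" 0 at_top] by (simp add: inverse_eq_divide)
  qed simp
  then show ?thesis by simp
qed

text \<open>The two iterated integrals are compared through a third one, of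
\<open>d \<lambda>\<^bsup>d-1\<^esup> |x|\<^sup>d H (\<lambda> x)\<close> over \<open>\<lambda> > 0\<close> and \<open>|x| < 1\<close>. For fixed \<open>x\<close>, the substitution
\<open>r = \<lambda> |x|\<close> gives the polar integral along the ray through \<open>x\<close>; for fixed \<open>\<lambda>\<close>, the substitution
\<open>w = \<lambda> x\<close> leaves the integral of \<open>d |w|\<^sup>d / \<lambda>\<^bsup>d+1\<^esup>\<close> over \<open>\<lambda> > |w|\<close>, which is \<open>1\<close>. Only the scaling of
Lebesgue measure is used, and the unit ball in place of the unit sphere matches the definition of
\<^const>\<open>sphere_measure\<close>.\<close>

lemma nn_integral_polar:
  fixes H :: "'a::euclidean_space \<Rightarrow> ennreal"
  assumes [measurable]: "H \<in> borel_measurable borel"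
  defines "d \<equiv> DIM('a)"
  shows "(\<integral>\<^sup>+w. H w \<partial>lborel) =
     (\<integral>\<^sup>+r. (ennreal (real d * r ^ (d - 1)) * indicator {0<..} r) *
        (\<integral>\<^sup>+x. indicator (ball 0 1) x * H (r *\<^sub>R sgn x) \<partial>lborel) \<partial>lborel)"
proof -
  define \<kappa> where "\<kappa> r = ennreal (real d * r ^ (d - 1)) * indicator {0<..} r" for r :: real
  have [measurable]: "\<kappa> \<in> borel_measurable borel" unfolding \<kappa>_def by measurable
  have [measurable]: "(\<lambda>x::'a. sgn x) \<in> borel_measurable borel"
    using borel_measurable_radial[of 1] by simp
  define b :: "'a \<Rightarrow> ennreal" where "b = indicator (ball 0 1)"
  have [measurable]: "b \<in> borel_measurable borel" unfolding b_def by (rule borel_measurable_indicator) simp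
  have d: "d > 0" by (simp add: d_def)
  have "(\<integral>\<^sup>+r. \<kappa> r * (\<integral>\<^sup>+x. b x * H (r *\<^sub>R sgn x) \<partial>lborel) \<partial>lborel)
      = (\<integral>\<^sup>+r. (\<integral>\<^sup>+x. \<kappa> r * (b x * H (r *\<^sub>R sgn x)) \<partial>lborel) \<partial>lborel)"
    by (subst nn_integral_cmult) (auto simp: sgn_div_norm)
  also have "\<dots> = (\<integral>\<^sup>+x. (\<integral>\<^sup>+r. \<kappa> r * (b x * H (r *\<^sub>R sgn x)) \<partial>lborel) \<partial>lborel)"
    by (rule lborel_pair.Fubini') (simp add: sgn_div_norm)
  also have "\<dots> = (\<integral>\<^sup>+x. (\<integral>\<^sup>+\<mu>. \<kappa> \<mu> * (ennreal (norm x ^ d) * b x * H (\<mu> *\<^sub>R x)) \<partial>lborel) \<partial>lborel)"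
  proof (rule nn_integral_cong_AE)
    have "AE x in lborel. x \<noteq> (0::'a)" by (rule AE_lborel_singleton)
    then show "AE x in lborel. (\<integral>\<^sup>+r. \<kappa> r * (b x * H (r *\<^sub>R sgn x)) \<partial>lborel) =
        (\<integral>\<^sup>+\<mu>. \<kappa> \<mu> * (ennreal (norm x ^ d) * b x * H (\<mu> *\<^sub>R x)) \<partial>lborel)"
    proof (eventually_elim)
      case (elim x)
      define c where "c = norm x"
      have c: "c > 0" using elim by (simp add: c_def)
      have "(\<integral>\<^sup>+r. \<kappa> r * (b x * H (r *\<^sub>R sgn x)) \<partial>lborel)
         = ennreal \<bar>c\<bar> * (\<integral>\<^sup>+\<mu>. \<kappa> (0 + c * \<mu>) * (b x * H ((0 + c * \<mu>) *\<^sub>R sgn x)) \<partial>lborel)"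
        using c by (intro nn_integral_real_affine) auto
      also have "\<dots> = (\<integral>\<^sup>+\<mu>. ennreal c * (\<kappa> (c * \<mu>) * (b x * H ((c * \<mu>) *\<^sub>R sgn x))) \<partial>lborel)"
        using c by (subst nn_integral_cmult) auto
      also have "\<dots> = (\<integral>\<^sup>+\<mu>. \<kappa> \<mu> * (ennreal (norm x ^ d) * b x * H (\<mu> *\<^sub>R x)) \<partial>lborel)"
      proof (rule nn_integral_cong)
        fix \<mu> :: real
        have 1: "(c * \<mu>) *\<^sub>R sgn x = \<mu> *\<^sub>R x"
          using c by (simp add: sgn_div_norm c_def)
        have 2: "ennreal c * \<kappa> (c * \<mu>) = \<kappa> \<mu> * ennreal (c ^ d)"
        proof (cases "\<mu> > 0")
          case True
          have "c * (real d * (c * \<mu>) ^ (d - 1)) = real d * \<mu> ^ (d - 1) * c ^ d"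
            using d by (cases d) (auto simp: power_mult_distrib)
          then show ?thesis using True c
            by (simp add: \<kappa>_def indicator_def flip: ennreal_mult')
        next
          case False
          then show ?thesis using c by (simp add: \<kappa>_def indicator_def zero_less_mult_iff)
        qed
        show "ennreal c * (\<kappa> (c * \<mu>) * (b x * H ((c * \<mu>) *\<^sub>R sgn x))) =
          \<kappa> \<mu> * (ennreal (norm x ^ d) * b x * H (\<mu> *\<^sub>R x))"
          unfolding 1 c_def[symmetric] by (metis 2 mult.assoc)
      qed
      finally show ?case .
    qed
  qed
  also have "\<dots> = (\<integral>\<^sup>+\<mu>. (\<integral>\<^sup>+x. \<kappa> \<mu> * (ennreal (norm x ^ d) * b x * H (\<mu> *\<^sub>R x)) \<partial>lborel) \<partial>lborel)"
    by (rule lborel_pair.Fubini'[symmetric]) simp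
  also have "\<dots> = (\<integral>\<^sup>+\<mu>. (\<integral>\<^sup>+w. (ennreal (real d / \<mu> ^ Suc d) * indicator {0<..} \<mu> * indicator {w. norm w < \<mu>} w) * (ennreal (norm w ^ d) * H w) \<partial>lborel) \<partial>lborel)"
  proof (rule nn_integral_cong)
    fix \<mu> :: real
    show "(\<integral>\<^sup>+x. \<kappa> \<mu> * (ennreal (norm x ^ d) * b x * H (\<mu> *\<^sub>R x)) \<partial>lborel) =
     (\<integral>\<^sup>+w. (ennreal (real d / \<mu> ^ Suc d) * indicator {0<..} \<mu> * indicator {w. norm w < \<mu>} w) * (ennreal (norm w ^ d) * H w) \<partial>lborel)"
    proof (cases "\<mu> > 0")
      case True
      have "(\<integral>\<^sup>+w. (ennreal (real d / \<mu> ^ Suc d) * indicator {0<..} \<mu> * indicator {w. norm w < \<mu>} w) * (ennreal (norm w ^ d) * H w) \<partial>lborel)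
        = ennreal (\<mu> ^ d) * (\<integral>\<^sup>+x. (ennreal (real d / \<mu> ^ Suc d) * indicator {0<..} \<mu> * indicator {w. norm w < \<mu>} (\<mu> *\<^sub>R x)) * (ennreal (norm (\<mu> *\<^sub>R x) ^ d) * H (\<mu> *\<^sub>R x)) \<partial>lborel)"
        using True unfolding d_def by (intro nn_integral_lborel_scaleR) measurable
      also have "\<dots> = (\<integral>\<^sup>+x. ennreal (\<mu> ^ d) * ((ennreal (real d / \<mu> ^ Suc d) * indicator {0<..} \<mu> * indicator {w. norm w < \<mu>} (\<mu> *\<^sub>R x)) * (ennreal (norm (\<mu> *\<^sub>R x) ^ d) * H (\<mu> *\<^sub>R x))) \<partial>lborel)"
        by (subst nn_integral_cmult) auto
      also have "\<dots> = (\<integral>\<^sup>+x. \<kappa> \<mu> * (ennreal (norm x ^ d) * b x * H (\<mu> *\<^sub>R x)) \<partial>lborel)"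
      proof (rule nn_integral_cong)
        fix x :: 'a
        have 1: "ennreal (\<mu> ^ d) * ennreal (real d / \<mu> ^ Suc d) * ennreal (norm (\<mu> *\<^sub>R x) ^ d) = ennreal (real d * \<mu> ^ (d - 1)) * ennreal (norm x ^ d)"
        proof -
          have "\<mu> ^ d * (real d / \<mu> ^ Suc d) * norm (\<mu> *\<^sub>R x) ^ d = real d * \<mu> ^ (d - 1) * norm x ^ d"
            using True d by (cases d) (auto simp: power_mult_distrib field_simps)
          then show ?thesis using True by (simp flip: ennreal_mult')
        qed
        have 2: "indicator {w. norm w < \<mu>} (\<mu> *\<^sub>R x) = b x"
          using True by (auto simp: indicator_def b_def)
        have 3: "indicator {0<..} \<mu> = (1 :: ennreal)" using True by simp
        show "ennreal (\<mu> ^ d) * ((ennreal (real d / \<mu> ^ Suc d) * indicator {0<..} \<mu> * indicator {w. norm w < \<mu>} (\<mu> *\<^sub>R x)) * (ennreal (norm (\<mu> *\<^sub>R x) ^ d) * H (\<mu> *\<^sub>R x))) = \<kappa> \<mu> * (ennreal (norm x ^ d) * b x * H (\<mu> *\<^sub>R x))"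
        proof -
          have rearr: "a * ((q * 1 * b x) * (p * h)) = (a * q * p) * (b x * h)" for a q p h :: ennreal
            by (simp add: ac_simps)
          show ?thesis unfolding 2 3 rearr 1 \<kappa>_def by (simp add: ac_simps)
        qed
      qed
      finally show ?thesis by simp
    next
      case False
      then show ?thesis by (simp add: \<kappa>_def)
    qed
  qed
  also have "\<dots> = (\<integral>\<^sup>+w. (\<integral>\<^sup>+\<mu>. (ennreal (real d / \<mu> ^ Suc d) * indicator {0<..} \<mu> * indicator {w. norm w < \<mu>} w) * (ennreal (norm w ^ d) * H w) \<partial>lborel) \<partial>lborel)"
    by (rule lborel_pair.Fubini') simp
  also have "\<dots> = (\<integral>\<^sup>+w. H w \<partial>lborel)"
  proof (rule nn_integral_cong_AE)
    have "AE x in lborel. x \<noteq> (0::'a)" by (rule AE_lborel_singleton)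
    then show "AE w in lborel. (\<integral>\<^sup>+\<mu>. (ennreal (real d / \<mu> ^ Suc d) * indicator {0<..} \<mu> * indicator {w. norm w < \<mu>} w) * (ennreal (norm w ^ d) * H w) \<partial>lborel) = H w"
    proof eventually_elim
      case (elim w)
      have "(\<integral>\<^sup>+\<mu>. (ennreal (real d / \<mu> ^ Suc d) * indicator {0<..} \<mu> * indicator {w. norm w < \<mu>} w) * (ennreal (norm w ^ d) * H w) \<partial>lborel)
        = (\<integral>\<^sup>+\<mu>. (ennreal (real d / \<mu> ^ Suc d) * indicator {0<..} \<mu> * indicator {w. norm w < \<mu>} w) \<partial>lborel) * (ennreal (norm w ^ d) * H w)"
        by (subst nn_integral_multc) auto
      also have "(\<integral>\<^sup>+\<mu>. (ennreal (real d / \<mu> ^ Suc d) * indicator {0<..} \<mu> * indicator {w. norm w < \<mu>} w) \<partial>lborel)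
         = (\<integral>\<^sup>+\<mu>. (ennreal (real d / \<mu> ^ Suc d) * indicator {norm w..} \<mu>) \<partial>lborel)"
      proof (rule nn_integral_cong_AE)
        have "AE \<mu> in lborel. \<mu> \<noteq> norm w" by (rule AE_lborel_singleton)
        then show "AE \<mu> in lborel. ennreal (real d / \<mu> ^ Suc d) * indicator {0<..} \<mu> * indicator {w. norm w < \<mu>} w = ennreal (real d / \<mu> ^ Suc d) * indicator {norm w..} \<mu>"
        proof eventually_elim
          case (elim \<mu>)
          then show ?case
            by (cases "norm w < \<mu>")
              (use le_less_trans[OF norm_ge_zero[of w]] in \<open>auto simp: indicator_def\<close>)
        qed
      qed
      also have "\<dots> = ennreal (1 / norm w ^ d)"
        using elim d by (intro nn_integral_inverse_power_tail) auto
      also have "\<dots> * (ennreal (norm w ^ d) * H w) = H w"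
        using elim by (simp add: mult.assoc[symmetric] flip: ennreal_mult')
      finally show ?case .
    qed
  qed
  finally show ?thesis unfolding \<kappa>_def b_def by simp
qed

text \<open>By the polar formula for indicator functions, Lebesgue measure is the image of a product
measure under \<open>(r, x) \<mapsto> r sgn x\<close>. This gives Fubini for integrable functions, and the inner
integral is the one over the sphere of radius \<open>r\<close>.\<close>

lemma integral_eq_0_if_sphere_integrals_eq_0:
  fixes h :: "'a::euclidean_space \<Rightarrow> complex"
  assumes h: "integrable lborel h"
    and zero: "\<And>r. r > 0 \<Longrightarrow> (\<integral>x. h x \<partial>sphere_measure r) = 0"
  shows "(\<integral>x. h x \<partial>lborel) = 0"
proof -
  define d where "d = DIM('a)"
  define V where "V = emeasure lborel (ball (0::'a) 1)"
  define U :: "'a measure" where "U = uniform_measure lborel (ball 0 1)"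
  \<comment> \<open>The inner integral below is an average over the unit ball; the factor \<open>V\<close> undoes the normalization.\<close>
  define k where "k = (\<lambda>r::real. V * (ennreal (real d * r ^ (d - 1)) * indicator {0<..} r))"
  define N where "N = density lborel k \<Otimes>\<^sub>M U"
  have V0: "V \<noteq> 0" and Vfin: "V \<noteq> \<infinity>"
    using emeasure_lborel_ball_finite[of "0::'a" 1] content_ball_pos[of 1 "0::'a"]
    by (auto simp: V_def measure_def)
  have [measurable]: "h \<in> borel_measurable borel" using h by (auto dest: borel_measurable_integrable)
  have [measurable]: "k \<in> borel_measurable borel" unfolding k_def by simp
  have [measurable]: "(\<lambda>(r, x::'a). r *\<^sub>R sgn x) \<in> borel_measurable (borel \<Otimes>\<^sub>M borel)"
    by (simp add: sgn_div_norm)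
  have [measurable_cong, simp]: "sets U = sets borel" by (simp add: U_def)
  have mN[measurable]: "(\<lambda>(r, x::'a). r *\<^sub>R sgn x) \<in> borel_measurable N"
    unfolding N_def by simp
  interpret U: prob_space U
    unfolding U_def using V0 Vfin by (intro prob_space_uniform_measure) (auto simp: V_def)
  have sfU: "sigma_finite_measure U" ..
  have sfk: "sigma_finite_measure (density lborel k)"
    using Vfin by (subst sigma_finite_measure.sigma_finite_iff_density_finite[OF sigma_finite_lborel])
      (auto simp: k_def indicator_def ennreal_mult_eq_top_iff intro!: AE_I2)
  interpret pair_sigma_finite "density lborel k" U
    using sfU sfk by (simp add: pair_sigma_finite_def)
  have polar: "lborel = distr N borel (\<lambda>(r, x::'a). r *\<^sub>R sgn x)"
  proof (rule measure_eqI)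
    fix A :: "'a set" assume "A \<in> sets lborel"
    then have A[measurable]: "A \<in> sets borel" by simp
    have inner: "(\<integral>\<^sup>+x. indicator A (r *\<^sub>R sgn x) \<partial>U)
        = (\<integral>\<^sup>+x. indicator (ball 0 1) x * indicator A (r *\<^sub>R sgn x) \<partial>lborel) / V" for r
      unfolding U_def V_def
      by (subst nn_integral_uniform_measure) (simp, simp add: sgn_div_norm, simp only: mult.commute)
    have "emeasure (distr N borel (\<lambda>(r, x). r *\<^sub>R sgn x)) A
        = (\<integral>\<^sup>+p. indicator A (case p of (r, x) \<Rightarrow> r *\<^sub>R sgn x) \<partial>N)"
      by (subst nn_integral_indicator[symmetric], simp, subst nn_integral_distr) auto
    also have "\<dots> = (\<integral>\<^sup>+r. \<integral>\<^sup>+x. indicator A (r *\<^sub>R sgn x) \<partial>U \<partial>density lborel k)"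
      unfolding N_def by (subst U.nn_integral_fst[symmetric]) (auto simp: split_beta')
    also have "\<dots> = (\<integral>\<^sup>+r. k r * ((\<integral>\<^sup>+x. indicator (ball 0 1) x * indicator A (r *\<^sub>R sgn x) \<partial>lborel) / V) \<partial>lborel)"
      unfolding inner[symmetric]
      by (subst nn_integral_density) (auto simp: sgn_div_norm)
    also have "\<dots> = (\<integral>\<^sup>+r. (ennreal (real d * r ^ (d - 1)) * indicator {0<..} r) *
          (\<integral>\<^sup>+x. indicator (ball 0 1) x * indicator A (r *\<^sub>R sgn x) \<partial>lborel) \<partial>lborel)"
    proof (rule nn_integral_cong)
      fix r :: real
      have "V * a * (c / V) = a * c" for a c
      proof -
        have "V * (c / V) = c"
          using ennreal_mult_divide_eq[of V c] V0 Vfin by (simp add: ennreal_times_divide mult.commute)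
        then show ?thesis by (metis mult.assoc mult.commute)
      qed
      then show "k r * ((\<integral>\<^sup>+x. indicator (ball 0 1) x * indicator A (r *\<^sub>R sgn x) \<partial>lborel) / V) =
        (ennreal (real d * r ^ (d - 1)) * indicator {0<..} r) *
          (\<integral>\<^sup>+x. indicator (ball 0 1) x * indicator A (r *\<^sub>R sgn x) \<partial>lborel)"
        unfolding k_def .
    qed
    also have "\<dots> = emeasure lborel A"
      unfolding d_def by (subst nn_integral_polar[symmetric]) auto
    finally show "emeasure lborel A = emeasure (distr N borel (\<lambda>(r, x). r *\<^sub>R sgn x)) A" by simp
  qed simp
  have int: "integrable N (\<lambda>(r, x). h (r *\<^sub>R sgn x))"
    using h mN by (subst (asm) polar, subst (asm) integrable_distr_eq) (auto simp: split_beta')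
  have "(\<integral>x. h x \<partial>lborel) = (\<integral>p. (case p of (r, x) \<Rightarrow> h (r *\<^sub>R sgn x)) \<partial>N)"
    using mN by (subst polar, subst integral_distr) (auto simp: split_beta')
  also have "\<dots> = (\<integral>r. (\<integral>x. h (r *\<^sub>R sgn x) \<partial>U) \<partial>density lborel k)"
    using integral_fst'[OF int[unfolded N_def]] unfolding N_def by simp
  also have "\<dots> = 0"
  proof (rule integral_eq_zero_AE)
    have "(\<integral>x. h (r *\<^sub>R sgn x) \<partial>U) = 0" if "r > 0" for r
      using zero[OF that] unfolding sphere_measure_def U_def
      by (subst (asm) integral_distr) auto
    then show "AE r in density lborel k. (\<integral>x. h (r *\<^sub>R sgn x) \<partial>U) = 0"
      by (subst AE_density) (auto simp: k_def indicator_def intro!: AE_I2)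
  qed
  finally show ?thesis .
qed

text \<open>The exponent is one more than the dimension, so that in polar coordinates the integrand is
dominated by \<open>1 / (1 + r)\<^sup>2\<close>.\<close>

lemma integrable_inverse_power:
  "integrable lborel (\<lambda>w::'a::euclidean_space. 1 / (1 + norm w) ^ Suc DIM('a))"
proof (rule integrableI_nonneg)
  define d where "d = DIM('a)"
  have d: "d > 0" by (simp add: d_def)
  define V where "V = emeasure lborel (ball (0::'a) 1)"
  have Vfin: "V < \<infinity>" using emeasure_lborel_ball_finite[of "0::'a" 1] by (simp add: V_def)
  have bound: "(ennreal (real d * r ^ (d - 1)) * indicator {0<..} r) *
        (\<integral>\<^sup>+x. indicator (ball 0 1) x * ennreal (1 / (1 + norm (r *\<^sub>R sgn (x::'a))) ^ Suc d) \<partial>lborel)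
      \<le> ennreal (real d) * V * (ennreal (1 / (1 + r) ^ 2) * indicator {0..} r)" for r :: real
  proof (cases "r > 0")
    case True
    have "(\<integral>\<^sup>+x. indicator (ball 0 1) x * ennreal (1 / (1 + norm (r *\<^sub>R sgn (x::'a))) ^ Suc d) \<partial>lborel)
       = (\<integral>\<^sup>+x. ennreal (1 / (1 + r) ^ Suc d) * indicator (ball (0::'a) 1) x \<partial>lborel)"
    proof (rule nn_integral_cong_AE)
      have "AE x in lborel. x \<noteq> (0::'a)" by (rule AE_lborel_singleton)
      then show "AE x in lborel. indicator (ball 0 1) x * ennreal (1 / (1 + norm (r *\<^sub>R sgn (x::'a))) ^ Suc d) =
        ennreal (1 / (1 + r) ^ Suc d) * indicator (ball 0 1) x"
      proof eventually_elim
        case (elim x)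
        then show ?case using True by (simp add: norm_sgn mult.commute)
      qed
    qed
    also have "\<dots> = ennreal (1 / (1 + r) ^ Suc d) * V"
      unfolding V_def by (subst nn_integral_cmult_indicator) simp_all
    finally have eq: "(\<integral>\<^sup>+x. indicator (ball 0 1) x * ennreal (1 / (1 + norm (r *\<^sub>R sgn (x::'a))) ^ Suc d) \<partial>lborel)
       = ennreal (1 / (1 + r) ^ Suc d) * V" .
    have "real d * r ^ (d - 1) * (1 / (1 + r) ^ Suc d) \<le> real d * (1 / (1 + r) ^ 2)"
    proof -
      obtain m where m: "d = Suc m" using d by (cases d) auto
      have "r ^ m \<le> (1 + r) ^ m" using True by (intro power_mono) auto
      then have "r ^ m / (1 + r) ^ m * (real d * (1 / (1 + r) ^ 2)) \<le> 1 * (real d * (1 / (1 + r) ^ 2))"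
        using True by (intro mult_right_mono) auto
      also have "r ^ m / (1 + r) ^ m * (real d * (1 / (1 + r) ^ 2)) = real d * r ^ (d - 1) * (1 / (1 + r) ^ Suc d)"
        using True unfolding m by (simp add: power2_eq_square ac_simps)
      finally show ?thesis by simp
    qed
    then have "ennreal (real d * r ^ (d - 1) * (1 / (1 + r) ^ Suc d)) \<le> ennreal (real d * (1 / (1 + r) ^ 2))"
      by (rule ennreal_leI)
    then have "ennreal (real d * r ^ (d - 1)) * ennreal (1 / (1 + r) ^ Suc d) \<le> ennreal (real d) * ennreal (1 / (1 + r) ^ 2)"
      using True by (simp only: ennreal_mult'[symmetric] zero_le_mult_iff zero_le_divide_iff of_nat_0_le_iff zero_le_power less_imp_le) (auto simp flip: ennreal_mult')
    then have "ennreal (real d * r ^ (d - 1)) * ennreal (1 / (1 + r) ^ Suc d) * V \<le> ennreal (real d) * ennreal (1 / (1 + r) ^ 2) * V"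
      by (rule mult_right_mono) simp
    then show ?thesis using True unfolding eq by (simp add: mult.assoc mult.commute mult.left_commute)
  qed simp
  have "(\<integral>\<^sup>+w. ennreal (1 / (1 + norm (w::'a)) ^ Suc d) \<partial>lborel) \<le>
     (\<integral>\<^sup>+r. ennreal (real d) * V * (ennreal (1 / (1 + r) ^ 2) * indicator {0..} r) \<partial>lborel)"
    by (subst nn_integral_polar, simp) (use bound in \<open>auto intro!: nn_integral_mono simp: d_def\<close>)
  also have "\<dots> = ennreal (real d) * V * (\<integral>\<^sup>+r. ennreal (1 / (1 + r) ^ 2) * indicator {0..} r \<partial>lborel)"
    by (rule nn_integral_cmult) simp
  also have "(\<integral>\<^sup>+r. ennreal (1 / (1 + r) ^ 2) * indicator {0..} r \<partial>lborel) = ennreal (0 - (- (1 / (1 + 0))))"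
  proof (rule nn_integral_FTC_atLeast)
    fix x :: real assume "0 \<le> x"
    then show "DERIV (\<lambda>x. - (1 / (1 + x))) x :> 1 / (1 + x) ^ 2"
      by (auto intro!: derivative_eq_intros simp: power2_eq_square)
  next
    have "((\<lambda>x::real. inverse (1 + x)) \<longlongrightarrow> 0) at_top"
      by (intro tendsto_inverse_0_at_top filterlim_tendsto_add_at_top[OF tendsto_const] filterlim_ident)
    from tendsto_minus[OF this] show "((\<lambda>x::real. - (1 / (1 + x))) \<longlongrightarrow> 0) at_top"
      by (simp add: inverse_eq_divide)
  qed auto
  also have "ennreal (real d) * V * ennreal (0 - (- (1 / (1 + 0)))) < \<infinity>"
    using Vfin by (simp add: ennreal_mult_less_top)
  finally show "(\<integral>\<^sup>+w. ennreal (1 / (1 + norm (w::'a)) ^ Suc DIM('a)) \<partial>lborel) < \<infinity>"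
    unfolding d_def .
qed auto

section \<open>Wirtinger derivatives of polynomials\<close>

definition coord :: "bool \<Rightarrow> 'n::finite \<Rightarrow> complex ^ 'n \<Rightarrow> complex" where
  "coord b i w = (if b then w $ i else cnj (w $ i))"

text \<open>The Wirtinger derivative \<open>\<partial>/\<partial>z\<^sub>i\<close> if \<open>b\<close> holds, and \<open>\<partial>/\<partial>\<close> of the conjugate of \<open>z\<^sub>i\<close> otherwise.
Indexing both kinds of coordinates and derivatives by a truth value lets one proof serve a
statement and its complex conjugate.\<close>

definition wirt :: "bool \<Rightarrow> 'n::finite \<Rightarrow> (complex ^ 'n \<Rightarrow> complex) \<Rightarrow> complex ^ 'n \<Rightarrow> complex" where
  "wirt b i g w = (frechet_derivative g (at w) (axis i 1)
      - (if b then \<i> else - \<i>) * frechet_derivative g (at w) (axis i \<i>)) / 2"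

lemma wirt_eqI:
  assumes "(g has_derivative g') (at w)"
  shows "wirt b i g w = (g' (axis i 1) - (if b then \<i> else - \<i>) * g' (axis i \<i>)) / 2"
  using frechet_derivative_at[OF assms] by (simp add: wirt_def)

lemma bounded_linear_coord: "bounded_linear (coord b i)"
proof (cases b)
  case True
  then have "coord b i = (\<lambda>w. w $ i)" by (auto simp: coord_def fun_eq_iff)
  then show ?thesis by (simp add: bounded_linear_vec_nth)
next
  case False
  then have "coord b i = (\<lambda>w. cnj (w $ i))" by (auto simp: coord_def fun_eq_iff)
  then show ?thesis
    using bounded_linear_compose[OF bounded_linear_cnj bounded_linear_vec_nth] by simp
qed

lemma has_derivative_coord: "(coord b i has_derivative coord b i) (at w)"
  by (rule bounded_linear_imp_has_derivative[OF bounded_linear_coord])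

lemma differentiable_coord [simp]: "coord b i differentiable (at w)"
  using has_derivative_coord by (auto simp: differentiable_def)

lemma norm_coord_le: "norm (coord b i w) \<le> norm w"
  by (auto simp: coord_def Finite_Cartesian_Product.norm_nth_le)

lemma wirt_coord: "wirt b i (coord b' j) w = (if b = b' \<and> i = j then 1 else 0)"
  by (subst wirt_eqI[OF has_derivative_coord]) (auto simp: coord_def axis_def)

lemma wirt_const [simp]: "wirt b i (\<lambda>_. c) = (\<lambda>_. 0)"
  by (rule ext, subst wirt_eqI[OF has_derivative_const]) simp

lemma wirt_add:
  assumes "g differentiable (at w)" "h differentiable (at w)"
  shows "wirt b i (\<lambda>w. g w + h w) w = wirt b i g w + wirt b i h w"
proof -
  obtain g' h' where *: "(g has_derivative g') (at w)" "(h has_derivative h') (at w)"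
    using assms by (auto simp: differentiable_def)
  show ?thesis
    unfolding wirt_eqI[OF *(1)] wirt_eqI[OF *(2)] wirt_eqI[OF has_derivative_add[OF *]]
    by (simp add: field_simps)
qed

lemma wirt_mult:
  assumes "g differentiable (at w)" "h differentiable (at w)"
  shows "wirt b i (\<lambda>w. g w * h w) w = wirt b i g w * h w + g w * wirt b i h w"
proof -
  obtain g' h' where *: "(g has_derivative g') (at w)" "(h has_derivative h') (at w)"
    using assms by (auto simp: differentiable_def)
  show ?thesis
    unfolding wirt_eqI[OF *(1)] wirt_eqI[OF *(2)] wirt_eqI[OF has_derivative_mult[OF *]]
    by (simp add: field_simps)
qed

lemma wirt_cmult:
  "g differentiable (at w) \<Longrightarrow> wirt b i (\<lambda>w. c * g w) w = c * wirt b i g w"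
  by (simp add: wirt_mult)

lemma has_derivative_radial:
  fixes w :: "'a::real_inner"
  assumes "(F has_real_derivative F') (at ((norm w)\<^sup>2))"
  shows "((\<lambda>w. complex_of_real (F ((norm w)\<^sup>2))) has_derivative (\<lambda>h. of_real (F' * (2 * (w \<bullet> h))))) (at w)"
proof -
  have 1: "((\<lambda>w::'a. (norm w)\<^sup>2) has_derivative (\<lambda>h. 2 * (w \<bullet> h))) (at w)"
    unfolding power2_norm_eq_inner by (auto intro!: derivative_eq_intros simp: inner_commute)
  have "((\<lambda>w::'a. F ((norm w)\<^sup>2)) has_derivative (\<lambda>h. F' * (2 * (w \<bullet> h)))) (at w)"
    using has_derivative_compose[OF 1, of F "\<lambda>h. F' * h"] assms
    by (simp add: has_field_derivative_def)
  from bounded_linear.has_derivative[OF bounded_linear_of_real this] show ?thesis by simp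
qed

lemma wirt_radial:
  assumes "(F has_real_derivative F') (at ((norm w)\<^sup>2))"
  shows "wirt b i (\<lambda>w. complex_of_real (F ((norm w)\<^sup>2))) w = coord (\<not> b) i w * of_real F'"
  unfolding wirt_eqI[OF has_derivative_radial[OF assms]]
  by (auto simp: inner_axis inner_complex_def coord_def complex_eq_iff algebra_simps)

lemma norm_sq_eq_sum_coord:
  "complex_of_real ((norm w)\<^sup>2) = (\<Sum>i\<in>UNIV. coord b i w * coord (\<not> b) i w)"
proof -
  have "coord b i w * coord (\<not> b) i w = (complex_of_real (cmod (w $ i)))\<^sup>2" for i
    using complex_norm_square[of "w $ i"] by (cases b) (simp_all add: coord_def mult.commute)
  then show ?thesis by (simp add: norm_vec_def L2_set_def sum_nonneg)
qed

text \<open>Polynomials of degree at most \<open>m\<close> in the coordinates and their conjugates, generated by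
multiplication with one coordinate at a time: this is the step by which annihilated polynomials are
built up in \<open>annihilated_wpoly\<close>.\<close>

inductive wpoly :: "nat \<Rightarrow> (complex ^ 'n::finite \<Rightarrow> complex) \<Rightarrow> bool" where
  const: "wpoly m (\<lambda>_. c)"
| mult: "wpoly m P \<Longrightarrow> wpoly (Suc m) (\<lambda>w. coord b i w * P w)"
| add: "wpoly m P \<Longrightarrow> wpoly m Q \<Longrightarrow> wpoly m (\<lambda>w. P w + Q w)"

lemma wpoly_Suc: "wpoly m P \<Longrightarrow> wpoly (Suc m) P"
  by (induction rule: wpoly.induct) (auto intro: wpoly.intros)

lemma wpoly_differentiable: "wpoly m P \<Longrightarrow> P differentiable (at w)"
  by (induction rule: wpoly.induct) auto

lemma wpoly_wirt: "wpoly m P \<Longrightarrow> wpoly m (wirt b i P)"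
proof (induction rule: wpoly.induct)
  case (const m c)
  then show ?case by (auto intro: wpoly.const)
next
  case (mult m P b' j)
  have "wirt b i (\<lambda>w. coord b' j w * P w) =
      (\<lambda>w. (if b = b' \<and> i = j then P w else 0) + coord b' j w * wirt b i P w)"
    by (rule ext, subst wirt_mult) (auto simp: wirt_coord wpoly_differentiable[OF mult.hyps])
  moreover have "wpoly (Suc m) (\<lambda>w. if b = b' \<and> i = j then P w else 0)"
    using wpoly_Suc[OF mult.hyps] by (cases "b = b' \<and> i = j") (auto intro: wpoly.const)
  ultimately show ?case using mult by (auto intro!: wpoly.add wpoly.mult)
next
  case (add m P Q)
  have "wirt b i (\<lambda>w. P w + Q w) = (\<lambda>w. wirt b i P w + wirt b i Q w)"
    by (rule ext, subst wirt_add) (auto simp: wpoly_differentiable[OF add.hyps(1)] wpoly_differentiable[OF add.hyps(2)])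
  then show ?case using add by (auto intro!: wpoly.add)
qed

lemma wpoly_cmult: "wpoly m P \<Longrightarrow> wpoly m (\<lambda>w. c * P w)"
proof (induction rule: wpoly.induct)
  case (mult m P b i)
  have "(\<lambda>w. c * (coord b i w * P w)) = (\<lambda>w. coord b i w * (c * P w))" by (auto simp: ac_simps)
  then show ?case using mult by (auto intro: wpoly.mult)
next
  case (add m P Q)
  then show ?case by (auto simp: distrib_left intro: wpoly.add)
qed (auto intro: wpoly.const)

lemma wpoly_continuous: "wpoly m P \<Longrightarrow> continuous_on S P"
  by (rule continuous_at_imp_continuous_on)
    (auto intro: differentiable_imp_continuous_within wpoly_differentiable)

lemma wpoly_bound: "wpoly m P \<Longrightarrow> \<exists>C\<ge>0. \<forall>w. norm (P w) \<le> C * (1 + norm w) ^ m"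
proof (induction rule: wpoly.induct)
  case (const m c)
  have "norm c \<le> norm c * (1 + norm w) ^ m" for w :: "complex ^ 'n"
    using mult_left_mono[OF one_le_power[of "1 + norm w" m] norm_ge_zero[of c]] by simp
  then show ?case by (intro exI[of _ "norm c"]) auto
next
  case (mult m P b i)
  then obtain C where C: "C \<ge> 0" "\<And>w. norm (P w) \<le> C * (1 + norm w) ^ m" by auto
  have "norm (coord b i w * P w) \<le> C * (1 + norm w) ^ Suc m" for w
  proof -
    have "norm (coord b i w * P w) \<le> (1 + norm w) * (C * (1 + norm w) ^ m)"
      unfolding norm_mult using norm_coord_le[of b i w] C by (intro mult_mono) auto
    then show ?thesis by (simp add: ac_simps)
  qed
  then show ?case using C by blast
next
  case (add m P Q)
  then obtain C D where C: "C \<ge> 0" "\<And>w. norm (P w) \<le> C * (1 + norm w) ^ m"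
    and D: "D \<ge> 0" "\<And>w. norm (Q w) \<le> D * (1 + norm w) ^ m" by blast
  have "norm (P w + Q w) \<le> (C + D) * (1 + norm w) ^ m" for w
    using norm_triangle_ineq[of "P w" "Q w"] C(2)[of w] D(2)[of w] by (simp add: distrib_right)
  then show ?case using C D by (intro exI[of _ "C + D"]) auto
qed

lemma wirt_commute: "wpoly m P \<Longrightarrow> wirt b i (wirt b' j P) = wirt b' j (wirt b i P)"
proof (induction rule: wpoly.induct)
  case (mult m P a k)
  note d = wpoly_differentiable[OF mult.hyps] wpoly_differentiable[OF wpoly_wirt[OF mult.hyps]]
  have 1: "wirt c l (\<lambda>w. coord a k w * P w) =
      (\<lambda>w. (if c = a \<and> l = k then 1 else 0) * P w + coord a k w * wirt c l P w)" for c l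
    by (rule ext, subst wirt_mult) (auto simp: wirt_coord d)
  show ?case
  proof (rule ext)
    fix w
    show "wirt b i (wirt b' j (\<lambda>w. coord a k w * P w)) w = wirt b' j (wirt b i (\<lambda>w. coord a k w * P w)) w"
      unfolding 1 by (simp add: wirt_add wirt_mult wirt_coord d mult.IH)
  qed
next
  case (add m P Q)
  have "wirt c l (\<lambda>w. P w + Q w) = (\<lambda>w. wirt c l P w + wirt c l Q w)" for c l
    by (rule ext, subst wirt_add) (auto simp: wpoly_differentiable[OF add.hyps(1)] wpoly_differentiable[OF add.hyps(2)])
  then show ?case
    by (auto simp: fun_eq_iff wirt_add wpoly_differentiable[OF wpoly_wirt[OF add.hyps(1)]]
       wpoly_differentiable[OF wpoly_wirt[OF add.hyps(2)]] add.IH)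
qed auto

text \<open>This is the inverse of the definition of the Wirtinger derivatives; it converts statements about
real directional derivatives.\<close>

lemma frechet_derivative_axis:
  "frechet_derivative g (at w) (axis i 1) = wirt True i g w + wirt False i g w"
  "frechet_derivative g (at w) (axis i \<i>) = \<i> * (wirt True i g w - wirt False i g w)"
  by (simp_all add: wirt_def field_simps)

lemma laplacian_eq_wirt:
  fixes P :: "complex ^ 'n::finite \<Rightarrow> complex"
  assumes "wpoly m P"
  shows "laplacian P w = 4 * (\<Sum>i\<in>UNIV. wirt True i (wirt False i P) w)"
proof -
  note d = wpoly_wirt[OF assms] wpoly_differentiable[OF wpoly_wirt[OF assms]]
  have s: "wirt c i (\<lambda>y. wirt True j P y + wirt False j P y) w = wirt c i (wirt True j P) w + wirt c i (wirt False j P) w" for c i j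
    by (simp add: wirt_add d)
  have t: "wirt c i (\<lambda>y. \<i> * (wirt True j P y - wirt False j P y)) w = \<i> * (wirt c i (wirt True j P) w - wirt c i (wirt False j P) w)" for c i j
  proof -
    have "(\<lambda>y. \<i> * (wirt True j P y - wirt False j P y)) = (\<lambda>y. \<i> * wirt True j P y + (- \<i>) * wirt False j P y)"
      by (auto simp: algebra_simps)
    then have "wirt c i (\<lambda>y. \<i> * (wirt True j P y - wirt False j P y)) w
        = wirt c i (\<lambda>y. \<i> * wirt True j P y + (- \<i>) * wirt False j P y) w" by simp
    also have "\<dots> = \<i> * wirt c i (wirt True j P) w + (- \<i>) * wirt c i (wirt False j P) w"
      using wirt_add[of "\<lambda>y. \<i> * wirt True j P y" w "\<lambda>y. (- \<i>) * wirt False j P y" c i]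
      by (simp only: wirt_cmult[OF d(2)] differentiable_mult differentiable_const d(2) simp_thms)
    finally show ?thesis by (simp add: algebra_simps)
  qed
  have B: "(Basis :: (complex ^ 'n) set) = (\<Union>i. {axis i 1, axis i \<i>})"
    by (auto simp: Basis_vec_def Basis_complex_def)
  have "laplacian P w = (\<Sum>i\<in>UNIV. \<Sum>b\<in>{axis i 1, axis i \<i>}.
      frechet_derivative (\<lambda>y. frechet_derivative P (at y) b) (at w) b)"
    unfolding laplacian_def B by (rule sum.UNION_disjoint) (auto simp: axis_eq_axis)
  also have "\<dots> = (\<Sum>i\<in>UNIV. 4 * wirt True i (wirt False i P) w)"
  proof (rule sum.cong)
    fix i :: 'n
    have ne: "axis i (1::complex) \<noteq> axis i \<i>" by (simp add: axis_eq_axis)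
    show "(\<Sum>b\<in>{axis i 1, axis i \<i>}. frechet_derivative (\<lambda>y. frechet_derivative P (at y) b) (at w) b)
       = 4 * wirt True i (wirt False i P) w"
      using ne wirt_commute[OF assms, of False i True i]
      by (simp add: frechet_derivative_axis s t) (simp add: algebra_simps)
  qed simp
  finally show ?thesis by (simp add: sum_distrib_left)
qed

section \<open>Bihomogeneous and harmonic polynomials\<close>

text \<open>The degrees \<open>d True\<close> in the coordinates and \<open>d False\<close> in their conjugates are tracked by
generation rather than by coefficients: then differentiation, and the vanishing of the derivative
with respect to a variable of degree \<open>0\<close>, follow by rule induction.\<close>

inductive bihom :: "(bool \<Rightarrow> nat) \<Rightarrow> (complex ^ 'n::finite \<Rightarrow> complex) \<Rightarrow> bool" where
  zero: "bihom d (\<lambda>_. 0)"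
| const: "bihom (\<lambda>_. 0) (\<lambda>_. c)"
| mult: "bihom d P \<Longrightarrow> bihom (d(b := Suc (d b))) (\<lambda>w. coord b i w * P w)"
| add: "bihom d P \<Longrightarrow> bihom d Q \<Longrightarrow> bihom d (\<lambda>w. P w + Q w)"

lemma bihom_wpoly: "bihom d P \<Longrightarrow> wpoly (d True + d False) P"
proof (induction rule: bihom.induct)
  case (mult d P b i)
  then show ?case using wpoly.mult[OF mult.IH, of b i] by (cases b) simp_all
qed (auto intro: wpoly.intros)

lemma bihom_differentiable: "bihom d P \<Longrightarrow> P differentiable (at w)"
  using bihom_wpoly wpoly_differentiable by blast

lemma bihom_cmult: "bihom d P \<Longrightarrow> bihom d (\<lambda>w. c * P w)"
proof (induction rule: bihom.induct)
  case (mult d P b i)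
  have "(\<lambda>w. c * (coord b i w * P w)) = (\<lambda>w. coord b i w * (c * P w))" by (auto simp: ac_simps)
  then show ?case using bihom.mult[OF mult.IH, of b i] by (simp add: fun_upd_def)
qed (auto simp: distrib_left intro: bihom.intros)

lemma bihom_sum:
  "finite S \<Longrightarrow> (\<And>i. i \<in> S \<Longrightarrow> bihom d (P i)) \<Longrightarrow> bihom d (\<lambda>w. \<Sum>i\<in>S. P i w)"
  by (induction S rule: finite_induct) (auto intro: bihom.zero bihom.add)

lemma bihom_wirt:
  fixes P :: "complex ^ 'n::finite \<Rightarrow> complex"
  shows "bihom d P \<Longrightarrow> (d b = 0 \<longrightarrow> wirt b i P = (\<lambda>_. 0)) \<and> (d b > 0 \<longrightarrow> bihom (d(b := d b - 1)) (wirt b i P))"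
proof (induction rule: bihom.induct)
  case (mult d P b' j)
  let ?A = "\<lambda>w. if b = b' \<and> i = j then P w else 0" and ?B = "\<lambda>w. coord b' j w * wirt b i P w"
  let ?d = "d(b' := Suc (d b'))"
  have eq: "wirt b i (\<lambda>w. coord b' j w * P w) = (\<lambda>w. ?A w + ?B w)"
    by (rule ext, subst wirt_mult) (auto simp: wirt_coord bihom_differentiable[OF mult.hyps])
  show ?case
  proof (cases "b = b'")
    case True
    have dd: "?d(b := ?d b - 1) = d" using True by auto
    have "bihom d ?A" using mult.hyps by (cases "b = b' \<and> i = j") (auto intro: bihom.zero)
    moreover have "bihom d ?B"
    proof (cases "d b = 0")
      case True
      then show ?thesis using mult.IH by (simp add: bihom.zero)
    next
      case False
      have "bihom ((d(b := d b - 1))(b := Suc ((d(b := d b - 1)) b))) (\<lambda>w. coord b j w * wirt b i P w)"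
        using False mult.IH by (intro bihom.mult) (simp add: fun_upd_def)
      moreover have "(d(b := d b - 1))(b := Suc ((d(b := d b - 1)) b)) = d" using False by auto
      ultimately show ?thesis using True by simp
    qed
    ultimately show ?thesis using True unfolding eq dd by (auto intro: bihom.add)
  next
    case False
    have d2: "?d(b := ?d b - 1) = (d(b := d b - 1))(b' := Suc ((d(b := d b - 1)) b'))" if "d b > 0"
      using False that by auto
    have eqB: "(\<lambda>w. ?A w + ?B w) = ?B" using False by simp
    show ?thesis
    proof (cases "d b = 0")
      case True
      then show ?thesis using mult.IH False unfolding eq eqB by simp
    next
      case nz: False
      then have "bihom ((d(b := d b - 1))(b' := Suc ((d(b := d b - 1)) b'))) ?B"
        using mult.IH by (intro bihom.mult) (simp add: fun_upd_def)
      then have "bihom (?d(b := ?d b - 1)) ?B" using nz d2 by simp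
      then show ?thesis using nz False unfolding eq eqB by (simp add: fun_upd_def cong: if_cong)
    qed
  qed
next
  case (add d P Q)
  have "wirt b i (\<lambda>w. P w + Q w) = (\<lambda>w. wirt b i P w + wirt b i Q w)"
    by (rule ext, subst wirt_add) (auto simp: bihom_differentiable[OF add.hyps(1)] bihom_differentiable[OF add.hyps(2)])
  then show ?case using add by (auto intro: bihom.add)
qed (auto intro: bihom.zero)

lemma bihom_euler:
  fixes P :: "complex ^ 'n::finite \<Rightarrow> complex"
  shows "bihom d P \<Longrightarrow> (\<Sum>i\<in>UNIV. coord b i w * wirt b i P w) = of_nat (d b) * P w"
proof (induction rule: bihom.induct)
  case (mult d P b' j)
  have eq: "wirt b i (\<lambda>w. coord b' j w * P w) w = (if b = b' \<and> i = j then P w else 0) + coord b' j w * wirt b i P w" for i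
    by (subst wirt_mult) (auto simp: wirt_coord bihom_differentiable[OF mult.hyps])
  have "(\<Sum>i\<in>UNIV. coord b i w * wirt b i (\<lambda>w. coord b' j w * P w) w)
     = (\<Sum>i\<in>UNIV. (if j = i then (if b = b' then coord b j w * P w else 0) else 0)) + coord b' j w * (\<Sum>i\<in>UNIV. coord b i w * wirt b i P w)"
    unfolding eq sum_distrib_left sum.distrib[symmetric] by (rule sum.cong) (auto simp: algebra_simps)
  then show ?case unfolding mult.IH by (auto simp: algebra_simps)
next
  case (add d P Q)
  have eq: "wirt b i (\<lambda>w. P w + Q w) w = wirt b i P w + wirt b i Q w" for i
    by (subst wirt_add) (auto simp: bihom_differentiable[OF add.hyps(1)] bihom_differentiable[OF add.hyps(2)])
  then show ?case using add.IH by (simp add: distrib_left sum.distrib)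
qed auto

lemma bihom_norm_sq_mult:
  assumes "bihom d P"
  shows "bihom (\<lambda>b. Suc (d b)) (\<lambda>w. of_real ((norm w)\<^sup>2) * P w)"
proof -
  have "bihom (\<lambda>b. Suc (d b)) (\<lambda>w. coord True i w * (coord False i w * P w))" for i
  proof -
    have "bihom ((d(False := Suc (d False)))(True := Suc ((d(False := Suc (d False))) True)))
        (\<lambda>w. coord True i w * (coord False i w * P w))"
      by (intro bihom.mult assms)
    moreover have "(d(False := Suc (d False)))(True := Suc ((d(False := Suc (d False))) True)) = (\<lambda>b. Suc (d b))"
      by (auto simp: fun_eq_iff)
    ultimately show ?thesis by simp
  qed
  then have "bihom (\<lambda>b. Suc (d b)) (\<lambda>w. \<Sum>i\<in>UNIV. coord True i w * (coord False i w * P w))"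
    by (intro bihom_sum) auto
  moreover have "(\<lambda>w. \<Sum>i\<in>UNIV. coord True i w * (coord False i w * P w)) = (\<lambda>w. of_real ((norm w)\<^sup>2) * P w)"
    by (rule ext) (simp only: norm_sq_eq_sum_coord[of _ True] sum_distrib_right not_True_eq_False mult.assoc)
  ultimately show ?thesis by simp
qed

definition bidegree :: "nat \<Rightarrow> nat \<Rightarrow> bool \<Rightarrow> nat" where
  "bidegree s t b = (if b then s else t)"

lemma bihom_polysI:
  "(\<And>z. P z = (\<Sum>\<alpha>\<in>multi_indices s. \<Sum>\<beta>\<in>multi_indices t. c \<alpha> \<beta> * monomial \<alpha> z * cnj (monomial \<beta> z)))
    \<Longrightarrow> P \<in> bihom_polys s t"
  unfolding bihom_polys_def by auto

lemma sum_multi_indices_Suc: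
  fixes h :: "('n::finite \<Rightarrow> nat) \<Rightarrow> 'a::comm_monoid_add"
  shows "(\<Sum>\<alpha>\<in>multi_indices s. h (\<alpha>(i := Suc (\<alpha> i)))) =
    (\<Sum>\<alpha>\<in>multi_indices (Suc s). if \<alpha> i > 0 then h \<alpha> else 0)"
proof -
  have up: "(\<Sum>j\<in>UNIV. (\<alpha>(i := Suc (\<alpha> i))) j) = Suc (\<Sum>j\<in>UNIV. \<alpha> j)" for \<alpha> :: "'n \<Rightarrow> nat"
    by (subst (1 2) sum.remove[of _ i]) auto
  have down: "Suc (\<Sum>j\<in>UNIV. (\<alpha>(i := \<alpha> i - 1)) j) = (\<Sum>j\<in>UNIV. \<alpha> j)" if "\<alpha> i > 0" for \<alpha> :: "'n \<Rightarrow> nat"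
    using that by (subst (1 2) sum.remove[of _ i]) auto
  have "(\<Sum>\<alpha>\<in>multi_indices s. h (\<alpha>(i := Suc (\<alpha> i)))) = (\<Sum>\<alpha>\<in>{\<alpha>\<in>multi_indices (Suc s). \<alpha> i > 0}. h \<alpha>)"
  proof (rule sum.reindex_bij_witness[where i = "\<lambda>\<alpha>. \<alpha>(i := \<alpha> i - 1)" and j = "\<lambda>\<alpha>. \<alpha>(i := Suc (\<alpha> i))"])
    fix \<alpha> :: "'n \<Rightarrow> nat" assume "\<alpha> \<in> multi_indices s"
    then show "\<alpha>(i := Suc (\<alpha> i)) \<in> {\<alpha> \<in> multi_indices (Suc s). 0 < \<alpha> i}"
      using up[of \<alpha>] by (simp add: multi_indices_def)
  next
    fix \<alpha> :: "'n \<Rightarrow> nat" assume "\<alpha> \<in> {\<alpha> \<in> multi_indices (Suc s). 0 < \<alpha> i}"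
    then show "\<alpha>(i := \<alpha> i - 1) \<in> multi_indices s"
      using down[of \<alpha>] by (simp add: multi_indices_def)
  qed auto
  also have "\<dots> = (\<Sum>\<alpha>\<in>multi_indices (Suc s). if \<alpha> i > 0 then h \<alpha> else 0)"
    by (subst sum.inter_filter) simp_all
  finally show ?thesis .
qed

lemma monomial_Suc: "monomial (\<alpha>(i := Suc (\<alpha> i))) w = w $ i * monomial \<alpha> w"
  unfolding monomial_def by (subst (1 2) prod.remove[of _ i]) (auto simp: mult.assoc intro!: prod.cong)

lemma bihom_polys_mult_holo:
  assumes "P \<in> bihom_polys s t"
  shows "(\<lambda>w. w $ i * P w) \<in> bihom_polys (Suc s) t"
proof -
  obtain c where P: "P = (\<lambda>z. \<Sum>\<alpha>\<in>multi_indices s. \<Sum>\<beta>\<in>multi_indices t. c \<alpha> \<beta> * monomial \<alpha> z * cnj (monomial \<beta> z))"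
    using assms by (auto simp: bihom_polys_def)
  define c' where "c' \<alpha> \<beta> = (if \<alpha> i > 0 then c (\<alpha>(i := \<alpha> i - 1)) \<beta> else 0)" for \<alpha> \<beta>
  have "w $ i * P w = (\<Sum>\<alpha>\<in>multi_indices (Suc s). \<Sum>\<beta>\<in>multi_indices t. c' \<alpha> \<beta> * monomial \<alpha> w * cnj (monomial \<beta> w))" for w
  proof -
    have "w $ i * P w = (\<Sum>\<alpha>\<in>multi_indices s. (\<lambda>\<alpha>. \<Sum>\<beta>\<in>multi_indices t. c (\<alpha>(i := \<alpha> i - 1)) \<beta> * monomial \<alpha> w * cnj (monomial \<beta> w)) (\<alpha>(i := Suc (\<alpha> i))))"
      unfolding P by (simp add: monomial_Suc sum_distrib_left ac_simps)
    also have "\<dots> = (\<Sum>\<alpha>\<in>multi_indices (Suc s). \<Sum>\<beta>\<in>multi_indices t. c' \<alpha> \<beta> * monomial \<alpha> w * cnj (monomial \<beta> w))"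
      by (subst sum_multi_indices_Suc) (auto simp: c'_def intro!: sum.cong)
    finally show ?thesis .
  qed
  then show ?thesis unfolding bihom_polys_def by blast
qed

text \<open>Conjugation exchanges the two degrees, so multiplication by a conjugate coordinate
reduces to multiplication by a coordinate.\<close>

lemma bihom_polys_cnj:
  assumes "P \<in> bihom_polys s t"
  shows "(\<lambda>w. cnj (P w)) \<in> bihom_polys t s"
proof -
  obtain c where P: "P = (\<lambda>z. \<Sum>\<alpha>\<in>multi_indices s. \<Sum>\<beta>\<in>multi_indices t. c \<alpha> \<beta> * monomial \<alpha> z * cnj (monomial \<beta> z))"
    using assms by (auto simp: bihom_polys_def)
  show ?thesis
    by (rule bihom_polysI[where c = "\<lambda>\<beta> \<alpha>. cnj (c \<alpha> \<beta>)"])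
      (unfold P, subst sum.swap, simp add: ac_simps)
qed

lemma bihom_polys_mult_antiholo:
  assumes "P \<in> bihom_polys s t"
  shows "(\<lambda>w. cnj (w $ i) * P w) \<in> bihom_polys s (Suc t)"
  using bihom_polys_cnj[OF bihom_polys_mult_holo[OF bihom_polys_cnj[OF assms], of i]] by simp

lemma bihom_imp_bihom_polys: "bihom d P \<Longrightarrow> P \<in> bihom_polys (d True) (d False)"
proof (induction rule: bihom.induct)
  case (zero d)
  show ?case by (rule bihom_polysI[where c = "\<lambda>_ _. 0"]) simp
next
  case (const c)
  have "multi_indices 0 = {\<lambda>_::'a. 0}" by (auto simp: multi_indices_def)
  then show ?case by (intro bihom_polysI[where c = "\<lambda>_ _. c"]) (simp add: monomial_def)
next
  case (mult d P b i)
  then show ?case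
    using bihom_polys_mult_holo[OF mult.IH, of i] bihom_polys_mult_antiholo[OF mult.IH, of i]
    by (cases b) (simp_all add: coord_def)
next
  case (add d P Q)
  then obtain c e where "P = (\<lambda>z. \<Sum>\<alpha>\<in>multi_indices (d True). \<Sum>\<beta>\<in>multi_indices (d False). c \<alpha> \<beta> * monomial \<alpha> z * cnj (monomial \<beta> z))"
    "Q = (\<lambda>z. \<Sum>\<alpha>\<in>multi_indices (d True). \<Sum>\<beta>\<in>multi_indices (d False). e \<alpha> \<beta> * monomial \<alpha> z * cnj (monomial \<beta> z))"
    by (auto simp: bihom_polys_def)
  then show ?case
    by (intro bihom_polysI[where c = "\<lambda>\<alpha> \<beta>. c \<alpha> \<beta> + e \<alpha> \<beta>"]) (simp add: distrib_right sum.distrib)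
qed

lemma bihom_prod_power_mult:
  fixes P :: "complex ^ 'n::finite \<Rightarrow> complex"
  assumes "finite S" "bihom d P"
  shows "bihom (d(b := d b + (\<Sum>i\<in>S. \<alpha> i))) (\<lambda>w. (\<Prod>i\<in>S. coord b i w ^ \<alpha> i) * P w)"
proof -
  have pow: "bihom (d(b := d b + k)) (\<lambda>w. coord b i w ^ k * Q w)" if "bihom d Q" for d k and i :: 'n and Q :: "complex ^ 'n \<Rightarrow> complex"
  proof (induction k)
    case (Suc k)
    from bihom.mult[OF this, of b i] show ?case by (simp add: mult.assoc fun_upd_def cong: if_cong)
  qed (use that in simp)
  from assms show ?thesis
  proof (induction S rule: finite_induct)
    case (insert i S)
    from pow[OF insert.IH[OF insert.prems], where k = "\<alpha> i" and i = i] insert.hyps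
    show ?case by (simp add: mult.assoc add.assoc add.commute add.left_commute fun_upd_def cong: if_cong)
  qed simp
qed

lemma bihom_polys_imp_bihom:
  assumes "P \<in> bihom_polys s t"
  shows "bihom (bidegree s t) P"
proof -
  obtain c where P: "P = (\<lambda>z. \<Sum>\<alpha>\<in>multi_indices s. \<Sum>\<beta>\<in>multi_indices t. c \<alpha> \<beta> * monomial \<alpha> z * cnj (monomial \<beta> z))"
    using assms by (auto simp: bihom_polys_def)
  have "bihom (bidegree s t) (\<lambda>z. c \<alpha> \<beta> * monomial \<alpha> z * cnj (monomial \<beta> z))"
    if "\<alpha> \<in> multi_indices s" "\<beta> \<in> multi_indices t" for \<alpha> \<beta>
  proof -
    have "bihom (((\<lambda>_. 0)(False := 0 + (\<Sum>i\<in>UNIV. \<beta> i)))(True := ((\<lambda>_. 0)(False := 0 + (\<Sum>i\<in>UNIV. \<beta> i))) True + (\<Sum>i\<in>UNIV. \<alpha> i)))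
      (\<lambda>w. (\<Prod>i\<in>UNIV. coord True i w ^ \<alpha> i) * ((\<Prod>i\<in>UNIV. coord False i w ^ \<beta> i) * c \<alpha> \<beta>))"
      by (intro bihom_prod_power_mult bihom.const) auto
    moreover have "((\<lambda>_. 0)(False := 0 + (\<Sum>i\<in>UNIV. \<beta> i)))(True := ((\<lambda>_. 0)(False := 0 + (\<Sum>i\<in>UNIV. \<beta> i))) True + (\<Sum>i\<in>UNIV. \<alpha> i)) = bidegree s t"
      using that by (auto simp: multi_indices_def bidegree_def fun_eq_iff)
    ultimately show ?thesis by (simp add: monomial_def coord_def ac_simps)
  qed
  then show ?thesis unfolding P by (intro bihom_sum) auto
qed

definition harmonic_bihom :: "(bool \<Rightarrow> nat) \<Rightarrow> (complex ^ 'n::finite \<Rightarrow> complex) \<Rightarrow> bool" where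
  "harmonic_bihom d P \<longleftrightarrow> bihom d P \<and> (\<forall>b w. (\<Sum>i\<in>UNIV. wirt b i (wirt (\<not> b) i P) w) = 0)"

lemma harmonic_bihom_iff:
  "harmonic_bihom (bidegree s t) P \<longleftrightarrow> P \<in> bihom_harmonics s t"
proof
  assume P: "harmonic_bihom (bidegree s t) P"
  then have bi: "bihom (bidegree s t) P" by (simp add: harmonic_bihom_def)
  have "(\<Sum>i\<in>UNIV. wirt True i (wirt False i P) w) = 0" for w
    using P unfolding harmonic_bihom_def by (metis (full_types))
  then show "P \<in> bihom_harmonics s t"
    using bihom_imp_bihom_polys[OF bi] laplacian_eq_wirt[OF bihom_wpoly[OF bi]]
    by (simp add: bihom_harmonics_def bidegree_def)
next
  assume P: "P \<in> bihom_harmonics s t"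
  then have bi: "bihom (bidegree s t) P" by (auto simp: bihom_harmonics_def intro: bihom_polys_imp_bihom)
  have 1: "(\<Sum>i\<in>UNIV. wirt True i (wirt False i P) w) = 0" for w
    using laplacian_eq_wirt[OF bihom_wpoly[OF bi]] P by (simp add: bihom_harmonics_def)
  have "(\<Sum>i\<in>UNIV. wirt b i (wirt (\<not> b) i P) w) = 0" for b w
    using 1[of w] wirt_commute[OF bihom_wpoly[OF bi], of True _ False] by (cases b) simp_all
  then show "harmonic_bihom (bidegree s t) P" using bi by (simp add: harmonic_bihom_def)
qed

text \<open>In one variable, Euler's identity applied twice gives
\<open>|z|\<^sup>2\<close> times the mixed second derivative as \<open>st P\<close>. Hence a nonzero harmonic polynomial is
holomorphic or antiholomorphic.\<close>

lemma harmonic_bihom_card_1: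
  fixes P :: "complex ^ 'n::finite \<Rightarrow> complex"
  assumes P: "harmonic_bihom d P" and card: "CARD('n) = 1" and nz: "P \<noteq> (\<lambda>_. 0)"
  shows "d True = 0 \<or> d False = 0"
proof -
  have bi: "bihom d P" using P by (simp add: harmonic_bihom_def)
  obtain i :: 'n where U: "UNIV = {i}" using card card_1_singletonE by blast
  have 0: "wirt True i (wirt False i P) w = 0" for w
    using P unfolding harmonic_bihom_def by (auto simp: U dest: spec[of _ True])
  have e: "coord b i w * wirt b i P w = of_nat (d b) * P w" for b w
    using bihom_euler[OF bi, of b w] by (simp add: U)
  have "of_nat (d True) * (of_nat (d False) * P w) = 0" for w
  proof -
    have "of_nat (d False) * wirt True i P w = wirt True i (\<lambda>w. of_nat (d False) * P w) w"
      by (simp add: wirt_cmult bihom_differentiable[OF bi])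
    also have "\<dots> = wirt True i (\<lambda>w. coord False i w * wirt False i P w) w" by (simp add: e)
    also have "\<dots> = 0"
      by (subst wirt_mult) (simp_all add: wirt_coord 0 wpoly_differentiable[OF wpoly_wirt[OF bihom_wpoly[OF bi]]])
    finally show ?thesis using e[of True w] by (auto simp: mult.left_commute)
  qed
  moreover obtain w where "P w \<noteq> 0" using nz by auto
  ultimately have "of_nat (d True) * (of_nat (d False) :: complex) = 0"
    by (metis mult.assoc mult_eq_0_iff)
  then show ?thesis by simp
qed

section \<open>Radial profiles\<close>

definition deriv_seq :: "(nat \<Rightarrow> real \<Rightarrow> real) \<Rightarrow> bool" where
  "deriv_seq F \<longleftrightarrow> (\<forall>k x. (F k has_real_derivative F (Suc k) x) (at x))"

text \<open>Growth at most of the order of a polynomial times \<open>exp (x / 4)\<close>. With \<open>x = |w|\<^sup>2\<close> this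
growth is absorbed by a function that decays faster than \<open>exp (- |w|\<^sup>2 / 4)\<close> times any negative
power of \<open>|w|\<close>, and it is the growth of the solutions of \<open>\<phi>' = \<phi> / 4\<close>, which have to be admitted.\<close>

definition moderate :: "(real \<Rightarrow> real) \<Rightarrow> bool" where
  "moderate h \<longleftrightarrow> (\<exists>C m. C \<ge> 0 \<and> (\<forall>x\<ge>0. \<bar>h x\<bar> \<le> C * (1 + x) ^ m * exp (x / 4)))"

text \<open>A radial profile \<open>F 0\<close> together with all its derivatives. It vanishes on a neighbourhood of
\<open>(-\<infinity>, a]\<close>, but its support need not be bounded above.\<close>

definition profile :: "real \<Rightarrow> (nat \<Rightarrow> real \<Rightarrow> real) \<Rightarrow> bool" where
  "profile a F \<longleftrightarrow> deriv_seq F \<and> (\<exists>c>a. \<forall>k. \<forall>x\<le>c. F k x = 0) \<and> (\<forall>k. moderate (F k))"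

lemma moderate_mono:
  assumes "moderate g" "\<And>x. x \<ge> 0 \<Longrightarrow> \<bar>h x\<bar> \<le> K * (1 + x) ^ j * \<bar>g x\<bar>"
  shows "moderate h"
proof -
  obtain C m where C: "C \<ge> 0" "\<And>x. x \<ge> 0 \<Longrightarrow> \<bar>g x\<bar> \<le> C * (1 + x) ^ m * exp (x / 4)"
    using assms(1) by (auto simp: moderate_def)
  have "\<bar>h x\<bar> \<le> (\<bar>K\<bar> * C) * (1 + x) ^ (j + m) * exp (x / 4)" if "x \<ge> 0" for x
  proof -
    have "\<bar>h x\<bar> \<le> K * (1 + x) ^ j * \<bar>g x\<bar>" by (rule assms(2)[OF that])
    also have "\<dots> \<le> (\<bar>K\<bar> * (1 + x) ^ j) * (C * (1 + x) ^ m * exp (x / 4))"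
      using that C by (intro mult_mono) (auto intro!: mult_right_mono)
    finally show ?thesis by (simp add: power_add ac_simps)
  qed
  then show ?thesis using C(1) unfolding moderate_def by (intro exI[of _ "\<bar>K\<bar> * C"] exI[of _ "j + m"]) auto
qed

lemma moderate_cmult: "moderate g \<Longrightarrow> moderate (\<lambda>x. c * g x)"
  by (erule moderate_mono[where K = "\<bar>c\<bar>" and j = 0]) (simp add: abs_mult)

lemma moderate_x_mult: "moderate g \<Longrightarrow> moderate (\<lambda>x. x * g x)"
  by (erule moderate_mono[where K = 1 and j = 1]) (simp add: abs_mult mult_right_mono)

lemma moderate_add:
  assumes "moderate g" "moderate h"
  shows "moderate (\<lambda>x. g x + h x)"
proof -
  obtain C m where C: "C \<ge> 0" "\<And>x. x \<ge> 0 \<Longrightarrow> \<bar>g x\<bar> \<le> C * (1 + x) ^ m * exp (x / 4)"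
    using assms(1) by (auto simp: moderate_def)
  obtain D l where D: "D \<ge> 0" "\<And>x. x \<ge> 0 \<Longrightarrow> \<bar>h x\<bar> \<le> D * (1 + x) ^ l * exp (x / 4)"
    using assms(2) by (auto simp: moderate_def)
  have "\<bar>g x + h x\<bar> \<le> (C + D) * (1 + x) ^ (m + l) * exp (x / 4)" if "x \<ge> 0" for x
  proof -
    have "\<bar>g x + h x\<bar> \<le> C * (1 + x) ^ m * exp (x / 4) + D * (1 + x) ^ l * exp (x / 4)"
      using C(2)[OF that] D(2)[OF that] by linarith
    also have "\<dots> \<le> C * (1 + x) ^ (m + l) * exp (x / 4) + D * (1 + x) ^ (m + l) * exp (x / 4)"
      using that C D by (intro add_mono mult_right_mono mult_left_mono power_increasing) auto
    finally show ?thesis by (simp add: distrib_right)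
  qed
  then show ?thesis using C(1) D(1) unfolding moderate_def
    by (intro exI[of _ "C + D"] exI[of _ "m + l"]) auto
qed

lemma profileE:
  assumes "profile a F"
  obtains c where "c > a" "\<And>k x. x \<le> c \<Longrightarrow> F k x = 0"
    "\<And>k x. (F k has_real_derivative F (Suc k) x) (at x)" "\<And>k. moderate (F k)"
  using assms by (auto simp: profile_def deriv_seq_def)

lemma profile_shift: "profile a F \<Longrightarrow> profile a (\<lambda>k. F (Suc k))"
  by (auto simp: profile_def deriv_seq_def)

text \<open>The derivatives of \<open>x F\<^sub>0 x\<close> are \<open>x F\<^sub>k x + k F\<^bsub>k-1\<^esub> x\<close> by Leibniz' rule; the truncated index at
\<open>k = 0\<close> is harmless because of the factor \<open>k\<close>.\<close>

lemma profile_x_mult: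
  assumes "profile a F"
  shows "profile a (\<lambda>k x. x * F k x + real k * F (k - 1) x)"
proof (rule profileE[OF assms])
  fix c assume c: "c > a" "\<And>k x. x \<le> c \<Longrightarrow> F k x = 0"
    and d: "\<And>k x. (F k has_real_derivative F (Suc k) x) (at x)" and m: "\<And>k. moderate (F k)"
  have "((\<lambda>x. x * F k x + real k * F (k - 1) x) has_real_derivative x * F (Suc k) x + real (Suc k) * F (Suc k - 1) x) (at x)" for k x
  proof (cases k)
    case 0
    then show ?thesis using d[of 0 x] by (auto intro!: derivative_eq_intros)
  next
    case (Suc j)
    show ?thesis unfolding Suc
      by (auto intro!: derivative_eq_intros d[of "Suc j"] d[of j] simp: algebra_simps)
  qed
  then show ?thesis using c m unfolding profile_def deriv_seq_def
    by (auto intro!: moderate_add moderate_x_mult moderate_cmult)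
qed

lemma profile_x_power_mult:
  assumes "profile a F"
  shows "\<exists>G. profile a G \<and> (\<forall>x. G 0 x = x ^ n * F 0 x)"
proof (induction n)
  case 0
  show ?case using assms by auto
next
  case (Suc n)
  then obtain G where "profile a G" "\<And>x. G 0 x = x ^ n * F 0 x" by auto
  then show ?case using profile_x_mult[of a G] by (intro exI[of _ "\<lambda>k x. x * G k x + real k * G (k - 1) x"]) auto
qed

text \<open>The derivatives of \<open>G x = F\<^sub>0 x / x\<close>, obtained by differentiating \<open>x G x = F\<^sub>0 x\<close> repeatedly: this
gives \<open>x G\<^sub>k + k G\<^bsub>k-1\<^esub> = F\<^sub>k\<close>.\<close>

fun quot_seq :: "(nat \<Rightarrow> real \<Rightarrow> real) \<Rightarrow> nat \<Rightarrow> real \<Rightarrow> real" where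
  "quot_seq F 0 x = F 0 x / x"
| "quot_seq F (Suc k) x = (F (Suc k) x - real (Suc k) * quot_seq F k x) / x"

lemma profile_x_divide:
  assumes "profile a F" "a \<ge> 0"
  shows "profile a (quot_seq F)"
proof (rule profileE[OF assms(1)])
  fix c assume c: "c > a" "\<And>k x. x \<le> c \<Longrightarrow> F k x = 0"
    and d: "\<And>k x. (F k has_real_derivative F (Suc k) x) (at x)" and m: "\<And>k. moderate (F k)"
  have z: "quot_seq F k x = 0" if "x \<le> c" for k x
    using that c by (induction k) auto
  have cpos: "c > 0" using c assms(2) by simp
  have "(quot_seq F k has_real_derivative quot_seq F (Suc k) x) (at x)" for k x
  proof (cases "x < c")
    case True
    have "((\<lambda>_. 0) has_real_derivative 0) (at x)" by simp
    moreover have "quot_seq F (Suc k) x = 0" using z True by (intro z) simp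
    moreover have "eventually (\<lambda>y. y \<in> {..<c}) (nhds x)" using True by (intro eventually_nhds_in_open) auto
    then have "eventually (\<lambda>y. quot_seq F k y = 0) (nhds x)"
      by eventually_elim (simp add: z)
    ultimately show ?thesis by (subst DERIV_cong_ev[OF refl _ refl, of _ "\<lambda>_. 0"]) auto
  next
    case False
    then have x: "x > 0" using cpos by simp
    show ?thesis
    proof (induction k)
      case 0
      have "quot_seq F 0 = (\<lambda>x. F 0 x / x)" by auto
      moreover have "((\<lambda>x. F 0 x / x) has_real_derivative (F (Suc 0) x * x - F 0 x * 1) / (x * x)) (at x)"
        using x by (intro DERIV_divide d DERIV_ident) auto
      moreover have "(F (Suc 0) x * x - F 0 x * 1) / (x * x) = quot_seq F (Suc 0) x"
        using x by (simp add: field_simps)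
      ultimately show ?case by metis
    next
      case (Suc k)
      let ?G = "quot_seq F"
      have "?G (Suc k) = (\<lambda>x. (F (Suc k) x - real (Suc k) * ?G k x) / x)" by auto
      moreover have "((\<lambda>x. (F (Suc k) x - real (Suc k) * ?G k x) / x) has_real_derivative
         ((F (Suc (Suc k)) x - real (Suc k) * ?G (Suc k) x) * x - (F (Suc k) x - real (Suc k) * ?G k x) * 1) / (x * x)) (at x)"
        using x by (intro DERIV_divide DERIV_diff d DERIV_ident DERIV_cmult Suc.IH) auto
      moreover have "((F (Suc (Suc k)) x - real (Suc k) * ?G (Suc k) x) * x - (F (Suc k) x - real (Suc k) * ?G k x) * 1) / (x * x) = ?G (Suc (Suc k)) x"
      proof -
        have "F (Suc k) x - real (Suc k) * ?G k x = x * ?G (Suc k) x" using x by simp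
        then show ?thesis using x by (simp add: field_simps del: quot_seq.simps(2)) (simp add: field_simps)
      qed
      ultimately show ?case by metis
    qed
  qed
  moreover have "moderate (quot_seq F k)" for k
  proof (induction k)
    case 0
    have "\<bar>F 0 x / x\<bar> \<le> (1 / c) * (1 + x) ^ 0 * \<bar>F 0 x\<bar>" if "x \<ge> 0" for x
      using c cpos by (cases "x \<le> c") (auto simp: abs_divide field_simps intro!: mult_right_mono)
    then have "moderate (\<lambda>x. F 0 x / x)" by (rule moderate_mono[OF m[of 0]])
    moreover have "quot_seq F 0 = (\<lambda>x. F 0 x / x)" by auto
    ultimately show ?case by simp
  next
    case (Suc k)
    have *: "moderate (\<lambda>x. F (Suc k) x + (- real (Suc k)) * quot_seq F k x)"
      by (intro moderate_add moderate_cmult m Suc)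
    have "\<bar>quot_seq F (Suc k) x\<bar> \<le> (1 / c) * (1 + x) ^ 0 * \<bar>F (Suc k) x + (- real (Suc k)) * quot_seq F k x\<bar>" if "x \<ge> 0" for x
    proof (cases "x \<le> c")
      case True
      then have "quot_seq F (Suc k) x = 0" by (rule z)
      then show ?thesis using cpos by (simp del: quot_seq.simps)
    next
      case False
      then have "1 / x \<le> 1 / c" using cpos by (intro divide_left_mono) auto
      then have "1 / x * \<bar>F (Suc k) x + (- real (Suc k)) * quot_seq F k x\<bar> \<le> 1 / c * \<bar>F (Suc k) x + (- real (Suc k)) * quot_seq F k x\<bar>"
        by (rule mult_right_mono) simp
      moreover have "F (Suc k) x + (- real (Suc k)) * quot_seq F k x = F (Suc k) x - real (Suc k) * quot_seq F k x"
        by (simp add: algebra_simps)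
      ultimately show ?thesis using False cpos by (simp add: abs_divide)
    qed
    then show ?case using moderate_mono[OF *] by blast
  qed
  ultimately show ?thesis using c(1) z unfolding profile_def deriv_seq_def by blast
qed

lemma profile_x_power_divide:
  assumes "profile a F" "a \<ge> 0"
  shows "\<exists>G. profile a G \<and> (\<forall>x. G 0 x = F 0 x / x ^ n)"
proof (induction n)
  case 0
  show ?case using assms by auto
next
  case (Suc n)
  then obtain G where "profile a G" "\<And>x. G 0 x = F 0 x / x ^ n" by auto
  then show ?case using profile_x_divide[of a G] assms by (intro exI[of _ "quot_seq G"]) (auto simp: field_simps)
qed

text \<open>The solution is \<open>exp (- \<sigma> x)\<close> times the integral of \<open>exp (\<sigma> y) F\<^sub>0 y\<close> from \<open>0\<close> to \<open>x\<close>. It keeps the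
lower end of the support of \<open>F\<^sub>0\<close>. Its growth stays moderate for both signs of \<open>\<sigma>\<close>: since
\<open>\<sigma> + 1/4 \<ge> 0\<close>, the factor \<open>exp ((\<sigma> + 1/4) y)\<close> in the bound for the integrand is largest at
\<open>y = x\<close>, and the integration costs one power of \<open>1 + x\<close>.\<close>

lemma profile_ode:
  assumes F: "profile a F" and a: "a \<ge> 0" and \<sigma>: "\<bar>\<sigma>\<bar> \<le> 1 / 4"
  shows "\<exists>G. profile a G \<and> (\<forall>x. G (Suc 0) x + \<sigma> * G 0 x = F 0 x)"
proof (rule profileE[OF F])
  fix c assume c: "c > a" "\<And>k x. x \<le> c \<Longrightarrow> F k x = 0"
    and d: "\<And>k x. (F k has_real_derivative F (Suc k) x) (at x)" and m: "\<And>k. moderate (F k)"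
  have cpos: "c > 0" using c a by simp
  define h where "h y = exp (\<sigma> * y) * F 0 y" for y
  have conth: "continuous_on S h" for S
    unfolding h_def
    by (intro continuous_intros DERIV_continuous_on[where D = "F (Suc 0)"]) (rule has_field_derivative_at_within[OF d])
  define g where "g x = integral {0..x} h" for x
  have g0: "g x = 0" if "x \<le> c" for x
  proof -
    have "g x = integral {0..x} (\<lambda>_. 0)"
      unfolding g_def using that c by (intro integral_cong) (auto simp: h_def)
    then show ?thesis by simp
  qed
  have dg: "(g has_real_derivative h x) (at x)" for x
  proof (cases "x < c")
    case True
    have "eventually (\<lambda>y. y \<in> {..<c}) (nhds x)" using True by (intro eventually_nhds_in_open) auto
    then have "eventually (\<lambda>y. g y = 0) (nhds x)" by eventually_elim (simp add: g0)
    moreover have "h x = 0" using True c by (simp add: h_def)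
    ultimately show ?thesis by (subst DERIV_cong_ev[OF refl _ refl, of _ "\<lambda>_. 0"]) auto
  next
    case False
    have "(g has_real_derivative h x) (at x within {0..x+1})"
      unfolding g_def using False cpos by (intro integral_has_real_derivative conth) auto
    moreover have "at x within {0..x+1} = at x"
      using False cpos by (intro at_within_interior) (auto simp: interior_atLeastAtMost_real)
    ultimately show ?thesis by simp
  qed
  \<comment> \<open>The equation itself expresses each derivative of the solution by the previous one.\<close>
  define G where "G = rec_nat (\<lambda>x. exp (- \<sigma> * x) * g x) (\<lambda>k Gk x. F k x - \<sigma> * Gk x)"
  have G0: "G 0 = (\<lambda>x. exp (- \<sigma> * x) * g x)" and GS: "G (Suc k) = (\<lambda>x. F k x - \<sigma> * G k x)" for k
    by (simp_all add: G_def)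
  have dG: "(G k has_real_derivative G (Suc k) x) (at x)" for k x
  proof (induction k)
    case 0
    have "((\<lambda>x. exp (- \<sigma> * x) * g x) has_real_derivative (- \<sigma> * exp (- \<sigma> * x)) * g x + h x * exp (- \<sigma> * x)) (at x)"
      by (intro DERIV_mult dg) (auto intro!: derivative_eq_intros)
    moreover have "h x * exp (- \<sigma> * x) = F 0 x" by (simp add: h_def exp_minus)
    ultimately show ?case unfolding GS G0 by (simp add: algebra_simps)
  next
    case (Suc k)
    have "((\<lambda>x. F k x - \<sigma> * G k x) has_real_derivative F (Suc k) x - \<sigma> * G (Suc k) x) (at x)"
      by (intro DERIV_diff DERIV_cmult Suc d)
    then show ?case by (simp only: GS)
  qed
  have mG: "moderate (G k)" for k
  proof (induction k)
    case 0
    obtain C j where C: "C \<ge> 0" "\<And>x. x \<ge> 0 \<Longrightarrow> \<bar>F 0 x\<bar> \<le> C * (1 + x) ^ j * exp (x / 4)"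
      using m[of 0] by (auto simp: moderate_def)
    have "\<bar>G 0 x\<bar> \<le> C * (1 + x) ^ Suc j * exp (x / 4)" if x: "x \<ge> 0" for x
    proof -
      have "norm (integral {0..x} h) \<le> (C * (1 + x) ^ j * exp ((\<sigma> + 1 / 4) * x)) * (x - 0)"
      proof (rule integral_bound[OF x conth])
        fix y assume y: "y \<in> {0..x}"
        have "norm (h y) = exp (\<sigma> * y) * \<bar>F 0 y\<bar>" by (simp add: h_def abs_mult)
        also have "\<dots> \<le> exp (\<sigma> * y) * (C * (1 + y) ^ j * exp (y / 4))"
          using C y by (intro mult_left_mono) auto
        also have "\<dots> = C * (1 + y) ^ j * exp ((\<sigma> + 1 / 4) * y)"
          by (simp add: algebra_simps flip: exp_add)
        also have "\<dots> \<le> C * (1 + x) ^ j * exp ((\<sigma> + 1 / 4) * x)"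
          using y \<sigma> C by (intro mult_mono power_mono) (auto intro!: mult_left_mono)
        finally show "norm (h y) \<le> C * (1 + x) ^ j * exp ((\<sigma> + 1 / 4) * x)" .
      qed
      then have "\<bar>G 0 x\<bar> \<le> exp (- \<sigma> * x) * ((C * (1 + x) ^ j * exp ((\<sigma> + 1 / 4) * x)) * x)"
        unfolding G0 g_def by (simp add: abs_mult)
      also have "\<dots> = C * (1 + x) ^ j * exp (x / 4) * x"
        by (simp add: algebra_simps flip: exp_add)
      also have "\<dots> \<le> C * (1 + x) ^ j * exp (x / 4) * (1 + x)"
        using C x by (intro mult_left_mono) auto
      finally show ?thesis by (simp add: ac_simps)
    qed
    then show ?case unfolding moderate_def using C(1) by blast
  next
    case (Suc k)
    have "moderate (\<lambda>x. F k x + (- \<sigma>) * G k x)" by (intro moderate_add moderate_cmult m Suc)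
    then show ?case by (simp add: GS)
  qed
  have zG: "G k x = 0" if "x \<le> c" for k x
    using that c by (induction k) (auto simp: G0 GS g0)
  have "profile a G" unfolding profile_def deriv_seq_def using dG mG zG c(1) by blast
  moreover have "\<forall>x. G (Suc 0) x + \<sigma> * G 0 x = F 0 x" by (simp add: GS)
  ultimately show ?thesis by blast
qed

text \<open>The operator is \<open>\<phi> \<mapsto> x\<^bsup>1-N\<^esup> (\<theta>' + \<sigma> \<theta>)\<close> with \<open>\<theta> = x\<^sup>N \<phi>\<close>, so that the previous lemma applies to \<open>\<theta>\<close>.
Dividing by \<open>x\<^sup>N\<close> is harmless because profiles vanish near \<open>0\<close>.\<close>

lemma profile_euler_ode:
  assumes F: "profile a F" and a: "a \<ge> 0" and \<sigma>: "\<bar>\<sigma>\<bar> \<le> 1 / 4" and N: "N \<ge> 1"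
  shows "\<exists>G. profile a G \<and> (\<forall>x. real N * G 0 x + x * (G (Suc 0) x + \<sigma> * G 0 x) = F 0 x)"
proof -
  obtain H where H: "profile a H" "\<And>x. H 0 x = x ^ (N - 1) * F 0 x"
    using profile_x_power_mult[OF F] by blast
  obtain T where T: "profile a T" "\<And>x. T (Suc 0) x + \<sigma> * T 0 x = H 0 x"
    using profile_ode[OF H(1) a \<sigma>] by blast
  obtain G where G: "profile a G" "\<And>x. G 0 x = T 0 x / x ^ N"
    using profile_x_power_divide[OF T(1) a] by blast
  have "real N * G 0 x + x * (G (Suc 0) x + \<sigma> * G 0 x) = F 0 x" for x
  proof (cases "x = 0")
    case True
    have "G 0 0 = 0" "F 0 0 = 0" using a F G(1) by (auto elim!: profileE)
    then show ?thesis using True by simp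
  next
    case False
    obtain n where n: "N = Suc n" using N by (cases N) auto
    have "((\<lambda>x. T 0 x / x ^ N) has_real_derivative (T (Suc 0) x * x ^ N - T 0 x * (real N * x ^ n)) / (x ^ N * x ^ N)) (at x)"
      using False T(1) unfolding n
      by (intro DERIV_divide) (auto elim: profileE intro!: derivative_eq_intros, cases n, auto simp: algebra_simps)
    moreover have "(G 0 has_real_derivative G (Suc 0) x) (at x)" using G(1) by (auto elim: profileE)
    moreover have "G 0 = (\<lambda>x. T 0 x / x ^ N)" using G(2) by auto
    ultimately have G1: "G (Suc 0) x = (T (Suc 0) x * x ^ N - T 0 x * (real N * x ^ n)) / (x ^ N * x ^ N)"
      by (metis DERIV_unique)
    have T1: "T (Suc 0) x = x ^ n * F 0 x - \<sigma> * T 0 x" using T(2)[of x] H(2)[of x] n by simp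
    show ?thesis using False unfolding G1 G(2) T1 n by (simp add: field_simps)
  qed
  then show ?thesis using G(1) by blast
qed

section \<open>Cutoff functions\<close>

text \<open>The \<open>k\<close>-th derivative of a product. Recursion from the outside in, instead of a sum with binomial
coefficients, makes every property below a plain induction on \<open>k\<close> for all \<open>M\<close> and \<open>F\<close>.\<close>

fun product_seq :: "nat \<Rightarrow> (nat \<Rightarrow> real \<Rightarrow> real) \<Rightarrow> (nat \<Rightarrow> real \<Rightarrow> real) \<Rightarrow> real \<Rightarrow> real" where
  "product_seq 0 M F x = M 0 x * F 0 x"
| "product_seq (Suc k) M F x = product_seq k (\<lambda>j. M (Suc j)) F x + product_seq k M (\<lambda>j. F (Suc j)) x"

lemma deriv_seq_shift: "deriv_seq F \<Longrightarrow> deriv_seq (\<lambda>k. F (Suc k))"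
  by (simp add: deriv_seq_def)

lemma deriv_seq_product:
  assumes "deriv_seq M" "deriv_seq F"
  shows "deriv_seq (\<lambda>k. product_seq k M F)"
proof -
  have "(product_seq k M F has_real_derivative product_seq (Suc k) M F x) (at x)" for k x
    using assms
  proof (induction k arbitrary: M F)
    case 0
    have "product_seq 0 M F = (\<lambda>x. M 0 x * F 0 x)" by auto
    moreover have "((\<lambda>x. M 0 x * F 0 x) has_real_derivative M (Suc 0) x * F 0 x + F (Suc 0) x * M 0 x) (at x)"
      using 0 by (intro DERIV_mult) (auto simp: deriv_seq_def)
    ultimately show ?case by (simp add: mult.commute)
  next
    case (Suc k)
    have "product_seq (Suc k) M F = (\<lambda>x. product_seq k (\<lambda>j. M (Suc j)) F x + product_seq k M (\<lambda>j. F (Suc j)) x)" by auto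
    moreover have "((\<lambda>x. product_seq k (\<lambda>j. M (Suc j)) F x + product_seq k M (\<lambda>j. F (Suc j)) x) has_real_derivative
       product_seq (Suc k) (\<lambda>j. M (Suc j)) F x + product_seq (Suc k) M (\<lambda>j. F (Suc j)) x) (at x)"
      by (intro DERIV_add Suc.IH deriv_seq_shift Suc.prems)
    ultimately show ?case by simp
  qed
  then show ?thesis by (simp add: deriv_seq_def)
qed

lemma product_seq_eq_0:
  assumes "\<And>j. M j x = 0 \<or> (\<forall>i. F i x = 0)" "(\<forall>j. M j x = 0) \<or> (\<forall>i. F i x = 0)"
  shows "product_seq k M F x = 0"
  using assms(2) by (induction k arbitrary: M F) auto

lemma product_seq_bound:
  fixes M :: "'b \<Rightarrow> nat \<Rightarrow> real \<Rightarrow> real"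
  assumes "\<And>j. \<exists>b. \<forall>R x. \<bar>M R j x\<bar> \<le> b" "\<And>k. moderate (F k)"
  shows "\<exists>C m. C \<ge> 0 \<and> (\<forall>R. \<forall>x\<ge>0. \<bar>product_seq k (M R) F x\<bar> \<le> C * (1 + x) ^ m * exp (x / 4))"
  using assms
proof (induction k arbitrary: M F)
  case 0
  obtain b where b: "\<And>R x. \<bar>M R 0 x\<bar> \<le> b" using 0(1)[of 0] by auto
  have "b \<ge> 0" using b[of undefined 0] by simp
  obtain C m where C: "C \<ge> 0" "\<And>x. x \<ge> 0 \<Longrightarrow> \<bar>F 0 x\<bar> \<le> C * (1 + x) ^ m * exp (x / 4)"
    using 0(2)[of 0] by (auto simp: moderate_def)
  have "\<bar>product_seq 0 (M R) F x\<bar> \<le> (b * C) * (1 + x) ^ m * exp (x / 4)" if "x \<ge> 0" for R x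
    using mult_mono[OF b[of R x] C(2)[OF that]] \<open>b \<ge> 0\<close> by (simp add: abs_mult mult.assoc)
  then show ?case using C \<open>b \<ge> 0\<close> by (intro exI[of _ "b * C"] exI[of _ m]) auto
next
  case (Suc k)
  obtain C m where C: "C \<ge> 0" "\<And>R x. x \<ge> 0 \<Longrightarrow> \<bar>product_seq k (\<lambda>j. M R (Suc j)) F x\<bar> \<le> C * (1 + x) ^ m * exp (x / 4)"
    using Suc.IH[of "\<lambda>R j. M R (Suc j)" F] Suc.prems by blast
  obtain D l where D: "D \<ge> 0" "\<And>R x. x \<ge> 0 \<Longrightarrow> \<bar>product_seq k (M R) (\<lambda>j. F (Suc j)) x\<bar> \<le> D * (1 + x) ^ l * exp (x / 4)"
    using Suc.IH[of M "\<lambda>j. F (Suc j)"] Suc.prems by blast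
  have "\<bar>product_seq (Suc k) (M R) F x\<bar> \<le> (C + D) * (1 + x) ^ (m + l) * exp (x / 4)" if "x \<ge> 0" for R x
  proof -
    have "\<bar>product_seq (Suc k) (M R) F x\<bar> \<le> C * (1 + x) ^ m * exp (x / 4) + D * (1 + x) ^ l * exp (x / 4)"
      using C(2)[OF that, of R] D(2)[OF that, of R] by simp
    also have "\<dots> \<le> C * (1 + x) ^ (m + l) * exp (x / 4) + D * (1 + x) ^ (m + l) * exp (x / 4)"
      using that C D by (intro add_mono mult_right_mono mult_left_mono power_increasing) auto
    finally show ?thesis by (simp add: distrib_right)
  qed
  then show ?case using C(1) D(1) by (intro exI[of _ "C + D"] exI[of _ "m + l"]) auto
qed

lemma product_seq_tendsto:
  assumes "\<And>j. (\<lambda>n. M n j x) \<longlonglongrightarrow> L j"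
  shows "(\<lambda>n. product_seq k (M n) F x) \<longlonglongrightarrow> product_seq k (\<lambda>j _. L j) F x"
  using assms
proof (induction k arbitrary: M F L)
  case (Suc k)
  show ?case using Suc.IH[of "\<lambda>n j. M n (Suc j)" "\<lambda>j. L (Suc j)" F] Suc.IH[of M L "\<lambda>j. F (Suc j)"] Suc.prems
    by (auto intro!: tendsto_add)
qed (auto intro!: tendsto_mult)

lemma product_seq_zero: "product_seq k (\<lambda>_ _. 0) F x = 0"
  by (rule product_seq_eq_0) auto

lemma product_seq_one: "product_seq k (\<lambda>j _. if j = 0 then 1 else 0) F x = F k x"
  by (induction k arbitrary: F) (auto simp: product_seq_zero)

text \<open>The \<open>k\<close>-th derivative of \<open>exp (- 1 / x)\<close> is \<open>p\<^sub>k (1 / x) exp (- 1 / x)\<close> with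
\<open>p\<^bsub>k+1\<^esub> (y) = y\<^sup>2 (p\<^sub>k (y) - p\<^sub>k' (y))\<close>.\<close>

fun flat_poly :: "nat \<Rightarrow> real poly" where
  "flat_poly 0 = 1"
| "flat_poly (Suc k) = [:0, 0, 1:] * (flat_poly k - pderiv (flat_poly k))"

definition flat :: "nat \<Rightarrow> real \<Rightarrow> real" where
  "flat k x = (if x > 0 then poly (flat_poly k) (1 / x) * exp (- 1 / x) else 0)"

lemma poly_times_exp_bounded: "\<exists>C. \<forall>y\<ge>0. \<bar>poly q y * exp (- y)\<bar> \<le> (C::real)"
proof -
  have 1: "y ^ i * exp (- y) \<le> fact i" if "y \<ge> 0" for y :: real and i
  proof -
    have "(\<Sum>n\<in>{i}. y ^ n /\<^sub>R fact n) \<le> exp y"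
      unfolding exp_def using that by (intro sum_le_suminf summable_exp_generic) auto
    then show ?thesis by (simp add: exp_minus field_simps)
  qed
  have "\<bar>poly q y * exp (- y)\<bar> \<le> (\<Sum>i\<le>degree q. \<bar>coeff q i\<bar> * fact i)" if "y \<ge> 0" for y
  proof -
    have "\<bar>poly q y * exp (- y)\<bar> = \<bar>\<Sum>i\<le>degree q. coeff q i * (y ^ i * exp (- y))\<bar>"
      by (simp add: poly_altdef sum_distrib_right mult.assoc)
    also have "\<dots> \<le> (\<Sum>i\<le>degree q. \<bar>coeff q i * (y ^ i * exp (- y))\<bar>)" by (rule sum_abs)
    also have "\<dots> \<le> (\<Sum>i\<le>degree q. \<bar>coeff q i\<bar> * fact i)"
      using that 1[OF that] by (intro sum_mono) (auto simp: abs_mult intro!: mult_left_mono)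
    finally show ?thesis .
  qed
  then show ?thesis by blast
qed

lemma flat_bounded: "\<exists>C. \<forall>x. \<bar>flat k x\<bar> \<le> C"
proof -
  obtain C where C: "\<And>y. y \<ge> 0 \<Longrightarrow> \<bar>poly (flat_poly k) y * exp (- y)\<bar> \<le> C"
    using poly_times_exp_bounded by blast
  have "C \<ge> 0" using C[of 0] by linarith
  have "\<bar>flat k x\<bar> \<le> C" for x using C[of "1 / x"] \<open>C \<ge> 0\<close> by (auto simp: flat_def)
  then show ?thesis by blast
qed

text \<open>This quadratic bound is what yields differentiability at \<open>0\<close>, with derivative \<open>0\<close>.\<close>

lemma flat_quadratic: "\<exists>C. \<forall>x. \<bar>flat k x\<bar> \<le> C * x\<^sup>2"
proof -
  obtain C where C: "\<And>y. y \<ge> 0 \<Longrightarrow> \<bar>poly ([:0, 0, 1:] * flat_poly k) y * exp (- y)\<bar> \<le> C"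
    using poly_times_exp_bounded by blast
  have C0: "C \<ge> 0" using C[of 0] by simp
  have "\<bar>flat k x\<bar> \<le> C * x\<^sup>2" for x
  proof (cases "x > 0")
    case True
    have "\<bar>flat k x\<bar> = \<bar>poly ([:0, 0, 1:] * flat_poly k) (1 / x) * exp (- (1 / x))\<bar> * x\<^sup>2"
      using True by (simp add: flat_def abs_mult power2_eq_square field_simps)
    also have "\<dots> \<le> C * x\<^sup>2" using C[of "1 / x"] True by (intro mult_right_mono) auto
    finally show ?thesis .
  next
    case False
    then show ?thesis using C0 by (simp add: flat_def)
  qed
  then show ?thesis by blast
qed

lemma deriv_seq_flat: "deriv_seq flat"
  unfolding deriv_seq_def
proof (intro allI)
  fix k and x :: real
  consider "x < 0" | "x = 0" | "x > 0" by linarith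
  then show "(flat k has_real_derivative flat (Suc k) x) (at x)"
  proof cases
    case 1
    then have "eventually (\<lambda>y. y \<in> {..<0}) (nhds x)" by (intro eventually_nhds_in_open) auto
    then have "eventually (\<lambda>y. flat k y = 0) (nhds x)" by eventually_elim (simp add: flat_def)
    moreover have "flat (Suc k) x = 0" using 1 by (simp add: flat_def)
    ultimately show ?thesis by (subst DERIV_cong_ev[OF refl _ refl, of _ "\<lambda>_. 0"]) auto
  next
    case 2
    obtain C where C: "\<And>x. \<bar>flat k x\<bar> \<le> C * x\<^sup>2" using flat_quadratic by blast
    have "((\<lambda>h. (flat k (0 + h) - flat k 0) / h) \<longlongrightarrow> 0) (at 0)"
    proof (rule Lim_null_comparison)
      show "\<forall>\<^sub>F h in at 0. norm ((flat k (0 + h) - flat k 0) / h) \<le> C * \<bar>h\<bar>"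
      proof (intro always_eventually allI)
        fix h :: real
        show "norm ((flat k (0 + h) - flat k 0) / h) \<le> C * \<bar>h\<bar>"
          using C[of h] by (cases "h = 0") (auto simp: flat_def[of k 0] field_simps power2_eq_square abs_mult_self_eq)
      qed
      show "((\<lambda>h. C * \<bar>h\<bar>) \<longlongrightarrow> 0) (at 0)"
        by (auto intro!: tendsto_eq_intros)
    qed
    moreover have "flat (Suc k) 0 = 0" by (simp add: flat_def)
    ultimately show ?thesis unfolding 2 DERIV_def by simp
  next
    case 3
    let ?p = "flat_poly k"
    have "((\<lambda>x. poly ?p (1 / x) * exp (- 1 / x)) has_real_derivative
        (poly (pderiv ?p) (1 / x) * (- (1 / x\<^sup>2))) * exp (- 1 / x) + (exp (- 1 / x) * (1 / x\<^sup>2)) * poly ?p (1 / x)) (at x)"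
    proof (intro DERIV_mult)
      have "((\<lambda>x. 1 / x) has_real_derivative - (1 / x\<^sup>2)) (at x)"
        using 3 by (auto intro!: derivative_eq_intros simp: power2_eq_square)
      then show "((\<lambda>x. poly ?p (1 / x)) has_real_derivative poly (pderiv ?p) (1 / x) * (- (1 / x\<^sup>2))) (at x)"
        using DERIV_chain2[OF poly_DERIV] by blast
      show "((\<lambda>x. exp (- 1 / x)) has_real_derivative exp (- 1 / x) * (1 / x\<^sup>2)) (at x)"
        using 3 by (auto intro!: derivative_eq_intros simp: power2_eq_square)
    qed
    moreover have "eventually (\<lambda>y. y \<in> {0<..}) (nhds x)" using 3 by (intro eventually_nhds_in_open) auto
    then have "eventually (\<lambda>y. flat k y = poly ?p (1 / y) * exp (- 1 / y)) (nhds x)"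
      by eventually_elim (simp add: flat_def)
    moreover have "flat (Suc k) x = (poly (pderiv ?p) (1 / x) * (- (1 / x\<^sup>2))) * exp (- 1 / x) + (exp (- 1 / x) * (1 / x\<^sup>2)) * poly ?p (1 / x)"
      using 3 by (simp add: flat_def field_simps power2_eq_square)
    ultimately show ?thesis by (subst DERIV_cong_ev[OF refl _ refl]) auto
  qed
qed

text \<open>The derivatives of \<open>x \<mapsto> exp (- 1 / (R - x))\<close>, extended by \<open>0\<close> to \<open>x \<ge> R\<close>. There is no plateau on which
the function is \<open>1\<close>; pointwise convergence as \<open>R \<rightarrow> \<infinity>\<close> with bounds uniform in \<open>R\<close> is enough.\<close>

definition cutoff :: "real \<Rightarrow> nat \<Rightarrow> real \<Rightarrow> real" where
  "cutoff R j x = (- 1) ^ j * flat j (R - x)"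

lemma deriv_seq_cutoff: "deriv_seq (cutoff R)"
  unfolding deriv_seq_def
proof (intro allI)
  fix k x
  have "(flat k has_real_derivative flat (Suc k) (R - x)) (at (R - x))"
    using deriv_seq_flat by (simp add: deriv_seq_def)
  moreover have "((\<lambda>x. R - x) has_real_derivative - 1) (at x)" by (auto intro!: derivative_eq_intros)
  ultimately have "((\<lambda>x. flat k (R - x)) has_real_derivative flat (Suc k) (R - x) * (- 1)) (at x)"
    by (rule DERIV_chain2)
  from DERIV_cmult[OF this, of "(- 1) ^ k"]
  show "(cutoff R k has_real_derivative cutoff R (Suc k) x) (at x)"
    by (simp add: cutoff_def[abs_def])
qed

lemma cutoff_bounded: "\<exists>b. \<forall>R x. \<bar>cutoff R j x\<bar> \<le> b"
  using flat_bounded[of j] by (auto simp: cutoff_def abs_mult power_abs)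

lemma cutoff_eq_0: "x \<ge> R \<Longrightarrow> cutoff R j x = 0"
  by (simp add: cutoff_def flat_def)

lemma cutoff_tendsto: "(\<lambda>n. cutoff (real n) j x) \<longlonglongrightarrow> (if j = 0 then 1 else 0)"
proof (rule Lim_transform_eventually)
  have inv: "(\<lambda>n. 1 / (real n - x)) \<longlonglongrightarrow> 0"
    by real_asymp
  have lim: "(\<lambda>n. (- 1) ^ j * (poly (flat_poly j) (1 / (real n - x)) * exp (- (1 / (real n - x))))) \<longlonglongrightarrow>
      (- 1) ^ j * (poly (flat_poly j) 0 * exp (- 0))"
    by (intro tendsto_intros tendsto_poly inv)
  have val: "(- 1) ^ j * (poly (flat_poly j) 0 * exp (- 0)) = (if j = 0 then 1 else (0::real))"
    by (cases j) auto
  show "(\<lambda>n. (- 1) ^ j * (poly (flat_poly j) (1 / (real n - x)) * exp (- (1 / (real n - x))))) \<longlonglongrightarrow> (if j = 0 then 1 else 0)"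
    using lim unfolding val .
  show "eventually (\<lambda>n. (- 1) ^ j * (poly (flat_poly j) (1 / (real n - x)) * exp (- (1 / (real n - x)))) = cutoff (real n) j x) sequentially"
    using eventually_compose_filterlim[OF eventually_gt_at_top[of x] filterlim_real_sequentially]
    by eventually_elim (auto simp: cutoff_def flat_def)
qed

lemma profile_product_cutoff:
  assumes F: "profile a F"
  shows "profile a (\<lambda>k. product_seq k (cutoff R) F)"
proof (rule profileE[OF F])
  fix c assume c: "c > a" "\<And>k x. x \<le> c \<Longrightarrow> F k x = 0" and m: "\<And>k. moderate (F k)"
  have "deriv_seq (\<lambda>k. product_seq k (cutoff R) F)"
    using F by (intro deriv_seq_product deriv_seq_cutoff) (simp add: profile_def)
  moreover have "\<forall>k. \<forall>x\<le>c. product_seq k (cutoff R) F x = 0"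
    using c(2) by (auto intro!: product_seq_eq_0)
  moreover have "moderate (product_seq k (cutoff R) F)" for k
    using product_seq_bound[of "\<lambda>_::unit. cutoff R" F k] cutoff_bounded m unfolding moderate_def by blast
  ultimately show ?thesis using c(1) unfolding profile_def by blast
qed

lemma profile_flat:
  assumes "c > a"
  shows "profile a (\<lambda>k x. flat k (x - c))"
proof -
  have "deriv_seq (\<lambda>k x. flat k (x - c))"
    unfolding deriv_seq_def
  proof (intro allI)
    fix k x
    have "(flat k has_real_derivative flat (Suc k) (x - c)) (at (x - c))"
      using deriv_seq_flat by (simp add: deriv_seq_def)
    moreover have "((\<lambda>x. x - c) has_real_derivative 1) (at x)" by (auto intro!: derivative_eq_intros)
    ultimately show "((\<lambda>x. flat k (x - c)) has_real_derivative flat (Suc k) (x - c)) (at x)"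
      using DERIV_chain2 by fastforce
  qed
  moreover have "moderate (\<lambda>x. flat k (x - c))" for k
  proof -
    obtain C where C: "\<And>x. \<bar>flat k x\<bar> \<le> C" using flat_bounded by blast
    have "C \<ge> 0" using C[of 0] by linarith
    have "\<bar>flat k (x - c)\<bar> \<le> C * (1 + x) ^ 0 * exp (x / 4)" if "x \<ge> 0" for x
      using C[of "x - c"] mult_left_mono[of 1 "exp (x / 4)" C] \<open>C \<ge> 0\<close> that by simp
    then show ?thesis unfolding moderate_def using \<open>C \<ge> 0\<close> by blast
  qed
  moreover have "\<forall>k. \<forall>x\<le>c. flat k (x - c) = 0" by (simp add: flat_def)
  ultimately show ?thesis using assms unfolding profile_def by blast
qed

section \<open>Twisted convolution and twisted derivatives\<close>

text \<open>The twisted convolution of \<open>f\<close> and \<open>g\<close>: a superposition of twisted spherical means if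
\<open>g\<close> is a polynomial times a radial function.\<close>

definition tconv :: "(complex ^ 'n::finite \<Rightarrow> complex) \<Rightarrow> (complex ^ 'n \<Rightarrow> complex) \<Rightarrow> complex ^ 'n \<Rightarrow> complex" where
  "tconv f g z = (\<integral>w. f (z - w) * exp (\<i> / 2 * of_real (Im (hdot z w))) * g w \<partial>lborel)"

text \<open>The twisted derivative \<open>A g\<close>. The multiplication operator is chosen such that the twisted
convolution with \<open>A g\<close> is a first-order differential operator in \<open>z\<close> applied to the twisted
convolution with \<open>g\<close>.\<close>

definition tderiv :: "bool \<Rightarrow> 'n::finite \<Rightarrow> (complex ^ 'n \<Rightarrow> complex) \<Rightarrow> complex ^ 'n \<Rightarrow> complex" where
  "tderiv b i g w = wirt b i g w + (if b then 1 else - 1) / 4 * coord (\<not> b) i w * g w"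

lemma hdot_add_left: "hdot (x + y) w = hdot x w + hdot y w"
  and hdot_scaleR_left: "hdot (c *\<^sub>R x) w = of_real c * hdot x w"
  and hdot_diff_right: "hdot x (v - w) = hdot x v - hdot x w"
  by (simp_all add: hdot_def sum.distrib sum_subtractf sum_distrib_left algebra_simps
      scaleR_conv_of_real[of _ "_ :: complex"])

lemma Im_hdot_self: "Im (hdot z z) = 0"
  by (simp add: hdot_def)

lemma continuous_on_hdot [continuous_intros]:
  "continuous_on S g \<Longrightarrow> continuous_on S h \<Longrightarrow> continuous_on S (\<lambda>x. hdot (g x) (h x))"
  unfolding hdot_def by (intro continuous_intros)

lemma lborel_integral_reflect:
  fixes h :: "'a::euclidean_space \<Rightarrow> complex"
  assumes "h \<in> borel_measurable borel"
  shows "(\<integral>w. h w \<partial>lborel) = (\<integral>u. h (z - u) \<partial>lborel)"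
proof -
  have "lborel = distr lborel borel (\<lambda>x::'a. z + (-1) *\<^sub>R x)"
    using lborel_affine[of "-1" z] by (simp add: density_1)
  then have "(\<integral>w. h w \<partial>lborel) = (\<integral>w. h w \<partial>distr lborel borel (\<lambda>x::'a. z + (-1) *\<^sub>R x))" by simp
  also have "\<dots> = (\<integral>u. h (z - u) \<partial>lborel)"
    using assms by (subst integral_distr) simp_all
  finally show ?thesis .
qed

text \<open>After \<open>w = z - u\<close> only \<open>g\<close> and the exponential depend on \<open>z\<close>, and \<open>f\<close> need not be differentiated.
The diagonal term of the phase drops out as \<open>hdot z z\<close> is real.\<close>

lemma tconv_translate:
  assumes "continuous_on UNIV f" "continuous_on UNIV g"
  shows "tconv f g z = (\<integral>u. f u * exp (- (\<i> / 2 * of_real (Im (hdot z u)))) * g (z - u) \<partial>lborel)"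
proof -
  have m: "(\<lambda>w. f (z - w) * exp (\<i> / 2 * of_real (Im (hdot z w))) * g w) \<in> borel_measurable borel"
    by (intro borel_measurable_continuous_onI continuous_intros assms continuous_on_compose2[OF assms(1)]) auto
  show ?thesis
    unfolding tconv_def
    by (subst lborel_integral_reflect[OF m, of z]) (simp add: hdot_diff_right Im_hdot_self)
qed

lemma integrable_continuous_compact_support:
  fixes h :: "'a::euclidean_space \<Rightarrow> complex"
  assumes h: "continuous_on UNIV h" and s: "\<And>w. w \<notin> cbox a b \<Longrightarrow> h w = 0"
  shows "integrable lborel h" and "(\<integral>w. h w \<partial>lborel) = integral (cbox a b) h"
proof -
  have "set_integrable lborel (cbox a b) h"
    using borel_integrable_compact[OF compact_cbox continuous_on_subset[OF h]] by (auto simp: set_integrable_def)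
  moreover have eq: "(\<lambda>w. indicator (cbox a b) w *\<^sub>R h w) = h"
    using s by (auto simp: indicator_def)
  ultimately show i: "integrable lborel h" by (simp add: set_integrable_def)
  have "(\<integral>w. h w \<partial>lborel) = integral UNIV h"
    using integral_lborel[OF i] by simp
  also have "\<dots> = integral UNIV (\<lambda>w. if w \<in> cbox a b then h w else 0)"
    using s by (intro integral_cong) auto
  also have "\<dots> = integral (cbox a b) h" by (rule integral_restrict_UNIV)
  finally show "(\<integral>w. h w \<partial>lborel) = integral (cbox a b) h" .
qed

text \<open>Differentiation under the integral sign in the direction \<open>v\<close>. As \<open>g\<close> has bounded support, for
the relevant \<open>z + t v\<close> with \<open>|t| \<le> 1\<close> all integrands live on one box, and the Leibniz rule for
integrals over boxes applies.\<close>

lemma tconv_directional: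
  fixes f g :: "complex ^ 'n::finite \<Rightarrow> complex"
  assumes f: "continuous_on UNIV f"
    and g: "\<And>w. g differentiable (at w)"
    and g': "continuous_on UNIV (\<lambda>w. frechet_derivative g (at w) v)"
    and supp: "\<And>w. norm w > r \<Longrightarrow> g w = 0"
    and zero: "\<And>z. norm z < \<delta> \<Longrightarrow> tconv f g z = 0" and z: "norm z < \<delta>"
  shows "has_bochner_integral lborel (\<lambda>u. f u * exp (- (\<i> / 2 * of_real (Im (hdot z u)))) *
      (frechet_derivative g (at (z - u)) v - \<i> / 2 * of_real (Im (hdot v u)) * g (z - u))) 0"
proof -
  have gc: "continuous_on UNIV g"
    by (intro differentiable_imp_continuous_on) (auto simp: differentiable_on_def intro: differentiable_at_withinI g)
  obtain a b :: "complex ^ 'n" where ab: "cball 0 (norm z + norm v + \<bar>r\<bar>) \<subseteq> cbox a b"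
    using bounded_subset_cbox_symmetric[of "cball 0 (norm z + norm v + \<bar>r\<bar>)"] bounded_cball by metis
  define k where "k t u = f u * exp (- (\<i> / 2 * of_real (Im (hdot (z + t *\<^sub>R v) u)))) * g (z + t *\<^sub>R v - u)" for t u
  define k' where "k' t u = f u * exp (- (\<i> / 2 * of_real (Im (hdot (z + t *\<^sub>R v) u)))) *
      (frechet_derivative g (at (z + t *\<^sub>R v - u)) v - \<i> / 2 * of_real (Im (hdot v u)) * g (z + t *\<^sub>R v - u))" for t u
  have out: "norm (z + t *\<^sub>R v - u) > r" if "u \<notin> cbox a b" "\<bar>t\<bar> \<le> 1" for t u
  proof -
    have "norm u > norm z + norm v + \<bar>r\<bar>" using that(1) ab by (auto simp: subset_iff not_le[symmetric])
    moreover have "norm (t *\<^sub>R v) \<le> norm v" using that(2) mult_right_mono[of "\<bar>t\<bar>" 1 "norm v"] by simp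
    moreover have "norm u \<le> norm (z + t *\<^sub>R v - u) + norm z + norm (t *\<^sub>R v)"
      using norm_triangle_ineq4[of "z + t *\<^sub>R v" "z + t *\<^sub>R v - u"] norm_triangle_ineq[of z "t *\<^sub>R v"] by simp
    ultimately show ?thesis by linarith
  qed
  have fd0: "frechet_derivative g (at w) v = 0" if "norm w > r" for w
  proof -
    have "((\<lambda>_. 0) has_derivative (\<lambda>_. 0)) (at w)" by simp
    moreover have "eventually (\<lambda>y. y \<in> - cball 0 r) (nhds w)"
      using that by (intro eventually_nhds_in_open) auto
    then have "eventually (\<lambda>y. 0 = g y) (nhds w)" by eventually_elim (simp add: supp)
    ultimately have "(g has_derivative (\<lambda>_. 0)) (at w)"
      using has_derivative_transform_eventually[of "\<lambda>_. 0" "\<lambda>_. 0" w UNIV g] supp[OF that]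
      by (auto simp: eventually_nhds eventually_at_filter)
    from frechet_derivative_at[OF this] show ?thesis by metis
  qed
  have contk: "continuous_on UNIV (k t)" for t
    unfolding k_def
    by (intro continuous_intros f continuous_on_compose2[OF gc]) auto
  have contk': "continuous_on S (\<lambda>(t, u). k' t u)" for S
    unfolding k'_def split_beta'
    by (intro continuous_intros continuous_on_compose2[OF f] continuous_on_compose2[OF gc]
        continuous_on_compose2[OF g']) auto
  have ik: "(\<integral>u. k t u \<partial>lborel) = integral (cbox a b) (k t)" if "\<bar>t\<bar> \<le> 1" for t
    by (rule integrable_continuous_compact_support[OF contk]) (simp add: k_def supp[OF out[OF _ that]])
  have k'0: "continuous_on UNIV (k' 0)" "\<And>w. w \<notin> cbox a b \<Longrightarrow> k' 0 w = 0"
    using continuous_on_compose2[OF contk'[of UNIV], of UNIV "\<lambda>u. (0, u)"] out[of _ 0]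
    by (simp_all add: continuous_on_Pair k'_def supp fd0)
  note ik' = integrable_continuous_compact_support[OF k'0(1), where a = a and b = b, OF k'0(2)]
  have dk: "((\<lambda>t. k t u) has_vector_derivative k' t u) (at t within {-1..1})" for t u
  proof -
    have "((\<lambda>t. z + t *\<^sub>R v - u) has_derivative (\<lambda>h. h *\<^sub>R v)) (at t within {-1..1})"
      by (auto intro!: derivative_eq_intros)
    from has_derivative_compose[OF this g[unfolded frechet_derivative_works]]
    have 1: "((\<lambda>t. g (z + t *\<^sub>R v - u)) has_derivative (\<lambda>h. frechet_derivative g (at (z + t *\<^sub>R v - u)) (h *\<^sub>R v))) (at t within {-1..1})" .
    have "linear (frechet_derivative g (at (z + t *\<^sub>R v - u)))"
      using g by (rule linear_frechet_derivative)
    with 1 have 2: "((\<lambda>t. g (z + t *\<^sub>R v - u)) has_vector_derivative frechet_derivative g (at (z + t *\<^sub>R v - u)) v) (at t within {-1..1})"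
      by (simp add: has_vector_derivative_def linear_cmul)
    have "((\<lambda>t. - (\<i> / 2 * of_real (Im (hdot z u) + t * Im (hdot v u)))) has_vector_derivative - (\<i> / 2 * of_real (Im (hdot v u)))) (at t within {-1..1})"
      by (auto intro!: derivative_eq_intros simp: has_vector_derivative_def scaleR_conv_of_real algebra_simps)
    from field_vector_diff_chain_within[OF this, of exp]
    have 3: "((\<lambda>t. exp (- (\<i> / 2 * of_real (Im (hdot z u) + t * Im (hdot v u))))) has_vector_derivative
       - (\<i> / 2 * of_real (Im (hdot v u))) * exp (- (\<i> / 2 * of_real (Im (hdot z u) + t * Im (hdot v u))))) (at t within {-1..1})"
      by (auto simp: o_def intro: DERIV_exp has_field_derivative_at_within)
    have "k t u = f u * (exp (- (\<i> / 2 * of_real (Im (hdot z u) + t * Im (hdot v u)))) * g (z + t *\<^sub>R v - u))" for t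
      by (simp add: k_def hdot_add_left hdot_scaleR_left)
    moreover have "((\<lambda>t. f u * (exp (- (\<i> / 2 * of_real (Im (hdot z u) + t * Im (hdot v u)))) * g (z + t *\<^sub>R v - u))) has_vector_derivative
       f u * (exp (- (\<i> / 2 * of_real (Im (hdot z u) + t * Im (hdot v u)))) * frechet_derivative g (at (z + t *\<^sub>R v - u)) v +
        (- (\<i> / 2 * of_real (Im (hdot v u))) * exp (- (\<i> / 2 * of_real (Im (hdot z u) + t * Im (hdot v u))))) * g (z + t *\<^sub>R v - u))) (at t within {-1..1})"
      by (intro has_vector_derivative_mult_right has_vector_derivative_mult 2 3)
    ultimately show ?thesis
      by (simp add: k'_def hdot_add_left hdot_scaleR_left algebra_simps)
  qed
  have "((\<lambda>t. integral (cbox a b) (k t)) has_vector_derivative integral (cbox a b) (k' 0)) (at 0 within {-1..1})"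
  proof (rule leibniz_rule_vector_derivative)
    show "k t integrable_on cbox a b" for t
      using contk by (intro integrable_continuous continuous_on_subset[OF contk]) auto
  qed (use dk contk' in auto)
  moreover have "at (0::real) within {-1..1} = at 0"
    by (intro at_within_interior) (auto simp: interior_atLeastAtMost_real)
  ultimately have D: "((\<lambda>t. integral (cbox a b) (k t)) has_vector_derivative integral (cbox a b) (k' 0)) (at 0)" by simp
  have "((\<lambda>t. z + t *\<^sub>R v) \<longlongrightarrow> z + 0 *\<^sub>R v) (nhds 0)"
    by (intro tendsto_intros filterlim_ident)
  then have "eventually (\<lambda>t. z + t *\<^sub>R v \<in> ball 0 \<delta>) (nhds 0)"
    using z by (intro topological_tendstoD) auto
  moreover have "eventually (\<lambda>t::real. t \<in> ball 0 1) (nhds 0)" by (intro eventually_nhds_in_open) auto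
  \<comment> \<open>The function that was differentiated vanishes near \<open>t = 0\<close>, so its derivative is \<open>0\<close>.\<close>
  ultimately have ev: "eventually (\<lambda>t. integral (cbox a b) (k t) = 0) (nhds 0)"
  proof eventually_elim
    case (elim t)
    have "integral (cbox a b) (k t) = tconv f g (z + t *\<^sub>R v)"
      using elim ik[of t] by (simp add: tconv_translate[OF f gc] k_def)
    then show ?case using zero elim by simp
  qed
  have "((\<lambda>t. integral (cbox a b) (k t)) has_vector_derivative 0) (at 0)"
  proof -
    obtain e where e: "e > 0" "\<And>t. dist t 0 < e \<Longrightarrow> integral (cbox a b) (k t) = 0"
      using ev unfolding eventually_nhds_metric by blast
    show ?thesis
      by (rule has_vector_derivative_transform_within[of "\<lambda>_. 0" 0 0 UNIV e, rotated]) (simp_all add: e)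
  qed
  with D have "integral (cbox a b) (k' 0) = 0" by (rule vector_derivative_unique_at)
  moreover have "(\<lambda>u. f u * exp (- (\<i> / 2 * of_real (Im (hdot z u)))) *
      (frechet_derivative g (at (z - u)) v - \<i> / 2 * of_real (Im (hdot v u)) * g (z - u))) = k' 0"
    by (simp add: k'_def fun_eq_iff)
  ultimately show ?thesis using ik' by (simp add: has_bochner_integral_iff)
qed

lemma tconv_eq_0_has_bochner_integral:
  fixes f g :: "complex ^ 'n::finite \<Rightarrow> complex"
  assumes f: "continuous_on UNIV f" and g: "continuous_on UNIV g"
    and supp: "\<And>w. norm w > r \<Longrightarrow> g w = 0" and zero: "tconv f g z = 0"
  shows "has_bochner_integral lborel (\<lambda>u. f u * exp (- (\<i> / 2 * of_real (Im (hdot z u)))) * g (z - u)) 0"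
proof -
  obtain a b :: "complex ^ 'n" where ab: "cball 0 (norm z + \<bar>r\<bar>) \<subseteq> cbox a b"
    using bounded_subset_cbox_symmetric[of "cball 0 (norm z + \<bar>r\<bar>)"] bounded_cball by metis
  have "norm (z - u) > r" if "u \<notin> cbox a b" for u
  proof -
    have "norm u > norm z + \<bar>r\<bar>" using that ab by (auto simp: subset_iff not_le[symmetric])
    then show ?thesis using norm_triangle_ineq4[of z "z - u"] by simp
  qed
  then have "integrable lborel (\<lambda>u. f u * exp (- (\<i> / 2 * of_real (Im (hdot z u)))) * g (z - u))"
    by (intro integrable_continuous_compact_support(1)[where a = a and b = b] continuous_intros f
         continuous_on_compose2[OF g]) (auto simp: supp)
  then show ?thesis using zero by (simp add: has_bochner_integral_iff tconv_translate[OF f g])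
qed

text \<open>The algebra behind the next lemma: \<open>s = \<plusminus>1\<close> is the sign in the twisted derivative, \<open>W\<close> and \<open>V\<close> are the two
Wirtinger derivatives, \<open>c\<close> and \<open>R - s \<i> I\<close> are the coordinates of \<open>z\<close> and \<open>u\<close>. The combination of the
directional derivatives along \<open>e\<^sub>i\<close> and \<open>\<i> e\<^sub>i\<close> produces the coordinate of \<open>u\<close>, which is replaced by
that of \<open>z - u\<close> at the cost of a multiple of the undifferentiated integrand.\<close>

lemma twist_identity:
  fixes s c W V R I g :: complex
  assumes "s = 1 \<or> s = -1"
  shows "1 / 2 * (W + V) + s / 2 * (W - V) + s / 4 * (c - (R - s * \<i> * I)) * g =
    1 / 2 * (W + V + \<i> / 2 * I * g) + (- s * \<i> / 2 * (\<i> * (W - V) - \<i> / 2 * R * g) + s / 4 * c * g)"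
proof -
  define X where "X = W - V"
  define Y where "Y = R * g"
  define Z where "Z = \<i> * (I * g)"
  define K where "K = c * g"
  have ss: "s * s = 1" using assms by auto
  have L: "s / 4 * (c - (R - s * \<i> * I)) * g = s / 4 * (K - Y) + (s * s) / 4 * Z"
    unfolding Y_def Z_def K_def by (simp add: algebra_simps)
  have J: "- s * \<i> / 2 * (\<i> * X - \<i> / 2 * R * g) = s / 2 * X - s / 4 * Y"
  proof -
    have "\<i> * (\<i> * x) = - x" for x by (simp flip: mult.assoc)
    then show ?thesis unfolding Y_def by (simp add: right_diff_distrib mult.assoc)
  qed
  have M: "\<i> / 2 * I * g = Z / 2" by (simp add: Z_def)
  show ?thesis unfolding X_def[symmetric] L J M ss K_def[symmetric] mult.assoc[of "s / 4" c g]
    by (simp add: distrib_left right_diff_distrib)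
qed

lemma tconv_tderiv:
  fixes f g :: "complex ^ 'n::finite \<Rightarrow> complex"
  assumes f: "continuous_on UNIV f"
    and g: "\<And>w. g differentiable (at w)"
    and g': "\<And>b. continuous_on UNIV (wirt b i g)"
    and supp: "\<And>w. norm w > r \<Longrightarrow> g w = 0"
    and zero: "\<And>z. norm z < \<delta> \<Longrightarrow> tconv f g z = 0" and z: "norm z < \<delta>"
  shows "tconv f (tderiv b i g) z = 0"
proof -
  have gc: "continuous_on UNIV g"
    by (intro differentiable_imp_continuous_on) (auto simp: differentiable_on_def intro: differentiable_at_withinI g)
  define E where "E u = f u * exp (- (\<i> / 2 * of_real (Im (hdot z u))))" for u
  define s :: complex where "s = (if b then 1 else - 1)"
  define v1 v2 :: "complex ^ 'n" where "v1 = axis i 1" and "v2 = axis i \<i>"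
  define D where "D v u = frechet_derivative g (at (z - u)) v - \<i> / 2 * of_real (Im (hdot v u)) * g (z - u)" for v u
  have hdot_axis: "hdot (axis i c) u = c * cnj (u $ i)" for c u
    unfolding hdot_def by (subst sum.remove[of _ i]) (auto simp: axis_def intro!: sum.neutral)
  have I1: "has_bochner_integral lborel (\<lambda>u. E u * D v1 u) 0" and I2: "has_bochner_integral lborel (\<lambda>u. E u * D v2 u) 0"
    unfolding E_def D_def
    by (rule tconv_directional[OF f g _ supp zero z];
        simp add: v1_def v2_def frechet_derivative_axis; intro continuous_intros g')+
  have I0: "has_bochner_integral lborel (\<lambda>u. E u * g (z - u)) 0"
    unfolding E_def by (rule tconv_eq_0_has_bochner_integral[OF f gc supp zero[OF z]])
  have eq: "E u * tderiv b i g (z - u) = 1 / 2 * (E u * D v1 u) + (- s * \<i> / 2 * (E u * D v2 u) + s / 4 * coord (\<not> b) i z * (E u * g (z - u)))" for u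
  proof -
    have 1: "D v1 u = wirt True i g (z - u) + wirt False i g (z - u) + \<i> / 2 * of_real (Im (u $ i)) * g (z - u)"
      and 2: "D v2 u = \<i> * (wirt True i g (z - u) - wirt False i g (z - u)) - \<i> / 2 * of_real (Re (u $ i)) * g (z - u)"
      by (simp_all add: D_def v1_def v2_def frechet_derivative_axis hdot_axis)
    have 3: "coord (\<not> b) i (z - u) = coord (\<not> b) i z - (of_real (Re (u $ i)) - s * \<i> * of_real (Im (u $ i)))"
      by (simp add: coord_def s_def complex_eq_iff)
    have 4: "wirt b i g (z - u) = (1 / 2) * (wirt True i g (z - u) + wirt False i g (z - u)) + s / 2 * (wirt True i g (z - u) - wirt False i g (z - u))"
      by (simp add: s_def field_simps)
    have "tderiv b i g (z - u) = 1 / 2 * D v1 u + (- s * \<i> / 2 * D v2 u + s / 4 * coord (\<not> b) i z * g (z - u))"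
      unfolding tderiv_def 1 2 3 4 s_def[symmetric] by (rule twist_identity) (simp add: s_def)
    then show ?thesis
      by (simp only: distrib_left mult.left_commute[of "E u"])
  qed
  have "has_bochner_integral lborel (\<lambda>u. E u * tderiv b i g (z - u)) (1 / 2 * 0 + (- s * \<i> / 2 * 0 + s / 4 * coord (\<not> b) i z * 0))"
    unfolding eq
    by (intro has_bochner_integral_add has_bochner_integral_mult_right I1 I2 I0)
  moreover have "continuous_on UNIV (tderiv b i g)"
    unfolding tderiv_def[abs_def]
    by (intro continuous_intros g' gc linear_continuous_on bounded_linear_coord)
  ultimately show ?thesis
    by (simp add: tconv_translate[OF f] E_def has_bochner_integral_iff)
qed

section \<open>Test functions\<close>

lemma wirt_eq_0_outside:
  assumes "\<And>w. norm w > r \<Longrightarrow> g w = 0" "norm w > r"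
  shows "wirt b i g w = 0"
proof -
  have "eventually (\<lambda>y. y \<in> - cball 0 r) (nhds w)"
    using assms(2) by (intro eventually_nhds_in_open) auto
  then obtain e where e: "e > 0" "\<And>y. dist y w < e \<Longrightarrow> norm y > r"
    unfolding eventually_nhds_metric by (force simp: not_le)
  have "(g has_derivative (\<lambda>_. 0)) (at w)"
    by (rule has_derivative_transform_within[of "\<lambda>_. 0" _ w UNIV e]) (simp_all add: e assms(1))
  from wirt_eqI[OF this] show ?thesis by simp
qed

lemma tderiv_eq_0_outside:
  assumes "\<And>w. norm w > r \<Longrightarrow> g w = 0" "norm w > r"
  shows "tderiv b i g w = 0"
  using wirt_eq_0_outside[OF assms, where b = b and i = i] assms by (simp add: tderiv_def)

text \<open>Sums of products of a polynomial and a radial profile in \<open>|w|\<^sup>2\<close>. Sums are included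
because the derivative of one product is a sum of two.\<close>

inductive test_fun :: "real \<Rightarrow> (complex ^ 'n::finite \<Rightarrow> complex) \<Rightarrow> bool" for a :: real where
  base: "wpoly m P \<Longrightarrow> profile a F \<Longrightarrow> test_fun a (\<lambda>w. P w * of_real (F 0 ((norm w)\<^sup>2)))"
| add: "test_fun a g \<Longrightarrow> test_fun a h \<Longrightarrow> test_fun a (\<lambda>w. g w + h w)"

text \<open>\<open>G R\<close> arises from \<open>g\<close> by cutting off the profiles at \<open>|w|\<^sup>2 = R\<close>. Derivatives are taken after the
cutoff, so the derivatives of the cutoff function occur in \<open>G R\<close>; the relation is stable under
differentiation for this reason.\<close>

inductive cutoff_limit :: "real \<Rightarrow> (nat \<Rightarrow> complex ^ 'n::finite \<Rightarrow> complex) \<Rightarrow> (complex ^ 'n \<Rightarrow> complex) \<Rightarrow> bool" for a :: real where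
  base: "wpoly m P \<Longrightarrow> profile a F \<Longrightarrow>
    cutoff_limit a (\<lambda>R w. P w * of_real (product_seq k (cutoff (real R)) F ((norm w)\<^sup>2))) (\<lambda>w. P w * of_real (F k ((norm w)\<^sup>2)))"
| add: "cutoff_limit a G g \<Longrightarrow> cutoff_limit a H h \<Longrightarrow> cutoff_limit a (\<lambda>R w. G R w + H R w) (\<lambda>w. g w + h w)"

lemma profile_has_derivative: "profile a F \<Longrightarrow> (F k has_real_derivative F (Suc k) x) (at x)"
  by (auto elim: profileE)

lemma profile_shift_n: "profile a F \<Longrightarrow> profile a (\<lambda>j. F (k + j))"
  by (induction k) (auto dest: profile_shift)

lemma differentiable_radial: "profile a F \<Longrightarrow> (\<lambda>w::complex^'n::finite. complex_of_real (F k ((norm w)\<^sup>2))) differentiable (at w)"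
  using has_derivative_radial[OF profile_has_derivative[of a F k]] by (auto simp: differentiable_def)

text \<open>A Wirtinger derivative of a function of \<open>|w|\<^sup>2\<close> brings out the opposite coordinate, since
\<open>|w|\<^sup>2\<close> is the sum of the products of opposite coordinates.\<close>

lemma wirt_base:
  assumes "wpoly m P" "profile a F"
  shows "wirt b i (\<lambda>w. P w * of_real (F k ((norm w)\<^sup>2))) =
     (\<lambda>w. wirt b i P w * of_real (F k ((norm w)\<^sup>2)) + (coord (\<not> b) i w * P w) * of_real (F (Suc k) ((norm w)\<^sup>2)))"
  using assms
  by (intro ext, subst wirt_mult)
    (auto simp: wirt_radial[OF profile_has_derivative] wpoly_differentiable differentiable_radial)

lemma tderiv_base:
  assumes "wpoly m P" "profile a F"
  shows "tderiv b i (\<lambda>w. P w * of_real (F k ((norm w)\<^sup>2))) =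
     (\<lambda>w. wirt b i P w * of_real (F k ((norm w)\<^sup>2)) + coord (\<not> b) i w * P w *
       of_real (F (Suc k) ((norm w)\<^sup>2) + (if b then 1 else - 1) / 4 * F k ((norm w)\<^sup>2)))"
  by (simp add: tderiv_def fun_eq_iff wirt_base[OF assms] algebra_simps)

lemma test_fun_differentiable: "test_fun a g \<Longrightarrow> g differentiable (at w)"
  by (induction rule: test_fun.induct) (auto simp: wpoly_differentiable differentiable_radial)

lemma test_fun_base': "wpoly m P \<Longrightarrow> profile a F \<Longrightarrow> test_fun a (\<lambda>w. P w * of_real (F k ((norm w)\<^sup>2)))"
  using test_fun.base[of m P a "\<lambda>j. F (k + j)"] profile_shift_n[of a F k] by simp

lemma test_fun_wirt: "test_fun a g \<Longrightarrow> test_fun a (wirt b i g)"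
proof (induction rule: test_fun.induct)
  case (base m P F)
  show ?case unfolding wirt_base[OF base]
    by (intro test_fun.add test_fun_base'[OF wpoly_wirt[OF base(1)] base(2)] test_fun_base'[OF wpoly.mult[OF base(1)] base(2)])
next
  case (add g h)
  have "wirt b i (\<lambda>w. g w + h w) = (\<lambda>w. wirt b i g w + wirt b i h w)"
    by (rule ext, rule wirt_add) (auto intro: test_fun_differentiable add)
  then show ?case using add by (auto intro: test_fun.add)
qed

lemma test_fun_coord_mult: "test_fun a g \<Longrightarrow> test_fun a (\<lambda>w. coord b i w * g w)"
proof (induction rule: test_fun.induct)
  case (base m P F)
  show ?case using test_fun.base[OF wpoly.mult[OF base(1)] base(2), of b i] by (simp add: mult.assoc)
next
  case (add g h)
  then show ?case by (simp add: distrib_left test_fun.add)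
qed

lemma test_fun_cmult: "test_fun a g \<Longrightarrow> test_fun a (\<lambda>w. c * g w)"
proof (induction rule: test_fun.induct)
  case (base m P F)
  show ?case using test_fun.base[OF wpoly_cmult[OF base(1)] base(2), of c] by (simp add: mult.assoc)
next
  case (add g h)
  then show ?case by (simp add: distrib_left test_fun.add)
qed

lemma test_fun_tderiv: "test_fun a g \<Longrightarrow> test_fun a (tderiv b i g)"
  unfolding tderiv_def[abs_def] mult.assoc by (intro test_fun.add test_fun_wirt test_fun_cmult test_fun_coord_mult)

lemma test_fun_continuous: "test_fun a g \<Longrightarrow> continuous_on S g"
  by (rule continuous_at_imp_continuous_on)
    (auto intro: differentiable_imp_continuous_within test_fun_differentiable)

lemma tderiv_add: "test_fun a g \<Longrightarrow> test_fun a h \<Longrightarrow> tderiv b i (\<lambda>w. g w + h w) = (\<lambda>w. tderiv b i g w + tderiv b i h w)"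
  by (rule ext) (simp add: tderiv_def wirt_add[OF test_fun_differentiable test_fun_differentiable] algebra_simps)

lemma tderiv_cmult: "test_fun a g \<Longrightarrow> tderiv b i (\<lambda>w. c * g w) = (\<lambda>w. c * tderiv b i g w)"
  by (rule ext) (simp add: tderiv_def wirt_cmult[OF test_fun_differentiable] algebra_simps)

lemma cutoff_limit_test_fun: "cutoff_limit a G g \<Longrightarrow> test_fun a (G R) \<and> test_fun a g"
proof (induction rule: cutoff_limit.induct)
  case (base m P F k)
  then show ?case using test_fun_base'[OF base(1) profile_product_cutoff[OF base(2), of "real R"], of k]
    by (auto intro: test_fun_base')
qed (auto intro: test_fun.add)

lemma cutoff_limit_tderiv: "cutoff_limit a G g \<Longrightarrow> cutoff_limit a (\<lambda>R. tderiv b i (G R)) (tderiv b i g)"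
proof (induction rule: cutoff_limit.induct)
  case (base m P F k)
  have p: "wpoly (Suc m) (\<lambda>w. wirt b i P w + (if b then 1 else - 1) / 4 * (coord (\<not> b) i w * P w))"
    by (intro wpoly.add wpoly_cmult wpoly.mult base wpoly_Suc wpoly_wirt)
  have eq: "tderiv b i (\<lambda>w. P w * of_real (F k ((norm w)\<^sup>2))) =
     (\<lambda>w. (wirt b i P w + (if b then 1 else - 1) / 4 * (coord (\<not> b) i w * P w)) * of_real (F k ((norm w)\<^sup>2))
       + (coord (\<not> b) i w * P w) * of_real (F (Suc k) ((norm w)\<^sup>2)))" if "profile a F" for F k
    unfolding tderiv_base[OF base(1) that] by (simp add: fun_eq_iff algebra_simps)
  show ?case
    unfolding eq[OF base(2)] eq[OF profile_product_cutoff[OF base(2)]]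
    by (intro cutoff_limit.add cutoff_limit.base[OF p base(2)] cutoff_limit.base[OF wpoly.mult[OF base(1)] base(2)])
next
  case (add G g H h)
  have "tderiv b i (\<lambda>w. G R w + H R w) = (\<lambda>w. tderiv b i (G R) w + tderiv b i (H R) w)" for R
    using tderiv_add cutoff_limit_test_fun[OF add(1)] cutoff_limit_test_fun[OF add(2)] by blast
  moreover have "tderiv b i (\<lambda>w. g w + h w) = (\<lambda>w. tderiv b i g w + tderiv b i h w)"
    using tderiv_add cutoff_limit_test_fun[OF add(1)] cutoff_limit_test_fun[OF add(2)] by blast
  ultimately show ?case using cutoff_limit.add[OF add.IH] by simp
qed

definition tderivs :: "(bool \<times> 'n::finite) list \<Rightarrow> (complex ^ 'n \<Rightarrow> complex) \<Rightarrow> complex ^ 'n \<Rightarrow> complex" where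
  "tderivs ds g = foldr (\<lambda>(b, i). tderiv b i) ds g"

lemma tderivs_simps [simp]:
  "tderivs [] g = g" "tderivs ((b, i) # ds) g = tderiv b i (tderivs ds g)"
  "tderivs (ds @ [(b, i)]) g = tderivs ds (tderiv b i g)"
  by (simp_all add: tderivs_def)

lemma test_fun_tderivs: "test_fun a g \<Longrightarrow> test_fun a (tderivs ds g)"
  by (induction ds) (auto intro: test_fun_tderiv)

lemma tderivs_add: "test_fun a g \<Longrightarrow> test_fun a h \<Longrightarrow> tderivs ds (\<lambda>w. g w + h w) = (\<lambda>w. tderivs ds g w + tderivs ds h w)"
  by (induction ds) (auto simp: tderiv_add[OF test_fun_tderivs test_fun_tderivs])

lemma tderivs_cmult: "test_fun a g \<Longrightarrow> tderivs ds (\<lambda>w. c * g w) = (\<lambda>w. c * tderivs ds g w)"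
  by (induction ds) (auto simp: tderiv_cmult[OF test_fun_tderivs])

lemma cutoff_limit_tderivs: "cutoff_limit a G g \<Longrightarrow> cutoff_limit a (\<lambda>R. tderivs ds (G R)) (tderivs ds g)"
  by (induction ds) (auto intro: cutoff_limit_tderiv)

lemma tderivs_eq_0_outside:
  "(\<And>w. norm w > r \<Longrightarrow> g w = 0) \<Longrightarrow> norm w > r \<Longrightarrow> tderivs ds g w = 0"
  by (induction ds arbitrary: w) (auto intro!: tderiv_eq_0_outside[where r = r])

section \<open>Polynomials annihilated by a rapidly decreasing function\<close>

text \<open>The parameter \<open>a\<close> is the lower end of the range of \<open>|w|\<^sup>2\<close> in which radial profiles may live; in the
application it is \<open>B\<^sup>2\<close>.\<close>

locale gauss_decay =
  fixes f :: "complex ^ 'n::finite \<Rightarrow> complex" and a :: real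
  assumes cont: "continuous_on UNIV f"
    and decay: "\<And>k. \<exists>C. \<forall>z. norm z ^ k * norm (f z) \<le> C * exp (- (1 / 4) * (norm z)\<^sup>2)"
    and a_nonneg: "a \<ge> 0"
begin

lemma decay_weight:
  "\<exists>C\<ge>0. \<forall>z. (1 + norm z) ^ k * norm (f z) \<le> C * exp (- (1 / 4) * (norm z)\<^sup>2)"
proof -
  obtain C where C: "\<And>z. norm z ^ k * norm (f z) \<le> C * exp (- (1 / 4) * (norm z)\<^sup>2)" using decay[of k] by blast
  obtain D where D: "\<And>z. norm (f z) \<le> D * exp (- (1 / 4) * (norm z)\<^sup>2)" using decay[of 0] by auto
  have "(1 + norm z) ^ k * norm (f z) \<le> (2 ^ k * (\<bar>C\<bar> + \<bar>D\<bar>)) * exp (- (1 / 4) * (norm z)\<^sup>2)" for z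
  proof -
    have "(1 + norm z) ^ k \<le> (2 * max 1 (norm z)) ^ k" by (intro power_mono) auto
    also have "\<dots> \<le> 2 ^ k * (1 + norm z ^ k)"
      by (auto simp: power_mult_distrib max_def)
    finally have "(1 + norm z) ^ k * norm (f z) \<le> 2 ^ k * (1 + norm z ^ k) * norm (f z)"
      by (intro mult_right_mono) auto
    also have "\<dots> = 2 ^ k * (norm (f z) + norm z ^ k * norm (f z))" by (simp add: algebra_simps)
    also have "\<dots> \<le> 2 ^ k * (D * exp (- (1 / 4) * (norm z)\<^sup>2) + C * exp (- (1 / 4) * (norm z)\<^sup>2))"
      by (intro mult_left_mono add_mono C D) auto
    also have "\<dots> \<le> 2 ^ k * (\<bar>D\<bar> * exp (- (1 / 4) * (norm z)\<^sup>2) + \<bar>C\<bar> * exp (- (1 / 4) * (norm z)\<^sup>2))"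
      by (intro mult_left_mono add_mono mult_right_mono) auto
    finally show ?thesis by (simp add: algebra_simps)
  qed
  then show ?thesis by (intro exI[of _ "2 ^ k * (\<bar>C\<bar> + \<bar>D\<bar>)"]) auto
qed

text \<open>The constant \<open>K\<close> depends on \<open>h\<close> only through its growth bound. The lemma thus provides one
integrable majorant for a whole sequence of cutoffs.\<close>

lemma integrand_bound:
  assumes P: "wpoly m P" and C: "C \<ge> 0"
  shows "\<exists>K. \<forall>h. (\<forall>x\<ge>0. \<bar>h x\<bar> \<le> C * (1 + x) ^ l * exp (x / 4)) \<longrightarrow>
    (\<forall>w. norm (f (- w) * (P w * of_real (h ((norm w)\<^sup>2)))) \<le> K * (1 / (1 + norm w) ^ Suc DIM(complex ^ 'n)))"
proof -
  obtain A where A: "A \<ge> 0" "\<And>w. norm (P w) \<le> A * (1 + norm w) ^ m" using wpoly_bound[OF P] by blast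
  let ?N = "Suc DIM(complex ^ 'n)"
  \<comment> \<open>The exponent pays for \<open>P\<close>, for the profile evaluated at \<open>|w|\<^sup>2\<close>, and for integrability.\<close>
  obtain D where D: "D \<ge> 0" "\<And>z. (1 + norm z) ^ (m + 2 * l + ?N) * norm (f z) \<le> D * exp (- (1 / 4) * (norm z)\<^sup>2)"
    using decay_weight by blast
  have "norm (f (- w) * (P w * of_real (h ((norm w)\<^sup>2)))) \<le> (D * A * C) * (1 / (1 + norm w) ^ ?N)"
    if h: "\<forall>x\<ge>0. \<bar>h x\<bar> \<le> C * (1 + x) ^ l * exp (x / 4)" for h w
  proof -
    let ?x = "norm w"
    have x: "1 + ?x > 0" using norm_ge_zero[of w] by linarith
    have "\<bar>h (?x\<^sup>2)\<bar> \<le> C * (1 + ?x\<^sup>2) ^ l * exp (?x\<^sup>2 / 4)" using h by simp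
    also have "\<dots> \<le> C * ((1 + ?x)\<^sup>2) ^ l * exp (?x\<^sup>2 / 4)"
      using C by (intro mult_right_mono mult_left_mono power_mono) (auto simp: power2_eq_square algebra_simps)
    finally have h1: "\<bar>h (?x\<^sup>2)\<bar> \<le> C * (1 + ?x) ^ (2 * l) * exp (?x\<^sup>2 / 4)" by (simp add: power_mult)
    have f1: "norm (f (- w)) \<le> D * exp (- (1 / 4) * ?x\<^sup>2) / (1 + ?x) ^ (m + 2 * l + ?N)"
      using D(2)[of "- w"] x by (simp add: pos_le_divide_eq mult.commute)
    have "norm (f (- w) * (P w * of_real (h (?x\<^sup>2)))) = norm (f (- w)) * (norm (P w) * \<bar>h (?x\<^sup>2)\<bar>)"
      by (simp add: norm_mult)
    also have "\<dots> \<le> (D * exp (- (1 / 4) * ?x\<^sup>2) / (1 + ?x) ^ (m + 2 * l + ?N)) * ((A * (1 + ?x) ^ m) * (C * (1 + ?x) ^ (2 * l) * exp (?x\<^sup>2 / 4)))"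
      using A C D x by (intro mult_mono f1 A(2) h1) auto
    also have "\<dots> = (D * A * C) * (exp (- (1 / 4) * ?x\<^sup>2) * exp (?x\<^sup>2 / 4)) * ((1 + ?x) ^ m * (1 + ?x) ^ (2 * l) / (1 + ?x) ^ (m + 2 * l + ?N))"
      by simp
    also have "exp (- (1 / 4) * ?x\<^sup>2) * exp (?x\<^sup>2 / 4) = 1" by (simp flip: exp_add)
    also have "(1 + ?x) ^ m * (1 + ?x) ^ (2 * l) / (1 + ?x) ^ (m + 2 * l + ?N) = 1 / (1 + ?x) ^ ?N"
      using x by (simp add: power_add)
    finally show ?thesis by simp
  qed
  then show ?thesis by blast
qed

lemma continuous_reflect: "continuous_on UNIV (\<lambda>w. f (- w))"
  by (intro continuous_on_compose2[OF cont] continuous_intros) auto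

lemma measurable_integrand: "test_fun a g \<Longrightarrow> (\<lambda>w. f (- w) * g w) \<in> borel_measurable borel"
  by (intro borel_measurable_continuous_onI continuous_intros continuous_reflect test_fun_continuous)

lemma integrable_test_fun: "test_fun a g \<Longrightarrow> integrable lborel (\<lambda>w. f (- w) * g w)"
proof (induction rule: test_fun.induct)
  case (base m P F)
  obtain C l where C: "C \<ge> 0" "\<forall>x\<ge>0. \<bar>F 0 x\<bar> \<le> C * (1 + x) ^ l * exp (x / 4)"
    using base(2) unfolding profile_def moderate_def by blast
  obtain K where K: "\<And>w. norm (f (- w) * (P w * of_real (F 0 ((norm w)\<^sup>2)))) \<le> K * (1 / (1 + norm w) ^ Suc DIM(complex ^ 'n))"
    using integrand_bound[OF base(1) C(1), of l] C(2) by blast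
  show ?case
  proof (rule Bochner_Integration.integrable_bound)
    show "integrable lborel (\<lambda>w::complex^'n. K * (1 / (1 + norm w) ^ Suc DIM(complex ^ 'n)))"
      by (intro integrable_mult_right integrable_inverse_power)
    show "(\<lambda>w. f (- w) * (P w * of_real (F 0 ((norm w)\<^sup>2)))) \<in> borel_measurable lborel"
      using measurable_integrand[OF test_fun.base[OF base]] by simp
    show "AE w in lborel. norm (f (- w) * (P w * of_real (F 0 ((norm w)\<^sup>2)))) \<le> norm (K * (1 / (1 + norm w) ^ Suc DIM(complex ^ 'n)))"
      using K by (intro AE_I2 order_trans[OF K]) (simp only: real_norm_def abs_ge_self)
  qed
next
  case (add g h)
  then show ?case by (simp add: distrib_left)
qed

text \<open>The value of the twisted convolution of \<open>f\<close> and \<open>g\<close> at the origin. It converges for all test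
functions, whereas at other points the twisted convolution with a profile of size
\<open>exp (|w|\<^sup>2 / 4)\<close> may diverge.\<close>

definition pairing :: "(complex ^ 'n \<Rightarrow> complex) \<Rightarrow> complex" where
  "pairing g = (\<integral>w. f (- w) * g w \<partial>lborel)"

lemma pairing_add: "test_fun a g \<Longrightarrow> test_fun a h \<Longrightarrow> pairing (\<lambda>w. g w + h w) = pairing g + pairing h"
  by (simp add: pairing_def distrib_left integrable_test_fun)

lemma pairing_cmult: "pairing (\<lambda>w. c * g w) = c * pairing g"
  by (simp add: pairing_def mult.left_commute)

lemma pairing_cutoff_limit: "cutoff_limit a G g \<Longrightarrow> (\<lambda>R. pairing (G R)) \<longlonglongrightarrow> pairing g"
proof (induction rule: cutoff_limit.induct)
  case (base m P F k)
  obtain C l where C: "C \<ge> 0" "\<And>R x. x \<ge> 0 \<Longrightarrow> \<bar>product_seq k (cutoff R) F x\<bar> \<le> C * (1 + x) ^ l * exp (x / 4)"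
    using product_seq_bound[where M = cutoff and F = F and k = k] cutoff_bounded base(2)
    unfolding profile_def by blast
  obtain K where K: "\<And>R w. norm (f (- w) * (P w * of_real (product_seq k (cutoff R) F ((norm w)\<^sup>2)))) \<le> K * (1 / (1 + norm w) ^ Suc DIM(complex ^ 'n))"
    using integrand_bound[OF base(1) C(1), of l] C(2) by blast
  show ?case
    unfolding pairing_def
  proof (rule integral_dominated_convergence)
    show "integrable lborel (\<lambda>w::complex^'n. K * (1 / (1 + norm w) ^ Suc DIM(complex ^ 'n)))"
      by (intro integrable_mult_right integrable_inverse_power)
    show "(\<lambda>w. f (- w) * (P w * of_real (F k ((norm w)\<^sup>2)))) \<in> borel_measurable lborel"
      using measurable_integrand[OF test_fun_base'[OF base]] by simp
    show "(\<lambda>w. f (- w) * (P w * of_real (product_seq k (cutoff (real R)) F ((norm w)\<^sup>2)))) \<in> borel_measurable lborel" for R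
      using measurable_integrand[OF test_fun_base'[OF base(1) profile_product_cutoff[OF base(2)]]] by simp
    show "AE w in lborel. (\<lambda>R. f (- w) * (P w * of_real (product_seq k (cutoff (real R)) F ((norm w)\<^sup>2)))) \<longlonglongrightarrow> f (- w) * (P w * of_real (F k ((norm w)\<^sup>2)))"
    proof (intro AE_I2 tendsto_intros)
      fix w :: "complex ^ 'n"
      show "(\<lambda>R. product_seq k (cutoff (real R)) F ((norm w)\<^sup>2)) \<longlonglongrightarrow> F k ((norm w)\<^sup>2)"
        using product_seq_tendsto[of "\<lambda>n. cutoff (real n)" "(norm w)\<^sup>2" "\<lambda>j. if j = 0 then 1 else 0" k F, OF cutoff_tendsto] by (simp add: product_seq_one)
    qed
    show "AE w in lborel. norm (f (- w) * (P w * of_real (product_seq k (cutoff (real R)) F ((norm w)\<^sup>2)))) \<le> K * (1 / (1 + norm w) ^ Suc DIM(complex ^ 'n))" for R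
      using K by (intro AE_I2)
  qed
next
  case (add G g H h)
  then show ?case using cutoff_limit_test_fun[OF add(1)] cutoff_limit_test_fun[OF add(2)]
    by (auto simp: pairing_add intro!: tendsto_add)
qed

text \<open>All iterated derivatives of the twisted convolution of \<open>f\<close> and \<open>g\<close> vanish at the origin. Recording the whole jet, in
place of vanishing on a neighbourhood, permits profiles that grow like \<open>exp (|w|\<^sup>2 / 4)\<close>, and
the property still passes to derivatives.\<close>

definition null :: "(complex ^ 'n \<Rightarrow> complex) \<Rightarrow> bool" where
  "null g \<longleftrightarrow> test_fun a g \<and> (\<forall>ds. pairing (tderivs ds g) = 0)"

lemma null_add: "null g \<Longrightarrow> null h \<Longrightarrow> null (\<lambda>w. g w + h w)"
  by (auto simp: null_def tderivs_add pairing_add[OF test_fun_tderivs test_fun_tderivs] intro: test_fun.add)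

lemma null_cmult: "null g \<Longrightarrow> null (\<lambda>w. c * g w)"
  by (auto simp: null_def tderivs_cmult pairing_cmult intro: test_fun_cmult)

lemma null_tderiv: "null g \<Longrightarrow> null (tderiv b i g)"
  unfolding null_def by (metis test_fun_tderiv tderivs_simps(3))

lemma null_sum:
  assumes "finite I" "I \<noteq> {}" "\<And>i. i \<in> I \<Longrightarrow> null (g i)"
  shows "null (\<lambda>w. \<Sum>i\<in>I. g i w)"
  using assms by (induction I rule: finite_ne_induct) (auto intro: null_add)

definition annihilated :: "(complex ^ 'n \<Rightarrow> complex) \<Rightarrow> bool" where
  "annihilated P \<longleftrightarrow> (\<forall>F. profile a F \<longrightarrow> null (\<lambda>w. P w * of_real (F 0 ((norm w)\<^sup>2))))"

lemma annihilated_add: "annihilated P \<Longrightarrow> annihilated Q \<Longrightarrow> annihilated (\<lambda>w. P w + Q w)"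
  using null_add by (fastforce simp: annihilated_def distrib_right)

lemma annihilated_cmult: "annihilated P \<Longrightarrow> annihilated (\<lambda>w. c * P w)"
  using null_cmult by (fastforce simp: annihilated_def mult.assoc)

text \<open>The twisted derivative turns \<open>P \<phi>\<close> into a derivative of \<open>P\<close> times \<open>\<phi>\<close> plus the coordinate times
\<open>P (\<phi>' \<plusminus> \<phi> / 4)\<close>, and every profile has the form \<open>\<phi>' \<plusminus> \<phi> / 4\<close>.\<close>

lemma annihilated_coord_mult:
  assumes P: "wpoly m P" "annihilated P" and P': "annihilated (wirt (\<not> b) i P)"
  shows "annihilated (\<lambda>w. coord b i w * P w)"
  unfolding annihilated_def
proof (intro allI impI)
  fix F assume F: "profile a F"
  define \<sigma> :: real where "\<sigma> = (if \<not> b then 1 else - 1) / 4"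
  have "\<bar>\<sigma>\<bar> \<le> 1 / 4" by (simp add: \<sigma>_def)
  then obtain G where G: "profile a G" "\<And>x. G (Suc 0) x + \<sigma> * G 0 x = F 0 x"
    using profile_ode[OF F a_nonneg] by blast
  have "null (\<lambda>w. tderiv (\<not> b) i (\<lambda>w. P w * of_real (G 0 ((norm w)\<^sup>2))) w + (- 1) * (wirt (\<not> b) i P w * of_real (G 0 ((norm w)\<^sup>2))))"
    using P(2) P' G(1) by (intro null_add null_tderiv null_cmult) (auto simp: annihilated_def)
  also have "(\<lambda>w. tderiv (\<not> b) i (\<lambda>w. P w * of_real (G 0 ((norm w)\<^sup>2))) w + (- 1) * (wirt (\<not> b) i P w * of_real (G 0 ((norm w)\<^sup>2))))
     = (\<lambda>w. coord b i w * P w * of_real (F 0 ((norm w)\<^sup>2)))"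
    unfolding tderiv_base[OF P(1) G(1)] \<sigma>_def[symmetric] G(2) by simp
  finally show "null (\<lambda>w. coord b i w * P w * of_real (F 0 ((norm w)\<^sup>2)))" .
qed

lemma annihilated_wpoly:
  assumes one: "annihilated (\<lambda>_. 1)"
  shows "wpoly m P \<Longrightarrow> annihilated P"
proof (induction m arbitrary: P)
  case 0
  from 0 show ?case
  proof (induction "0::nat" P rule: wpoly.induct)
    case (const c)
    then show ?case using annihilated_cmult[OF one, of c] by simp
  qed (auto intro: annihilated_add)
next
  case (Suc m)
  from Suc.prems show ?case
  proof (induction "Suc m" P rule: wpoly.induct)
    case (const c)
    then show ?case using annihilated_cmult[OF one, of c] by simp
  next
    case (mult P b i)
    then show ?case using Suc.IH by (intro annihilated_coord_mult[of m]) (auto intro: wpoly_wirt)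
  qed (auto intro: annihilated_add)
qed

end

section \<open>Lowering the bidegree of harmonic polynomials\<close>

lemma harmonic_bihomI:
  assumes "bihom d P" "\<And>w. (\<Sum>i\<in>UNIV. wirt b i (wirt (\<not> b) i P) w) = 0"
  shows "harmonic_bihom d P"
proof -
  have "(\<Sum>i\<in>UNIV. wirt b' i (wirt (\<not> b') i P) w) = 0" for b' w
    using assms(2)[of w] wirt_commute[OF bihom_wpoly[OF assms(1)], of b _ "\<not> b"]
    by (cases "b' = b") (auto simp: neq_commute)
  then show ?thesis using assms(1) by (simp add: harmonic_bihom_def)
qed

lemma wirt_sum:
  assumes "finite I" "\<And>i. i \<in> I \<Longrightarrow> g i differentiable (at w)"
  shows "wirt b j (\<lambda>w. \<Sum>i\<in>I. g i w) w = (\<Sum>i\<in>I. wirt b j (g i) w)"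
  using assms by (induction I rule: finite_induct) (auto simp: wirt_add)

text \<open>The Laplacian has constant coefficients and therefore commutes with Wirtinger derivatives.\<close>

lemma harmonic_bihom_wirt_sum_eq_0:
  fixes P :: "complex ^ 'n::finite \<Rightarrow> complex"
  assumes "harmonic_bihom d P"
  shows "(\<Sum>j\<in>UNIV. wirt b j (wirt (\<not> b) j (wirt c i P)) w) = 0"
proof -
  have bi: "bihom d P" and h: "\<And>w. (\<Sum>j\<in>UNIV. wirt b j (wirt (\<not> b) j P) w) = 0"
    using assms by (auto simp: harmonic_bihom_def)
  note w = bihom_wpoly[OF bi]
  have "(\<Sum>j\<in>UNIV. wirt b j (wirt (\<not> b) j (wirt c i P)) w) = (\<Sum>j\<in>UNIV. wirt c i (wirt b j (wirt (\<not> b) j P)) w)"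
    by (simp only: wirt_commute[OF w, of _ _ c i] wirt_commute[OF wpoly_wirt[OF w], of _ _ c i])
  also have "\<dots> = wirt c i (\<lambda>w. \<Sum>j\<in>UNIV. wirt b j (wirt (\<not> b) j P) w) w"
    by (rule wirt_sum[symmetric]) (auto intro: wpoly_differentiable wpoly_wirt w)
  also have "\<dots> = 0" by (simp add: h)
  finally show ?thesis .
qed

lemma wirt_norm_sq_mult:
  assumes "R differentiable (at w)"
  shows "wirt b j (\<lambda>w. of_real ((norm w)\<^sup>2) * R w) w = coord (\<not> b) j w * R w + of_real ((norm w)\<^sup>2) * wirt b j R w"
proof -
  have "((\<lambda>x. x) has_real_derivative 1) (at ((norm w)\<^sup>2))" by simp
  note d = has_derivative_radial[OF this] and wd = wirt_radial[OF this]
  show ?thesis using wd by (subst wirt_mult) (use d assms in \<open>auto simp: differentiable_def\<close>)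
qed

text \<open>The number \<open>1 / (n + p + q - 1)\<close>. For \<open>q = 0\<close> it multiplies a derivative that vanishes;
setting it to \<open>0\<close> then avoids the degenerate denominator for \<open>n = 1\<close>, \<open>p = 0\<close>.\<close>

definition harmonic_coeff :: "nat \<Rightarrow> nat \<Rightarrow> nat \<Rightarrow> complex" where
  "harmonic_coeff n p q = (if q = 0 then 0 else 1 / of_nat (n + p + q - 1))"

text \<open>The harmonic projection of the coordinate times \<open>Q\<close>, whose degree in the coordinates of kind \<open>b\<close>
is one higher than that of \<open>Q\<close>. For harmonic \<open>Q\<close>, the Laplacian of the first summand is a multiple of
the derivative of \<open>Q\<close> of the opposite kind, and the second summand cancels it.\<close>

definition raise_harmonic :: "bool \<Rightarrow> (bool \<Rightarrow> nat) \<Rightarrow> (complex ^ 'n::finite \<Rightarrow> complex) \<Rightarrow> 'n \<Rightarrow> complex ^ 'n \<Rightarrow> complex" where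
  "raise_harmonic b d Q i = (\<lambda>w. coord b i w * Q w
      + (- harmonic_coeff CARD('n) (d b) (d (\<not> b))) * (of_real ((norm w)\<^sup>2) * wirt (\<not> b) i Q w))"

lemma raise_harmonic_bihom:
  assumes "bihom d Q"
  shows "bihom (d(b := Suc (d b))) (raise_harmonic b d Q i)"
proof -
  have "bihom (d(b := Suc (d b))) (\<lambda>w. of_real ((norm w)\<^sup>2) * wirt (\<not> b) i Q w)"
  proof (cases "d (\<not> b) = 0")
    case True
    then have "wirt (\<not> b) i Q = (\<lambda>_. 0)" using bihom_wirt[OF assms] by blast
    then show ?thesis by (simp add: bihom.zero)
  next
    case False
    then have "bihom (d(\<not> b := d (\<not> b) - 1)) (wirt (\<not> b) i Q)" using bihom_wirt[OF assms] by blast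
    from bihom_norm_sq_mult[OF this]
    have "bihom (\<lambda>c. Suc ((d(\<not> b := d (\<not> b) - 1)) c)) (\<lambda>w. of_real ((norm w)\<^sup>2) * wirt (\<not> b) i Q w)" .
    moreover have "(\<lambda>c. Suc ((d(\<not> b := d (\<not> b) - 1)) c)) = d(b := Suc (d b))"
    proof
      fix c
      show "Suc ((d(\<not> b := d (\<not> b) - 1)) c) = (d(b := Suc (d b))) c"
        using False by (cases "c = b") (auto simp: fun_upd_def)
    qed
    ultimately show ?thesis by simp
  qed
  then show ?thesis unfolding raise_harmonic_def
    by (intro bihom.add bihom_cmult bihom.mult assms)
qed

lemma wirt_raise_harmonic:
  fixes Q :: "complex ^ 'n::finite \<Rightarrow> complex"
  assumes "bihom d Q"
  shows "wirt c j (raise_harmonic b d Q i) w =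
    (if c = b \<and> j = i then Q w else 0) + coord b i w * wirt c j Q w
     + (- harmonic_coeff CARD('n) (d b) (d (\<not> b))) *
       (coord (\<not> c) j w * wirt (\<not> b) i Q w + of_real ((norm w)\<^sup>2) * wirt c j (wirt (\<not> b) i Q) w)"
proof -
  note dQ = bihom_differentiable[OF assms]
  have dR: "wirt (\<not> b) i Q differentiable (at w)" for w
    by (intro wpoly_differentiable[OF wpoly_wirt[OF bihom_wpoly[OF assms]]])
  have dN: "(\<lambda>w. of_real ((norm w)\<^sup>2) * wirt (\<not> b) i Q w) differentiable (at w)" for w
    using has_derivative_radial[of "\<lambda>x. x" 1 w] dR by (intro differentiable_mult) (auto simp: differentiable_def)
  show ?thesis
    unfolding raise_harmonic_def
    by (simp only: wirt_add wirt_mult[OF differentiable_coord dQ] wirt_cmult[OF dN] wirt_norm_sq_mult[OF dR] wirt_coord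
        differentiable_mult differentiable_coord dQ dN differentiable_const) auto
qed

lemma sum_delta_mult:
  fixes g :: "'n::finite \<Rightarrow> complex"
  shows "(\<Sum>j\<in>UNIV. (if j = i then g j else 0)) = g i"
  by simp

text \<open>Write \<open>R\<close> for the derivative of \<open>Q\<close> of the kind opposite to \<open>b\<close>, and \<open>(p, q)\<close> for the degrees of \<open>Q\<close>. Up to
the common factor \<open>4\<close>, the Laplacian of the coordinate times \<open>Q\<close> is \<open>R\<close>, and that of
\<open>|w|\<^sup>2 R\<close> is \<open>(n + p + q - 1) R\<close> by Euler's identity, as \<open>R\<close> has degrees \<open>(p, q - 1)\<close>.\<close>

lemma raise_harmonic_harmonic:
  fixes Q :: "complex ^ 'n::finite \<Rightarrow> complex"
  assumes Q: "harmonic_bihom d Q"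
  shows "harmonic_bihom (d(b := Suc (d b))) (raise_harmonic b d Q i)"
proof (rule harmonic_bihomI[where b = b])
  have bi: "bihom d Q" using Q by (simp add: harmonic_bihom_def)
  show "bihom (d(b := Suc (d b))) (raise_harmonic b d Q i)" by (rule raise_harmonic_bihom[OF bi])
  fix w
  define c where "c = harmonic_coeff CARD('n) (d b) (d (\<not> b))"
  define R where "R = wirt (\<not> b) i Q"
  have wQ: "wpoly (d True + d False) Q" by (rule bihom_wpoly[OF bi])
  have wR: "wpoly (d True + d False) R" unfolding R_def by (rule wpoly_wirt[OF wQ])
  note diffs = wpoly_differentiable[OF wQ] wpoly_differentiable[OF wR] wpoly_differentiable[OF wpoly_wirt[OF wQ]] wpoly_differentiable[OF wpoly_wirt[OF wR]]
  have dN: "(\<lambda>w. of_real ((norm w)\<^sup>2) * wirt (\<not> b) j R w) differentiable (at w)" for j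
    using has_derivative_radial[of "\<lambda>x. x" 1 w] diffs by (intro differentiable_mult) (auto simp: differentiable_def)
  have 1: "wirt (\<not> b) j (raise_harmonic b d Q i) = (\<lambda>w. coord b i w * wirt (\<not> b) j Q w + (- c) * (coord b j w * R w + of_real ((norm w)\<^sup>2) * wirt (\<not> b) j R w))" for j
    by (rule ext) (simp add: wirt_raise_harmonic[OF bi] c_def R_def)
  have 2: "wirt b j (wirt (\<not> b) j (raise_harmonic b d Q i)) w =
      (if j = i then wirt (\<not> b) j Q w else 0) + coord b i w * wirt b j (wirt (\<not> b) j Q) w
       + (- c) * (R w + coord b j w * wirt b j R w + (coord (\<not> b) j w * wirt (\<not> b) j R w + of_real ((norm w)\<^sup>2) * wirt b j (wirt (\<not> b) j R) w))" for j
  proof -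
    have a: "wirt b j (\<lambda>w. coord b i w * wirt (\<not> b) j Q w) w = (if j = i then wirt (\<not> b) j Q w else 0) + coord b i w * wirt b j (wirt (\<not> b) j Q) w"
      by (subst wirt_mult) (auto simp: diffs wirt_coord)
    have b: "wirt b j (\<lambda>w. coord b j w * R w) w = R w + coord b j w * wirt b j R w"
      by (subst wirt_mult) (auto simp: diffs wirt_coord)
    have d: "wirt b j (\<lambda>w. coord b j w * R w + of_real ((norm w)\<^sup>2) * wirt (\<not> b) j R w) w
       = R w + coord b j w * wirt b j R w + (coord (\<not> b) j w * wirt (\<not> b) j R w + of_real ((norm w)\<^sup>2) * wirt b j (wirt (\<not> b) j R) w)"
      by (subst wirt_add) (use b dN diffs in \<open>auto simp: wirt_norm_sq_mult simp del: of_real_power\<close>)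
    have e: "(\<lambda>w. coord b j w * R w + of_real ((norm w)\<^sup>2) * wirt (\<not> b) j R w) differentiable (at w)"
      using dN diffs by auto
    have "wirt b j (\<lambda>w. coord b i w * wirt (\<not> b) j Q w + (- c) * (coord b j w * R w + of_real ((norm w)\<^sup>2) * wirt (\<not> b) j R w)) w
      = wirt b j (\<lambda>w. coord b i w * wirt (\<not> b) j Q w) w + wirt b j (\<lambda>w. (- c) * (coord b j w * R w + of_real ((norm w)\<^sup>2) * wirt (\<not> b) j R w)) w"
      using e diffs by (intro wirt_add differentiable_mult) auto
    then show ?thesis unfolding 1 a d wirt_cmult[OF e] by simp
  qed
  have h0: "(\<Sum>j\<in>UNIV. wirt b j (wirt (\<not> b) j Q) w) = 0" using Q by (auto simp: harmonic_bihom_def)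
  have h1: "(\<Sum>j\<in>UNIV. wirt b j (wirt (\<not> b) j R) w) = 0" unfolding R_def by (rule harmonic_bihom_wirt_sum_eq_0[OF Q])
  have sum: "(\<Sum>j\<in>UNIV. wirt b j (wirt (\<not> b) j (raise_harmonic b d Q i)) w) =
      R w + (- c) * (of_nat CARD('n) * R w + (\<Sum>j\<in>UNIV. coord b j w * wirt b j R w) + (\<Sum>j\<in>UNIV. coord (\<not> b) j w * wirt (\<not> b) j R w))"
    unfolding 2 sum.distrib sum_distrib_left[symmetric] sum_delta_mult h0 h1 by (simp add: R_def algebra_simps)
  show "(\<Sum>j\<in>UNIV. wirt b j (wirt (\<not> b) j (raise_harmonic b d Q i)) w) = 0"
  proof (cases "d (\<not> b) = 0")
    case True
    then have "R = (\<lambda>_. 0)" unfolding R_def using bihom_wirt[OF bi] by blast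
    then show ?thesis unfolding sum by simp
  next
    case False
    then have bR: "bihom (d(\<not> b := d (\<not> b) - 1)) R" unfolding R_def using bihom_wirt[OF bi] by blast
    have n: "CARD('n) \<ge> 1" by (simp add: Suc_leI)
    have E: "(\<Sum>j\<in>UNIV. coord b j w * wirt b j R w) = of_nat (d b) * R w"
      "(\<Sum>j\<in>UNIV. coord (\<not> b) j w * wirt (\<not> b) j R w) = of_nat (d (\<not> b) - 1) * R w"
      using bihom_euler[OF bR, of b w] bihom_euler[OF bR, of "\<not> b" w] by simp_all
    define N where "N = CARD('n) + d b + d (\<not> b) - 1"
    have "N \<noteq> 0" using n False unfolding N_def by linarith
    moreover have c: "c = 1 / of_nat N" using False by (simp add: c_def harmonic_coeff_def N_def)
    moreover have "of_nat CARD('n) * R w + of_nat (d b) * R w + of_nat (d (\<not> b) - 1) * R w = of_nat N * R w"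
    proof -
      have "CARD('n) + d b + (d (\<not> b) - 1) = N" using False by (simp add: N_def)
      then show ?thesis by (simp only: distrib_right[symmetric] of_nat_add[symmetric])
    qed
    ultimately show ?thesis unfolding sum E by simp
  qed
qed

text \<open>The factor \<open>1 - c q\<close> equals \<open>(n + p - 1) / (n + p + q - 1)\<close> for \<open>q > 0\<close>. It vanishes exactly for
\<open>n = 1\<close>, \<open>p = 0\<close>, where the harmonic projection is zero.\<close>

lemma harmonic_coeff_identity:
  assumes "n \<ge> 1" "n \<ge> 2 \<or> q = 0"
  shows "1 - harmonic_coeff n p q * of_nat q \<noteq> 0"
    and "of_nat (n + p) - harmonic_coeff n p q * of_nat q = (1 - harmonic_coeff n p q * of_nat q) * of_nat (n + p + q)"
proof -
  show "1 - harmonic_coeff n p q * of_nat q \<noteq> 0"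
  proof (cases "q = 0")
    case False
    then have "n \<ge> 2" using assms by simp
    then have "of_nat q \<noteq> (of_nat (n + p + q - 1) :: complex)" by (simp only: of_nat_eq_iff)
    moreover have "(of_nat (n + p + q - 1) :: complex) \<noteq> 0" using assms False by (simp only: of_nat_eq_0_iff)
    ultimately show ?thesis using False by (simp add: harmonic_coeff_def field_simps)
  qed (simp add: harmonic_coeff_def)
  show "of_nat (n + p) - harmonic_coeff n p q * of_nat q = (1 - harmonic_coeff n p q * of_nat q) * of_nat (n + p + q)"
  proof (cases "q = 0")
    case False
    obtain k where k: "n = Suc k" using assms by (cases n) auto
    have "(of_nat (k + p + q) :: complex) \<noteq> 0" using False by (simp only: of_nat_eq_0_iff)
    then show ?thesis using False by (simp add: harmonic_coeff_def k field_simps)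
  qed (simp add: harmonic_coeff_def)
qed

text \<open>Contracting the twisted derivatives with the harmonic projections of the coordinate multiples of \<open>Q\<close> gives
back \<open>Q\<close>, times a first-order operator in the radial variable: by Euler's identity both
\<open>\<Sum> \<partial>\<^sub>i P\<^sub>i\<close> and the contraction of the \<open>P\<^sub>i\<close> with the opposite coordinates are multiples of \<open>Q\<close>.\<close>

lemma sum_tderiv_raise_harmonic:
  fixes Q :: "complex ^ 'n::finite \<Rightarrow> complex"
  assumes Q: "harmonic_bihom d Q" and F: "profile a F" and n: "CARD('n) \<ge> 2 \<or> d (\<not> b) = 0"
  defines "\<kappa> \<equiv> 1 - harmonic_coeff CARD('n) (d b) (d (\<not> b)) * of_nat (d (\<not> b))"
  shows "(\<Sum>i\<in>UNIV. tderiv b i (\<lambda>w. raise_harmonic b d Q i w * of_real (F 0 ((norm w)\<^sup>2))) w) =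
    \<kappa> * (Q w * of_real (real (CARD('n) + d b + d (\<not> b)) * F 0 ((norm w)\<^sup>2) +
       (norm w)\<^sup>2 * (F (Suc 0) ((norm w)\<^sup>2) + (if b then 1 else - 1) / 4 * F 0 ((norm w)\<^sup>2))))"
proof -
  have bi: "bihom d Q" using Q by (simp add: harmonic_bihom_def)
  define c where "c = harmonic_coeff CARD('n) (d b) (d (\<not> b))"
  define r where "r = complex_of_real ((norm w)\<^sup>2)"
  define \<phi> where "\<phi> = complex_of_real (F 0 ((norm w)\<^sup>2))"
  define \<psi> where "\<psi> = complex_of_real (F (Suc 0) ((norm w)\<^sup>2) + (if b then 1 else - 1) / 4 * F 0 ((norm w)\<^sup>2))"
  have E: "(\<Sum>j\<in>UNIV. coord c j w * wirt c j Q w) = of_nat (d c) * Q w" for c by (rule bihom_euler[OF bi])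
  have h0: "(\<Sum>j\<in>UNIV. wirt b j (wirt (\<not> b) j Q) w) = 0" using Q by (auto simp: harmonic_bihom_def)
  have S1: "(\<Sum>i\<in>UNIV. wirt b i (raise_harmonic b d Q i) w) = \<kappa> * of_nat (CARD('n) + d b + d (\<not> b)) * Q w"
  proof -
    have "(\<Sum>i\<in>UNIV. wirt b i (raise_harmonic b d Q i) w) =
        of_nat CARD('n) * Q w + of_nat (d b) * Q w + (- c) * (of_nat (d (\<not> b)) * Q w)"
      unfolding wirt_raise_harmonic[OF bi] sum.distrib sum_distrib_left[symmetric] c_def[symmetric] E h0 by simp
    also have "\<dots> = (of_nat (CARD('n) + d b) - c * of_nat (d (\<not> b))) * Q w" by (simp add: algebra_simps)
    also have "of_nat (CARD('n) + d b) - c * of_nat (d (\<not> b)) = \<kappa> * of_nat (CARD('n) + d b + d (\<not> b))"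
      unfolding \<kappa>_def c_def using n by (intro harmonic_coeff_identity(2)) (auto simp: Suc_leI)
    finally show ?thesis .
  qed
  have S2: "(\<Sum>i\<in>UNIV. coord (\<not> b) i w * raise_harmonic b d Q i w) = \<kappa> * r * Q w"
  proof -
    have "(\<Sum>i\<in>UNIV. coord (\<not> b) i w * raise_harmonic b d Q i w) =
       (\<Sum>i\<in>UNIV. coord b i w * coord (\<not> b) i w) * Q w + (- c * r) * (\<Sum>i\<in>UNIV. coord (\<not> b) i w * wirt (\<not> b) i Q w)"
      unfolding raise_harmonic_def c_def[symmetric] r_def[symmetric] sum_distrib_right sum_distrib_left sum.distrib[symmetric]
      by (rule sum.cong) (simp_all add: algebra_simps)
    also have "\<dots> = \<kappa> * r * Q w"
      unfolding E norm_sq_eq_sum_coord[of w b, symmetric] r_def[symmetric] by (simp add: \<kappa>_def c_def algebra_simps)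
    finally show ?thesis .
  qed
  have "(\<Sum>i\<in>UNIV. tderiv b i (\<lambda>w. raise_harmonic b d Q i w * of_real (F 0 ((norm w)\<^sup>2))) w)
     = (\<Sum>i\<in>UNIV. wirt b i (raise_harmonic b d Q i) w) * \<phi> + (\<Sum>i\<in>UNIV. coord (\<not> b) i w * raise_harmonic b d Q i w) * \<psi>"
    unfolding tderiv_base[OF bihom_wpoly[OF raise_harmonic_bihom[OF bi]] F] sum_distrib_right sum.distrib[symmetric]
    by (simp add: \<phi>_def \<psi>_def)
  also have "\<dots> = \<kappa> * (Q w * (of_nat (CARD('n) + d b + d (\<not> b)) * \<phi> + r * \<psi>))"
    unfolding S1 S2 by (simp add: algebra_simps)
  finally show ?thesis by (simp add: \<phi>_def \<psi>_def r_def)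
qed

context gauss_decay
begin

text \<open>The first-order operator of the previous lemma is onto the profiles.\<close>

lemma annihilated_lower:
  fixes Q :: "complex ^ 'n \<Rightarrow> complex"
  assumes hyp: "\<And>P. harmonic_bihom (d(b := Suc (d b))) P \<Longrightarrow> annihilated P"
    and n: "CARD('n) \<ge> 2 \<or> d (\<not> b) = 0" and Q: "harmonic_bihom d Q"
  shows "annihilated Q"
  unfolding annihilated_def
proof (intro allI impI)
  fix F assume F: "profile a F"
  define \<kappa> where "\<kappa> = 1 - harmonic_coeff CARD('n) (d b) (d (\<not> b)) * of_nat (d (\<not> b))"
  have \<kappa>: "\<kappa> \<noteq> 0" unfolding \<kappa>_def using n by (intro harmonic_coeff_identity(1)) (auto simp: Suc_leI)
  define \<sigma> :: real where "\<sigma> = (if b then 1 else - 1) / 4"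
  have "\<bar>\<sigma>\<bar> \<le> 1 / 4" by (simp add: \<sigma>_def)
  then obtain G where G: "profile a G"
    "\<And>x. real (CARD('n) + d b + d (\<not> b)) * G 0 x + x * (G (Suc 0) x + \<sigma> * G 0 x) = F 0 x"
    using profile_euler_ode[OF F a_nonneg, of \<sigma> "CARD('n) + d b + d (\<not> b)"] by (auto simp: Suc_leI)
  have "null (\<lambda>w. inverse \<kappa> * (\<Sum>i\<in>UNIV. tderiv b i (\<lambda>w. raise_harmonic b d Q i w * of_real (G 0 ((norm w)\<^sup>2))) w))"
    using hyp[OF raise_harmonic_harmonic[OF Q]] G(1)
    by (intro null_cmult null_sum null_tderiv) (auto simp: annihilated_def)
  also have "(\<lambda>w. inverse \<kappa> * (\<Sum>i\<in>UNIV. tderiv b i (\<lambda>w. raise_harmonic b d Q i w * of_real (G 0 ((norm w)\<^sup>2))) w))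
     = (\<lambda>w. Q w * of_real (F 0 ((norm w)\<^sup>2)))"
    unfolding sum_tderiv_raise_harmonic[OF Q G(1) n] \<kappa>_def[symmetric] \<sigma>_def[symmetric] G(2) using \<kappa> by (intro ext) (simp add: field_simps)
  finally show "null (\<lambda>w. Q w * of_real (F 0 ((norm w)\<^sup>2)))" .
qed

text \<open>The degree in the coordinates is lowered to \<open>0\<close> before the degree in the conjugates. For \<open>n = 1\<close> a
lowering step requires the other degree to be \<open>0\<close>: in the first phase this is \<open>t\<close>, which is \<open>0\<close> if there
is any step to take, and in the second phase it is the degree already lowered to \<open>0\<close>.\<close>

lemma annihilated_one:
  assumes hyp: "\<And>P. harmonic_bihom (bidegree s t) P \<Longrightarrow> annihilated P"
    and n: "CARD('n) \<ge> 2 \<or> s = 0 \<or> t = 0"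
  shows "annihilated (\<lambda>_. 1)"
proof -
  have up: "(bidegree s t)(True := Suc s) = bidegree (Suc s) t" "(bidegree s t)(False := Suc t) = bidegree s (Suc t)" for s t
    by (auto simp: bidegree_def fun_eq_iff)
  have "\<forall>P. harmonic_bihom (bidegree 0 t) P \<longrightarrow> annihilated P"
    using hyp n
  proof (induction s)
    case (Suc s)
    have "annihilated P" if "harmonic_bihom (bidegree s t) P" for P
      using annihilated_lower[where d = "bidegree s t" and b = True, OF _ _ that] Suc.prems
      by (auto simp: bidegree_def[of _ _ True] bidegree_def[of _ _ False] up)
    then show ?case using Suc by blast
  qed simp
  then have "\<forall>P. harmonic_bihom (bidegree 0 0) P \<longrightarrow> annihilated P"
  proof (induction t)
    case (Suc t)
    have "annihilated P" if "harmonic_bihom (bidegree 0 t) P" for P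
      using annihilated_lower[where d = "bidegree 0 t" and b = False, OF _ _ that] Suc.prems
      by (auto simp: bidegree_def[of _ _ True] bidegree_def[of _ _ False] up)
    then show ?case using Suc by blast
  qed simp
  moreover have "harmonic_bihom (bidegree 0 0) (\<lambda>_::complex^'n. 1)"
  proof -
    have "bidegree 0 0 = (\<lambda>_. 0)" by (auto simp: bidegree_def)
    then show ?thesis by (simp add: harmonic_bihom_def bihom.const)
  qed
  ultimately show ?thesis by blast
qed

text \<open>Cutting off a profile at \<open>|w|\<^sup>2 = R\<close> gives a compactly supported function \<open>g\<^sub>R\<close> whose support
lies in \<open>|w|\<^sup>2 \<ge> c > B\<^sup>2\<close>. For \<open>|z| < \<surd>c - B\<close> every sphere \<open>|w| = r\<close> that meets this support has
\<open>r > |z| + B\<close>. In polar coordinates the twisted convolution with \<open>g\<^sub>R\<close> is therefore zero at \<open>z\<close>, and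
so are all its derivatives on this neighbourhood of the origin. Finally \<open>R \<rightarrow> \<infinity>\<close> by dominated
convergence.\<close>

lemma annihilated_if_twisted_means_vanish:
  fixes P :: "complex ^ 'n \<Rightarrow> complex"
  assumes P: "wpoly m P" and B: "B \<ge> 0" "a = B\<^sup>2"
    and mean: "\<And>z r. r > norm z + B \<Longrightarrow> twisted_mean f P r z = 0"
  shows "annihilated P"
  unfolding annihilated_def null_def
proof (intro allI impI conjI)
  fix F assume F: "profile a F"
  show "test_fun a (\<lambda>w. P w * of_real (F 0 ((norm w)\<^sup>2)))" by (rule test_fun.base[OF P F])
  fix ds
  define g where "g R w = P w * complex_of_real (product_seq 0 (cutoff (real R)) F ((norm w)\<^sup>2))" for R :: nat and w
  obtain c where c: "c > a" "\<And>k x. x \<le> c \<Longrightarrow> F k x = 0" using F by (auto elim: profileE)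
  \<comment> \<open>The radius of the neighbourhood of the origin on which the twisted convolutions vanish.\<close>
  define \<delta> where "\<delta> = sqrt c - B"
  have \<delta>: "\<delta> > 0" using c(1) B unfolding \<delta>_def by (simp add: real_less_rsqrt)
  have tg: "test_fun a (g R)" for R
    unfolding g_def by (rule test_fun_base'[OF P profile_product_cutoff[OF F]])
  have supp: "g R w = 0" if "norm w > sqrt (real R)" for R w
  proof -
    have "(norm w)\<^sup>2 \<ge> real R"
      using that by (metis less_eq_real_def real_sqrt_le_iff real_sqrt_abs2 power2_eq_square abs_norm_cancel)
    then show ?thesis by (simp add: g_def cutoff_eq_0)
  qed
  have zero: "tconv f (g R) z = 0" if z: "norm z < \<delta>" for R z
  proof -
    define h where "h w = f (z - w) * exp (\<i> / 2 * of_real (Im (hdot z w))) * g R w" for w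
    have conth: "continuous_on UNIV h"
      unfolding h_def by (intro continuous_intros continuous_on_compose2[OF cont] test_fun_continuous[OF tg]) auto
    obtain u v :: "complex ^ 'n" where uv: "cball 0 (sqrt (real R)) \<subseteq> cbox u v"
      using bounded_subset_cbox_symmetric[of "cball 0 (sqrt (real R))"] bounded_cball by metis
    have "integrable lborel h"
      by (rule integrable_continuous_compact_support(1)[OF conth, of u v])
        (use uv supp in \<open>auto simp: h_def subset_iff not_le[symmetric]\<close>)
    moreover have "(\<integral>w. h w \<partial>sphere_measure r) = 0" if r: "r > 0" for r
    proof -
      let ?q = "complex_of_real (product_seq 0 (cutoff (real R)) F (r\<^sup>2))"
      have "(\<integral>w. h w \<partial>sphere_measure r) =
          (\<integral>w. ?q * (f (z - w) * exp (\<i> / 2 * of_real (Im (hdot z w))) * P w) \<partial>sphere_measure r)"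
      proof (rule integral_cong_AE)
        show "h \<in> borel_measurable (sphere_measure r)"
          using borel_measurable_continuous_onI[OF conth] by (simp cong: measurable_cong_sets)
        have "continuous_on UNIV (\<lambda>w. ?q * (f (z - w) * exp (\<i> / 2 * of_real (Im (hdot z w))) * P w))"
          by (intro continuous_intros continuous_on_compose2[OF cont] wpoly_continuous[OF P]) auto
        from borel_measurable_continuous_onI[OF this]
        show "(\<lambda>w. ?q * (f (z - w) * exp (\<i> / 2 * of_real (Im (hdot z w))) * P w)) \<in> borel_measurable (sphere_measure r)"
          by (simp cong: measurable_cong_sets)
        show "AE w in sphere_measure r. h w = ?q * (f (z - w) * exp (\<i> / 2 * of_real (Im (hdot z w))) * P w)"
          using AE_sphere_measure[OF r] by eventually_elim (simp add: h_def g_def)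
      qed
      also have "\<dots> = ?q * twisted_mean f P r z" unfolding twisted_mean_def by simp
      also have "\<dots> = 0"
      proof (cases "r > norm z + B")
        case False
        then have "r \<le> sqrt c" using z by (simp add: \<delta>_def)
        then have "r\<^sup>2 \<le> c" using r by (metis less_eq_real_def real_sqrt_le_iff real_sqrt_abs2 power2_eq_square abs_of_pos)
        then show ?thesis using c(2) by simp
      qed (simp add: mean)
      finally show ?thesis .
    qed
    ultimately have "(\<integral>w. h w \<partial>lborel) = 0" by (rule integral_eq_0_if_sphere_integrals_eq_0)
    then show ?thesis by (simp add: tconv_def h_def)
  qed
  have zeros: "norm z < \<delta> \<Longrightarrow> tconv f (tderivs ds (g R)) z = 0" for R z
  proof (induction ds arbitrary: z)
    case Nil
    then show ?case by (simp add: zero)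
  next
    case (Cons bi ds)
    obtain b i where bi: "bi = (b, i)" by (cases bi)
    have t: "test_fun a (tderivs ds (g R))" by (rule test_fun_tderivs[OF tg])
    show ?case unfolding bi tderivs_simps
      by (rule tconv_tderiv[OF cont test_fun_differentiable[OF t] test_fun_continuous[OF test_fun_wirt[OF t]]
            tderivs_eq_0_outside[OF supp] Cons.IH Cons.prems])
  qed
  have "pairing (tderivs ds (g R)) = 0" for R
    using zeros[of 0 R] \<delta> by (simp add: pairing_def tconv_def hdot_def)
  moreover have "cutoff_limit a (\<lambda>R. tderivs ds (g R)) (tderivs ds (\<lambda>w. P w * of_real (F 0 ((norm w)\<^sup>2))))"
    unfolding g_def by (intro cutoff_limit_tderivs cutoff_limit.base[OF P F])
  ultimately have "(\<lambda>_::nat. 0) \<longlonglongrightarrow> pairing (tderivs ds (\<lambda>w. P w * of_real (F 0 ((norm w)\<^sup>2))))"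
    using pairing_cutoff_limit by force
  then show "pairing (tderivs ds (\<lambda>w. P w * of_real (F 0 ((norm w)\<^sup>2)))) = 0"
    by (simp add: LIMSEQ_const_iff)
qed

end

section \<open>Density of polynomials\<close>

lemma wpoly_mono: "wpoly m P \<Longrightarrow> m \<le> m' \<Longrightarrow> wpoly m' P"
  by (induction m' rule: nat_induct) (auto simp: le_Suc_eq intro: wpoly_Suc)

lemma real_polynomial_mult_wpoly:
  fixes r :: "complex ^ 'n::finite \<Rightarrow> real"
  shows "real_polynomial_function r \<Longrightarrow> wpoly m P \<Longrightarrow> \<exists>k. wpoly k (\<lambda>w. of_real (r w) * P w)"
proof (induction r arbitrary: m P rule: real_polynomial_function.induct)
  case (linear r)
  interpret r: bounded_linear r by fact
  have lin: "r w = (\<Sum>i\<in>UNIV. Re (w $ i) * r (axis i 1) + Im (w $ i) * r (axis i \<i>))" for w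
  proof -
    have "w = (\<Sum>i\<in>UNIV. axis i (w $ i))" by (simp add: vec_eq_iff axis_def if_distrib cong: if_cong)
    also have "\<dots> = (\<Sum>i\<in>UNIV. Re (w $ i) *\<^sub>R axis i 1 + Im (w $ i) *\<^sub>R axis i \<i>)"
      by (intro sum.cong refl) (simp add: vec_eq_iff axis_def complex_eq_iff)
    finally have "r w = r (\<Sum>i\<in>UNIV. Re (w $ i) *\<^sub>R axis i 1 + Im (w $ i) *\<^sub>R axis i \<i>)" by simp
    then show ?thesis by (simp add: r.sum r.add r.scaleR)
  qed
  define x y where "x i = r (axis i 1)" and "y i = r (axis i \<i>)" for i
  have "r w = (\<Sum>i\<in>UNIV. Re (w $ i) * x i + Im (w $ i) * y i)" for w
    unfolding x_def y_def by (rule lin)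
  then have r: "complex_of_real (r w) = (\<Sum>i\<in>UNIV. of_real (Re (w $ i) * x i + Im (w $ i) * y i))" for w
    by (simp only: of_real_sum)
  have split: "complex_of_real (Re z * x + Im z * y) = (of_real x / 2 - \<i> / 2 * of_real y) * z + (of_real x / 2 + \<i> / 2 * of_real y) * cnj z" for z x y
    by (simp add: complex_eq_iff)
  have eq: "of_real (r w) * P w = (\<Sum>i\<in>UNIV. (of_real (x i) / 2 - \<i> / 2 * of_real (y i)) * (coord True i w * P w)
      + (of_real (x i) / 2 + \<i> / 2 * of_real (y i)) * (coord False i w * P w))" for w
    unfolding r split sum_distrib_right coord_def by (simp only: if_True if_False distrib_right mult.assoc)
  have sum: "finite I \<Longrightarrow> (\<And>i. i \<in> I \<Longrightarrow> wpoly k (G i)) \<Longrightarrow> wpoly k (\<lambda>w. \<Sum>i\<in>I. G i w)" for I :: "'n set" and G :: "'n \<Rightarrow> complex ^ 'n \<Rightarrow> complex" and k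
    by (induction I rule: finite_induct) (auto intro: wpoly.intros)
  have "wpoly (Suc m) (\<lambda>w. of_real (r w) * P w)"
    unfolding eq by (intro sum wpoly.add wpoly_cmult wpoly.mult linear) auto
  then show ?case by blast
next
  case (const c)
  then show ?case using wpoly_cmult by blast
next
  case (add r1 r2)
  obtain k where k: "wpoly k (\<lambda>w. of_real (r1 w) * P w)" using add by blast
  obtain l where l: "wpoly l (\<lambda>w. of_real (r2 w) * P w)" using add by blast
  have "wpoly (max k l) (\<lambda>w. of_real (r1 w) * P w + of_real (r2 w) * P w)"
    by (intro wpoly.add wpoly_mono[OF k] wpoly_mono[OF l]) auto
  then show ?case by (auto simp: distrib_right)
next
  case (mult r1 r2)
  obtain l where l: "wpoly l (\<lambda>w. of_real (r2 w) * P w)" using mult by blast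
  obtain k where "wpoly k (\<lambda>w. of_real (r1 w) * (of_real (r2 w) * P w))" using mult.IH(1)[OF l] by blast
  then show ?case by (auto simp: mult.assoc)
qed

lemma polynomial_function_wpoly:
  fixes p :: "complex ^ 'n::finite \<Rightarrow> complex"
  assumes "polynomial_function p"
  shows "\<exists>k. wpoly k p"
proof -
  have "real_polynomial_function (Re \<circ> p)" "real_polynomial_function (Im \<circ> p)"
    using assms bounded_linear_Re bounded_linear_Im unfolding polynomial_function_def by blast+
  then obtain k l where k: "wpoly k (\<lambda>w. of_real (Re (p w)) * 1)" and l: "wpoly l (\<lambda>w. of_real (Im (p w)) * \<i>)"
    using real_polynomial_mult_wpoly[of "Re \<circ> p" 0 "\<lambda>_. 1"] real_polynomial_mult_wpoly[of "Im \<circ> p" 0 "\<lambda>_. \<i>"]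
    by (auto intro: wpoly.const)
  have "wpoly (max k l) (\<lambda>w. of_real (Re (p w)) * 1 + of_real (Im (p w)) * \<i>)"
    by (intro wpoly.add wpoly_mono[OF k] wpoly_mono[OF l]) auto
  also have "(\<lambda>w. of_real (Re (p w)) * 1 + of_real (Im (p w)) * \<i>) = p"
    by (auto simp: complex_eq_iff)
  finally show ?thesis by blast
qed

text \<open>By Stone--Weierstrass the conjugate of \<open>h\<close> is a uniform limit of polynomials on a box
containing the support, hence the integral of \<open>|h|\<^sup>2\<close> vanishes.\<close>

lemma continuous_eq_0_if_orthogonal_to_wpoly:
  fixes h :: "complex ^ 'n::finite \<Rightarrow> complex"
  assumes h: "continuous_on UNIV h" and supp: "\<And>w. norm w > r \<Longrightarrow> h w = 0"
    and orth: "\<And>m P. wpoly m P \<Longrightarrow> (\<integral>w. h w * P w \<partial>lborel) = 0"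
  shows "h w = 0"
proof -
  obtain u v :: "complex ^ 'n" where uv: "cball 0 \<bar>r\<bar> \<subseteq> cbox u v"
    using bounded_subset_cbox_symmetric[of "cball 0 \<bar>r\<bar>"] bounded_cball by metis
  have out: "h w = 0" if "w \<notin> cbox u v" for w
    using that uv by (intro supp) (auto simp: subset_iff not_le[symmetric])
  have int: "integrable lborel (\<lambda>w. h w * q w)" if "continuous_on UNIV q" for q
    by (rule integrable_continuous_compact_support(1)[of _ u v]) (auto intro!: continuous_intros h that simp: out)
  have inth: "integrable lborel h" using int[of "\<lambda>_. 1"] by simp
  define A where "A = (\<integral>w. norm (h w) \<partial>lborel)"
  define Q where "Q = (\<integral>w. h w * cnj (h w) \<partial>lborel)"
  have bound: "norm Q \<le> A * e" if e: "e > 0" for e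
  proof -
    obtain p where p: "polynomial_function p" "\<And>x. x \<in> cbox u v \<Longrightarrow> norm (cnj (h x) - p x) < e"
      using Stone_Weierstrass_polynomial_function[of "cbox u v" "\<lambda>w. cnj (h w)", OF compact_cbox _ e]
        continuous_on_cnj[OF continuous_on_subset[OF h subset_UNIV]] by blast
    obtain k where k: "wpoly k p" using polynomial_function_wpoly[OF p(1)] by blast
    have pc: "continuous_on UNIV p" by (rule wpoly_continuous[OF k])
    have "Q = Q - (\<integral>w. h w * p w \<partial>lborel)" using orth[OF k] by simp
    also have "\<dots> = (\<integral>w. h w * cnj (h w) - h w * p w \<partial>lborel)"
      unfolding Q_def by (intro Bochner_Integration.integral_diff[symmetric] int pc continuous_on_cnj h)
    finally have "norm Q = norm (\<integral>w. h w * cnj (h w) - h w * p w \<partial>lborel)" by simp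
    also have "\<dots> \<le> (\<integral>w. norm (h w * cnj (h w) - h w * p w) \<partial>lborel)"
      by (rule integral_norm_bound)
    also have "\<dots> \<le> (\<integral>w. norm (h w) * e \<partial>lborel)"
    proof (rule integral_mono)
      show "integrable lborel (\<lambda>w. norm (h w * cnj (h w) - h w * p w))"
        by (intro integrable_norm Bochner_Integration.integrable_diff int pc continuous_on_cnj h)
      show "integrable lborel (\<lambda>w. norm (h w) * e)"
        by (intro integrable_mult_left integrable_norm inth)
      fix w
      show "norm (h w * cnj (h w) - h w * p w) \<le> norm (h w) * e"
      proof (cases "w \<in> cbox u v")
        case True
        have "norm (h w * cnj (h w) - h w * p w) = norm (h w) * norm (cnj (h w) - p w)"
          by (simp add: right_diff_distrib flip: norm_mult)
        also have "\<dots> \<le> norm (h w) * e" using p(2)[OF True] by (intro mult_left_mono) auto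
        finally show ?thesis .
      qed (simp add: out)
    qed
    also have "\<dots> = A * e" by (simp add: A_def)
    finally show ?thesis .
  qed
  have "A \<ge> 0" unfolding A_def by (rule Bochner_Integration.integral_nonneg) simp
  have "norm Q \<le> 0"
  proof (rule field_le_epsilon)
    fix e :: real assume e: "e > 0"
    \<comment> \<open>Adding \<open>1\<close> keeps the denominator positive if \<open>A = 0\<close>.\<close>
    have "norm Q \<le> A * (e / (A + 1))" using \<open>A \<ge> 0\<close> e by (intro bound) auto
    also have "\<dots> \<le> e" using \<open>A \<ge> 0\<close> e by (simp add: field_simps)
    finally show "norm Q \<le> 0 + e" by simp
  qed
  then have "Q = 0" by simp
  moreover have "Q = of_real (\<integral>w. (norm (h w))\<^sup>2 \<partial>lborel)"
    unfolding Q_def complex_norm_square[symmetric] by (rule integral_complex_of_real)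
  ultimately have z: "(\<integral>w. (norm (h w))\<^sup>2 \<partial>lborel) = 0" by simp
  have "integrable lborel (\<lambda>w. (norm (h w))\<^sup>2)"
    using integrable_norm[OF int[OF h]] by (simp add: norm_mult power2_eq_square)
  then have "AE w in lborel. (norm (h w))\<^sup>2 = 0"
    using z by (subst (asm) integral_nonneg_eq_0_iff_AE) auto
  then have "AE w in lborel. w \<in> {w. h w = 0}"
    by eventually_elim simp
  then have "AE w in lebesgue. w \<in> {w. h w = 0}" by (rule AE_completion)
  moreover have "closed {w. h w = 0}" by (intro closed_Collect_eq h continuous_on_const)
  ultimately show ?thesis using mem_closed_if_AE_lebesgue by blast
qed

text \<open>Integrability on the sphere makes the twisted mean linear in the polynomial.\<close>

lemma twisted_mean_eq_0_span:
  fixes f :: "complex ^ 'n::finite \<Rightarrow> complex"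
  assumes f: "continuous_on UNIV f" and r: "r > 0"
    and S: "\<And>P. P \<in> S \<Longrightarrow> continuous_on UNIV P \<and> twisted_mean f P r z = 0"
    and P: "P \<in> cfun.span S"
  shows "twisted_mean f P r z = 0"
proof -
  define V where "V = {P. continuous_on UNIV P \<and> twisted_mean f P r z = 0}"
  interpret prob_space "sphere_measure r :: (complex ^ 'n) measure" by (rule prob_space_sphere_measure)
  have int: "integrable (sphere_measure r) (\<lambda>w. f (z - w) * exp (\<i> / 2 * of_real (Im (hdot z w))) * P w)"
    if "continuous_on UNIV P" for P
  proof -
    let ?h = "\<lambda>w. f (z - w) * exp (\<i> / 2 * of_real (Im (hdot z w))) * P w"
    have c: "continuous_on UNIV ?h"
      by (intro continuous_intros continuous_on_compose2[OF f] that) auto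
    have "compact (?h ` sphere 0 r)"
      by (intro compact_continuous_image continuous_on_subset[OF c]) auto
    then obtain K where K: "\<And>w. w \<in> sphere 0 r \<Longrightarrow> norm (?h w) \<le> K"
      using compact_imp_bounded bounded_iff by (metis (no_types, lifting) imageI)
    show ?thesis
    proof (rule integrable_const_bound)
      show "AE w in sphere_measure r. norm (?h w) \<le> K"
        using AE_sphere_measure[OF r] by eventually_elim (rule K)
      show "?h \<in> borel_measurable (sphere_measure r)"
        using borel_measurable_continuous_onI[OF c] by (simp cong: measurable_cong_sets)
    qed
  qed
  have "cfun.subspace V"
  proof (rule cfun.subspaceI)
    show "0 \<in> V" by (simp add: V_def twisted_mean_def zero_fun_def)
    fix P Q assume "P \<in> V" "Q \<in> V"
    then show "P + Q \<in> V"
      using Bochner_Integration.integral_add[OF int int, of P Q]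
      by (auto simp: V_def twisted_mean_def plus_fun_def distrib_left intro: continuous_on_add)
  next
    fix c P assume "P \<in> V"
    then have "continuous_on UNIV P" "twisted_mean f P r z = 0" by (auto simp: V_def)
    then show "cscale_fun c P \<in> V"
      by (auto simp: V_def cscale_fun_def twisted_mean_def mult.left_commute[of _ c] intro!: continuous_intros)
  qed
  moreover have "S \<subseteq> V" using S by (auto simp: V_def)
  ultimately have "cfun.span S \<subseteq> V" by (simp add: cfun.span_minimal)
  then show ?thesis using P by (auto simp: V_def)
qed

section \<open>The support theorem\<close>

theorem theorem1p4:
  fixes s t :: nat and B :: real
    and f :: "complex ^ 'n \<Rightarrow> complex"
    and P :: "nat \<Rightarrow> complex ^ 'n \<Rightarrow> complex"
  assumes "(bihom_harmonics s t :: (complex ^ 'n \<Rightarrow> complex) set) \<noteq> {0}"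
    and "orthonormal_basis_H s t P"
    and "B \<ge> 0"
    and "smooth f"
    and "\<forall>k::nat. \<exists>C::real. \<forall>z. norm z ^ k * norm (f z) \<le> C * exp (- (1 / 4) * (norm z)\<^sup>2)"
    and "\<forall>z r j. r > norm z + B \<longrightarrow> 1 \<le> j \<longrightarrow> j \<le> dim_H TYPE('n) s t \<longrightarrow>
           twisted_mean f (P j) r z = 0"
  shows "\<forall>z. norm z > B \<longrightarrow> f z = 0"
proof (intro allI impI)
  fix z0 :: "complex ^ 'n" assume z0: "norm z0 > B"
  have cont: "continuous_on UNIV f"
    using assms(4) by (auto simp: smooth_def dest: spec[of _ 0])
  interpret gauss_decay f "B\<^sup>2"
    using cont assms(5) by unfold_locales auto
  have basis: "P j \<in> bihom_harmonics s t" if "j \<in> {1..dim_H TYPE('n) s t}" for j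
    using assms(2) that by (auto simp: orthonormal_basis_H_def)
  have span: "cfun.span (P ` {1..dim_H TYPE('n) s t}) = bihom_harmonics s t"
    using assms(2) by (simp add: orthonormal_basis_H_def)
  have wp: "wpoly (s + t) Q" if "Q \<in> bihom_harmonics s t" for Q :: "complex ^ 'n \<Rightarrow> complex"
    using that bihom_wpoly[OF bihom_polys_imp_bihom[of Q s t]] by (simp add: bihom_harmonics_def bidegree_def)
  have ann: "annihilated Q" if "harmonic_bihom (bidegree s t) Q" for Q
  proof -
    have Q: "Q \<in> bihom_harmonics s t" using that by (simp add: harmonic_bihom_iff)
    have mean: "twisted_mean f Q r z = 0" if r: "r > norm z + B" for z r
    proof (rule twisted_mean_eq_0_span[OF cont])
      show "r > 0" using r assms(3) norm_ge_zero[of z] by linarith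
      show "Q \<in> cfun.span (P ` {1..dim_H TYPE('n) s t})" using Q span by simp
      show "continuous_on UNIV R \<and> twisted_mean f R r z = 0" if "R \<in> P ` {1..dim_H TYPE('n) s t}" for R
        using that assms(6) r by (auto intro: wpoly_continuous[OF wp[OF basis]])
    qed
    show ?thesis
      by (rule annihilated_if_twisted_means_vanish[OF wp[OF Q] assms(3) refl mean])
  qed
  have card: "CARD('n) \<ge> 2 \<or> s = 0 \<or> t = 0"
  proof (cases "CARD('n) = 1")
    case True
    \<comment> \<open>As a span, the space contains \<open>0\<close>, so being different from \<open>{0}\<close> it contains a nonzero element.\<close>
    have "0 \<in> (bihom_harmonics s t :: (complex ^ 'n \<Rightarrow> complex) set)"
      using span cfun.span_zero by blast
    then obtain Q :: "complex ^ 'n \<Rightarrow> complex" where Q: "Q \<in> bihom_harmonics s t" "Q \<noteq> 0"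
      using assms(1) by blast
    then have "harmonic_bihom (bidegree s t) Q" "Q \<noteq> (\<lambda>_. 0)"
      by (simp_all add: harmonic_bihom_iff zero_fun_def)
    from harmonic_bihom_card_1[OF this(1) True this(2)] show ?thesis by (simp add: bidegree_def)
  next
    case False
    have "CARD('n) > 0" by simp
    then show ?thesis using False by linarith
  qed
  have one: "annihilated (\<lambda>_. 1)" by (rule annihilated_one[OF ann card])
  \<comment> \<open>A profile supported in \<open>[c, b]\<close> that does not vanish at \<open>|z0|\<^sup>2\<close>.\<close>
  define c where "c = (B\<^sup>2 + (norm z0)\<^sup>2) / 2"
  have "B\<^sup>2 < (norm z0)\<^sup>2" using z0 assms(3) by (intro power_strict_mono) auto
  then have c: "c > B\<^sup>2" "c < (norm z0)\<^sup>2" by (auto simp: c_def)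
  define b where "b = (norm z0)\<^sup>2 + 1"
  define F where "F k = product_seq k (cutoff b) (\<lambda>k x. flat k (x - c))" for k
  have F: "profile (B\<^sup>2) F"
    unfolding F_def by (intro profile_product_cutoff profile_flat c)
  define h where "h w = f (- w) * of_real (F 0 ((norm w)\<^sup>2))" for w
  have "h (- z0) = 0"
  proof (rule continuous_eq_0_if_orthogonal_to_wpoly)
    have "test_fun (B\<^sup>2) (\<lambda>w::complex^'n. 1 * of_real (F 0 ((norm w)\<^sup>2)))"
      by (rule test_fun.base[OF wpoly.const F])
    from continuous_on_mult[OF continuous_reflect test_fun_continuous[OF this]]
    show "continuous_on UNIV h" by (simp add: h_def[abs_def])
    show "h w = 0" if "norm w > sqrt b" for w
    proof -
      have "b \<le> (norm w)\<^sup>2" using that by (simp add: real_sqrt_le_iff less_imp_le sqrt_le_D)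
      then show ?thesis by (simp add: h_def F_def cutoff_eq_0)
    qed
    show "(\<integral>w. h w * Q w \<partial>lborel) = 0" if "wpoly m Q" for m Q
    proof -
      have "null (\<lambda>w. Q w * of_real (F 0 ((norm w)\<^sup>2)))"
        using annihilated_wpoly[OF one that] F by (simp add: annihilated_def)
      then have "pairing (tderivs [] (\<lambda>w. Q w * of_real (F 0 ((norm w)\<^sup>2)))) = 0" unfolding null_def by blast
      then show ?thesis by (simp add: pairing_def h_def ac_simps)
    qed
  qed
  moreover have "F 0 ((norm z0)\<^sup>2) \<noteq> 0"
    using c by (simp add: F_def b_def cutoff_def flat_def)
  ultimately show "f z0 = 0" by (simp add: h_def)
qed

end
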